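(* Let $\mathbb{K}$ be a field and let $\mathcal{C}$ be an essentially small, $\mathrm{Hom}$-finite, Krull–Schmidt, $2$-Calabi–Yau $\mathbb{K}$-linear triangulated category with suspension functor $\Sigma$ and with a basic cluster-tilting object $T=\bigoplus_{i=1}^nT_i$. Then $\mathcal{C}$ has only finitely many isomorphism classes of indecomposable objects if and only if the set \[ L:=\{\ell_X\mid X\in\mathrm{ind}(\mathcal{C})\smallsetminus\mathrm{add}(\Sigma T)\} \] generates the kernel of the canonical projection $\mathbf{g}:K_0^{\mathrm{sp}}(\mathcal{C})\to K_0(\mathcal{C};T)$. In this case, the set $L$ is a basis of the kernel of $\mathbf{g}$, and for any $x\in\ker(\mathbf{g})$, \[ x=\sum_{A\in\mathrm{ind}(\mathcal{C})\smallsetminus\mathrm{add}(\Sigma T)}\frac{\langle x,A\rangle}{\langle\ell_A,A\rangle}\,\ell_A. \]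
   Context: $\mathrm{Hom}$-finite: all $\mathcal{C}(X,Y)$ are finite-dimensional over $\mathbb{K}$. Krull–Schmidt: every object is a finite direct sum of indecomposables, with local endomorphism algebras. $2$-Calabi–Yau: there are isomorphisms of bifunctors $\mathcal{C}(X,\Sigma Y)\cong D\mathcal{C}(Y,\Sigma X)$, $D=\mathrm{Hom}_{\mathbb{K}}(-,\mathbb{K})$. Cluster-tilting: for any $X$, $\mathcal{C}(T,\Sigma X)=0$ if and only if $X\in\mathrm{add}(T)$, where $\mathrm{add}(T)$ is the smallest full additive subcategory containing the $T_i$ and closed under isomorphisms; basic: the $T_i$ are indecomposable and pairwise non-isomorphic. $\mathrm{ind}(\mathcal{C})$ is a set of representatives of isomorphism classes of indecomposable objects. Let $\Lambda=\mathrm{End}_{\mathcal{C}}(T)$ and $F=\mathcal{C}(T,-):\mathcal{C}\to\mathrm{mod}\,\Lambda$ (finite-dimensional right modules). $K_0^{\mathrm{sp}}(\mathcal{C})$ is the split Grothendieck group (free abelian on $\mathrm{ind}(\mathcal{C})$). $K_0(\mathcal{C};T)$ is the quotient of $K_0^{\mathrm{sp}}(\mathcal{C})$ by the relations $[X]+[Z]-[Y]$ for all triangles $X\to Y\to Z\xrightarrow{h}\Sigma X$ such that $h$ factors through an object of $\mathrm{add}(\Sigma T)$. The bilinear form $\langle-,-\rangle:K_0^{\mathrm{sp}}(\mathcal{C})\times K_0^{\mathrm{sp}}(\mathcal{C})\to\mathbb{Z}$ is determined by $\langle X,Y\rangle=\dim_{\mathbb{K}}\mathrm{Hom}_\Lambda(FX,FY)$.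 A triangle $X\xrightarrow{f}Y\xrightarrow{g}Z\xrightarrow{h}\Sigma X$ is almost split if $X,Z$ are indecomposable, $h\ne0$, and any non-section $X\to X'$ factors through $f$ (equivalently any non-retraction $Z'\to Z$ factors through $g$). For $X$ indecomposable there is, up to isomorphism, a unique almost split triangle $X\to E\to\Sigma^{-1}X\to\Sigma X$, and $\ell_X:=[X]+[\Sigma^{-1}X]-[E]\in K_0^{\mathrm{sp}}(\mathcal{C})$. *)

theory Defs
  imports
    Complex_Main
    "HOL-Algebra.Free_Abelian_Groups"
    "HOL-Library.Function_Algebras"
begin

section \<open>Linear categories\<close>

text \<open>
  The objects of a category are the elements of a type, so categories are small; an essentially
  small category is represented by a small category equivalent to it.  Morphism spaces are
  subspaces of one ambient vector space, and a single operation composes all composable pairs.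
  This is no restriction: given any small \<open>K\<close>-linear category, take for the ambient space the
  direct sum of all its Hom spaces, and extend composition by zero to pairs that are not
  composable.  Nothing is required of the operations outside the Hom spaces, and different Hom
  spaces need not be disjoint (they share \<open>0\<close> anyway), which is why all notions below mention
  source and target explicitly.
\<close>

record ('o, 'm, 'k) lin_cat =
  homs :: "'o \<Rightarrow> 'o \<Rightarrow> 'm set"
  ident :: "'o \<Rightarrow> 'm"
  cmp :: "'m \<Rightarrow> 'm \<Rightarrow> 'm"  (infixr "\<cdot>\<index>" 75)
  scl :: "'k \<Rightarrow> 'm \<Rightarrow> 'm"

text \<open>The composite \<open>g \<cdot> f\<close> is ``first \<open>f\<close>, then \<open>g\<close>''.\<close>

locale linear_category = vs: vector_space "scl C"
  for C :: "('o, 'm::ab_group_add, 'k::field, 'z) lin_cat_scheme" (structure) +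
  assumes homs_subspace: "vs.subspace (homs C X Y)"
    and cmp_closed: "\<lbrakk>f \<in> homs C X Y; g \<in> homs C Y Z\<rbrakk> \<Longrightarrow> g \<cdot> f \<in> homs C X Z"
    and cmp_assoc:
      "\<lbrakk>f \<in> homs C W X; g \<in> homs C X Y; h \<in> homs C Y Z\<rbrakk> \<Longrightarrow> (h \<cdot> g) \<cdot> f = h \<cdot> (g \<cdot> f)"
    and ident_closed: "ident C X \<in> homs C X X"
    and ident_left: "f \<in> homs C X Y \<Longrightarrow> ident C Y \<cdot> f = f"
    and ident_right: "f \<in> homs C X Y \<Longrightarrow> f \<cdot> ident C X = f"
    and cmp_add_left:
      "\<lbrakk>f \<in> homs C X Y; g \<in> homs C Y Z; g' \<in> homs C Y Z\<rbrakk> \<Longrightarrow> (g + g') \<cdot> f = g \<cdot> f + g' \<cdot> f"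
    and cmp_add_right:
      "\<lbrakk>f \<in> homs C X Y; f' \<in> homs C X Y; g \<in> homs C Y Z\<rbrakk> \<Longrightarrow> g \<cdot> (f + f') = g \<cdot> f + g \<cdot> f'"
    and cmp_scl_left:
      "\<lbrakk>f \<in> homs C X Y; g \<in> homs C Y Z\<rbrakk> \<Longrightarrow> scl C c g \<cdot> f = scl C c (g \<cdot> f)"
    and cmp_scl_right:
      "\<lbrakk>f \<in> homs C X Y; g \<in> homs C Y Z\<rbrakk> \<Longrightarrow> g \<cdot> scl C c f = scl C c (g \<cdot> f)"

definition isomorphism ::
  "('o, 'm, 'k, 'z) lin_cat_scheme \<Rightarrow> 'o \<Rightarrow> 'o \<Rightarrow> 'm \<Rightarrow> bool" where
  "isomorphism C X Y f \<longleftrightarrow> f \<in> homs C X Y \<and>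
     (\<exists>g\<in>homs C Y X. g \<cdot>\<^bsub>C\<^esub> f = ident C X \<and> f \<cdot>\<^bsub>C\<^esub> g = ident C Y)"

definition isomorphic :: "('o, 'm, 'k, 'z) lin_cat_scheme \<Rightarrow> 'o \<Rightarrow> 'o \<Rightarrow> bool" where
  "isomorphic C X Y \<longleftrightarrow> (\<exists>f. isomorphism C X Y f)"

definition section_mor ::
  "('o, 'm, 'k, 'z) lin_cat_scheme \<Rightarrow> 'o \<Rightarrow> 'o \<Rightarrow> 'm \<Rightarrow> bool" where
  "section_mor C X Y s \<longleftrightarrow> s \<in> homs C X Y \<and> (\<exists>r\<in>homs C Y X. r \<cdot>\<^bsub>C\<^esub> s = ident C X)"

definition zero_object :: "('o, 'm::zero, 'k, 'z) lin_cat_scheme \<Rightarrow> 'o \<Rightarrow> bool" where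
  "zero_object C X \<longleftrightarrow> (\<forall>Y. homs C X Y = {0} \<and> homs C Y X = {0})"

text \<open>\<open>S\<close> is a (bi)product of the finite family \<open>Xs\<close>; for \<open>Xs = []\<close> this says that \<open>S\<close> is a
  zero object.\<close>

definition direct_sum ::
  "('o, 'm::ab_group_add, 'k, 'z) lin_cat_scheme \<Rightarrow> 'o \<Rightarrow> 'o list \<Rightarrow> bool" where
  "direct_sum C S Xs \<longleftrightarrow> (\<exists>i p.
     (\<forall>a<length Xs. i a \<in> homs C (Xs ! a) S \<and> p a \<in> homs C S (Xs ! a)) \<and>
     (\<forall>a<length Xs. \<forall>b<length Xs.
        p a \<cdot>\<^bsub>C\<^esub> i b = (if a = b then ident C (Xs ! a) else 0)) \<and>
     (\<Sum>a<length Xs. i a \<cdot>\<^bsub>C\<^esub> p a) = ident C S)"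

locale additive_category = linear_category +
  assumes ex_zero_object: "\<exists>Z. zero_object C Z"
    and ex_biproduct: "\<exists>S. direct_sum C S [X, Y]"

definition hom_finite ::
  "('o, 'm::ab_group_add, 'k::field, 'z) lin_cat_scheme \<Rightarrow> bool" where
  "hom_finite C \<longleftrightarrow> (\<forall>X Y. \<exists>B. finite B \<and> module.span (scl C) B = homs C X Y)"

definition indecomposable ::
  "('o, 'm::ab_group_add, 'k, 'z) lin_cat_scheme \<Rightarrow> 'o \<Rightarrow> bool" where
  "indecomposable C X \<longleftrightarrow> \<not> zero_object C X \<and>
     (\<forall>A B. direct_sum C X [A, B] \<longrightarrow> zero_object C A \<or> zero_object C B)"

text \<open>The endomorphism ring of \<open>X\<close> is local: it is nonzero and its nonunits are closed under
  addition.\<close>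

definition local_end :: "('o, 'm::ab_group_add, 'k, 'z) lin_cat_scheme \<Rightarrow> 'o \<Rightarrow> bool" where
  "local_end C X \<longleftrightarrow> ident C X \<noteq> 0 \<and>
     (\<forall>f\<in>homs C X X. \<forall>g\<in>homs C X X.
        \<not> isomorphism C X X f \<longrightarrow> \<not> isomorphism C X X g \<longrightarrow> \<not> isomorphism C X X (f + g))"

definition krull_schmidt ::
  "('o, 'm::ab_group_add, 'k, 'z) lin_cat_scheme \<Rightarrow> bool" where
  "krull_schmidt C \<longleftrightarrow>
     (\<forall>X. \<exists>Xs. direct_sum C X Xs \<and> (\<forall>Y\<in>set Xs. indecomposable C Y \<and> local_end C Y))"

text \<open>The smallest full additive subcategory, closed under isomorphisms, that contains the objects
  in \<open>S\<close> (a full subcategory is given by its set of objects).\<close>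

inductive_set add_closure ::
  "('o, 'm::ab_group_add, 'k, 'z) lin_cat_scheme \<Rightarrow> 'o set \<Rightarrow> 'o set"
  for C :: "('o, 'm::ab_group_add, 'k, 'z) lin_cat_scheme" and S :: "'o set" where
  base: "X \<in> S \<Longrightarrow> X \<in> add_closure C S"
| zero: "zero_object C X \<Longrightarrow> X \<in> add_closure C S"
| sum: "\<lbrakk>X \<in> add_closure C S; Y \<in> add_closure C S; direct_sum C Z [X, Y]\<rbrakk>
    \<Longrightarrow> Z \<in> add_closure C S"
| iso: "\<lbrakk>X \<in> add_closure C S; isomorphic C X Y\<rbrakk> \<Longrightarrow> Y \<in> add_closure C S"


section \<open>Triangulated categories\<close>

text \<open>\<open>susp\<close> and \<open>smap\<close> are the suspension functor on objects and on morphisms, and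
  \<open>tri C X Y Z f g h\<close> says that \<open>f : X \<rightarrow> Y\<close>, \<open>g : Y \<rightarrow> Z\<close>, \<open>h : Z \<rightarrow> susp X\<close> form a
  distinguished triangle.\<close>

record ('o, 'm, 'k) tri_cat = "('o, 'm, 'k) lin_cat" +
  susp :: "'o \<Rightarrow> 'o"
  smap :: "'m \<Rightarrow> 'm"
  tri :: "'o \<Rightarrow> 'o \<Rightarrow> 'o \<Rightarrow> 'm \<Rightarrow> 'm \<Rightarrow> 'm \<Rightarrow> bool"

text \<open>The suspension is only required to be a \<open>K\<close>-linear autoequivalence, not an automorphism.
  \<open>tri_octahedral\<close> is Verdier's axiom for the composite \<open>v \<cdot> u\<close>.\<close>

locale triangulated_category = additive_category C
  for C :: "('o, 'm::ab_group_add, 'k::field, 'z) tri_cat_scheme" (structure) +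
  assumes smap_ident: "smap C (ident C X) = ident C (susp C X)"
    and smap_cmp:
      "\<lbrakk>f \<in> homs C X Y; g \<in> homs C Y Z\<rbrakk> \<Longrightarrow> smap C (g \<cdot> f) = smap C g \<cdot> smap C f"
    and smap_add:
      "\<lbrakk>f \<in> homs C X Y; g \<in> homs C X Y\<rbrakk> \<Longrightarrow> smap C (f + g) = smap C f + smap C g"
    and smap_scl: "f \<in> homs C X Y \<Longrightarrow> smap C (scl C r f) = scl C r (smap C f)"
    and smap_fully_faithful:
      "bij_betw (smap C) (homs C X Y) (homs C (susp C X) (susp C Y))"
    and susp_essentially_surjective: "\<exists>Y. isomorphic C (susp C Y) X"
    and tri_homs:
      "tri C X Y Z f g h \<Longrightarrow> f \<in> homs C X Y \<and> g \<in> homs C Y Z \<and> h \<in> homs C Z (susp C X)"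
    and tri_iso:
      "\<lbrakk>tri C X Y Z f g h;
        f' \<in> homs C X' Y'; g' \<in> homs C Y' Z'; h' \<in> homs C Z' (susp C X');
        isomorphism C X X' a; isomorphism C Y Y' b; isomorphism C Z Z' c;
        f' \<cdot> a = b \<cdot> f; g' \<cdot> b = c \<cdot> g; h' \<cdot> c = smap C a \<cdot> h\<rbrakk>
       \<Longrightarrow> tri C X' Y' Z' f' g' h'"
    and tri_ident: "zero_object C Z \<Longrightarrow> tri C X X Z (ident C X) 0 0"
    and tri_exists: "f \<in> homs C X Y \<Longrightarrow> \<exists>Z g h. tri C X Y Z f g h"
    and tri_rotate:
      "\<lbrakk>f \<in> homs C X Y; g \<in> homs C Y Z; h \<in> homs C Z (susp C X)\<rbrakk>
       \<Longrightarrow> tri C X Y Z f g h \<longleftrightarrow> tri C Y Z (susp C X) g h (- smap C f)"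
    and tri_morphism:
      "\<lbrakk>tri C X Y Z f g h; tri C X' Y' Z' f' g' h';
        a \<in> homs C X X'; b \<in> homs C Y Y'; f' \<cdot> a = b \<cdot> f\<rbrakk>
       \<Longrightarrow> \<exists>c\<in>homs C Z Z'. g' \<cdot> b = c \<cdot> g \<and> h' \<cdot> c = smap C a \<cdot> h"
    and tri_octahedral:
      "\<lbrakk>tri C X Y Z' u j k; tri C Y Z X' v l i; tri C X Z Y' (v \<cdot> u) m n\<rbrakk>
       \<Longrightarrow> \<exists>f g. tri C Z' Y' X' f g (smap C j \<cdot> i) \<and>
             f \<cdot> j = m \<cdot> v \<and> n \<cdot> f = k \<and> g \<cdot> m = l \<and> i \<cdot> g = smap C u \<cdot> n"

text \<open>The dual of the subspace \<open>V\<close>.  Functionals are normalised to be \<open>undefined\<close> outside \<open>V\<close>, so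
  that equality is equality on \<open>V\<close>.\<close>

definition dual_space ::
  "('k \<Rightarrow> 'm \<Rightarrow> 'm) \<Rightarrow> 'm set \<Rightarrow> ('m::ab_group_add \<Rightarrow> 'k::field) set" where
  "dual_space s V = {\<xi> \<in> extensional V.
     (\<forall>x\<in>V. \<forall>y\<in>V. \<xi> (x + y) = \<xi> x + \<xi> y) \<and> (\<forall>c. \<forall>x\<in>V. \<xi> (s c x) = c * \<xi> x)}"

text \<open>\<open>\<phi> X Y\<close> is a linear isomorphism from \<open>Hom X (susp Y)\<close> onto the dual of \<open>Hom Y (susp X)\<close>; the
  last clause is naturality in \<open>X\<close> and \<open>Y\<close> simultaneously.\<close>

definition two_calabi_yau ::
  "('o, 'm::ab_group_add, 'k::field, 'z) tri_cat_scheme \<Rightarrow> bool" where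
  "two_calabi_yau C \<longleftrightarrow> (\<exists>\<phi> :: 'o \<Rightarrow> 'o \<Rightarrow> 'm \<Rightarrow> 'm \<Rightarrow> 'k.
     (\<forall>X Y. bij_betw (\<phi> X Y) (homs C X (susp C Y))
              (dual_space (scl C) (homs C Y (susp C X)))) \<and>
     (\<forall>X Y. \<forall>f\<in>homs C X (susp C Y). \<forall>f'\<in>homs C X (susp C Y). \<forall>g\<in>homs C Y (susp C X).
        \<phi> X Y (f + f') g = \<phi> X Y f g + \<phi> X Y f' g) \<and>
     (\<forall>X Y c. \<forall>f\<in>homs C X (susp C Y). \<forall>g\<in>homs C Y (susp C X).
        \<phi> X Y (scl C c f) g = c * \<phi> X Y f g) \<and>
     (\<forall>X X' Y Y'. \<forall>u\<in>homs C X' X. \<forall>v\<in>homs C Y Y'.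
        \<forall>f\<in>homs C X (susp C Y). \<forall>g\<in>homs C Y' (susp C X').
        \<phi> X' Y' (smap C v \<cdot>\<^bsub>C\<^esub> f \<cdot>\<^bsub>C\<^esub> u) g = \<phi> X Y f (smap C u \<cdot>\<^bsub>C\<^esub> g \<cdot>\<^bsub>C\<^esub> v)))"

text \<open>The list \<open>Ts\<close> consists of the summands of \<open>T\<close>; \<open>add(T)\<close> is \<open>add_closure C (set Ts)\<close>.\<close>

definition basic_cluster_tilting ::
  "('o, 'm::ab_group_add, 'k, 'z) tri_cat_scheme \<Rightarrow> 'o \<Rightarrow> 'o list \<Rightarrow> bool" where
  "basic_cluster_tilting C T Ts \<longleftrightarrow>
     direct_sum C T Ts \<and>
     (\<forall>a<length Ts. indecomposable C (Ts ! a)) \<and>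
     (\<forall>a<length Ts. \<forall>b<length Ts. a \<noteq> b \<longrightarrow> \<not> isomorphic C (Ts ! a) (Ts ! b)) \<and>
     (\<forall>X. homs C T (susp C X) = {0} \<longleftrightarrow> X \<in> add_closure C (set Ts))"

definition add_susp ::
  "('o, 'm::ab_group_add, 'k, 'z) tri_cat_scheme \<Rightarrow> 'o list \<Rightarrow> 'o set" where
  "add_susp C Ts = add_closure C (susp C ` set Ts)"


section \<open>Grothendieck groups\<close>

definition indec_iso_classes ::
  "('o, 'm::ab_group_add, 'k, 'z) lin_cat_scheme \<Rightarrow> 'o set set" where
  "indec_iso_classes C = {{Y. isomorphic C X Y} | X. indecomposable C X}"

text \<open>\<open>I\<close> is a set of representatives of the isomorphism classes of indecomposable objects.\<close>

definition indec_representatives ::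
  "('o, 'm::ab_group_add, 'k, 'z) lin_cat_scheme \<Rightarrow> 'o set \<Rightarrow> bool" where
  "indec_representatives C I \<longleftrightarrow>
     (\<forall>X\<in>I. indecomposable C X) \<and>
     (\<forall>X. indecomposable C X \<longrightarrow> (\<exists>!Y. Y \<in> I \<and> isomorphic C X Y))"

text \<open>The split Grothendieck group is the free abelian group on \<open>I\<close>, where \<open>I\<close> always is a set of
  representatives as above.  The class of an object is well defined by the Krull-Schmidt theorem.\<close>

abbreviation K0_split :: "'o set \<Rightarrow> ('o \<Rightarrow>\<^sub>0 int) monoid" where
  "K0_split I \<equiv> free_Abelian_group I"

definition cls ::
  "('o, 'm::ab_group_add, 'k, 'z) lin_cat_scheme \<Rightarrow> 'o set \<Rightarrow> 'o \<Rightarrow> ('o \<Rightarrow>\<^sub>0 int)" where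
  "cls C I X = (THE c. \<exists>Ys. set Ys \<subseteq> I \<and> direct_sum C X Ys \<and> c = (\<Sum>Y\<leftarrow>Ys. frag_of Y))"

definition K0_relations ::
  "('o, 'm::ab_group_add, 'k, 'z) tri_cat_scheme \<Rightarrow> 'o set \<Rightarrow> 'o list \<Rightarrow> ('o \<Rightarrow>\<^sub>0 int) set" where
  "K0_relations C I Ts = {cls C I X + cls C I Z - cls C I Y | X Y Z f g h.
     tri C X Y Z f g h \<and>
     (\<exists>W\<in>add_susp C Ts. \<exists>a\<in>homs C Z W. \<exists>b\<in>homs C W (susp C X). h = b \<cdot>\<^bsub>C\<^esub> a)}"

definition K0_relation_subgroup ::
  "('o, 'm::ab_group_add, 'k, 'z) tri_cat_scheme \<Rightarrow> 'o set \<Rightarrow> 'o list \<Rightarrow> ('o \<Rightarrow>\<^sub>0 int) set" where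
  "K0_relation_subgroup C I Ts = generate (K0_split I) (K0_relations C I Ts)"

definition K0_rel ::
  "('o, 'm::ab_group_add, 'k, 'z) tri_cat_scheme \<Rightarrow> 'o set \<Rightarrow> 'o list \<Rightarrow> ('o \<Rightarrow>\<^sub>0 int) set monoid"
  where "K0_rel C I Ts = K0_split I Mod K0_relation_subgroup C I Ts"

definition g_proj ::
  "('o, 'm::ab_group_add, 'k, 'z) tri_cat_scheme \<Rightarrow> 'o set \<Rightarrow> 'o list
    \<Rightarrow> ('o \<Rightarrow>\<^sub>0 int) \<Rightarrow> ('o \<Rightarrow>\<^sub>0 int) set" where
  "g_proj C I Ts x = K0_relation_subgroup C I Ts #>\<^bsub>K0_split I\<^esub> x"


section \<open>The bilinear form\<close>

text \<open>\<open>F X\<close> is \<open>homs C T X\<close>, on which the endomorphism algebra of \<open>T\<close> acts from the right by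
  precomposition.  Module homomorphisms \<open>F X \<rightarrow> F Y\<close> are normalised to vanish outside \<open>F X\<close>, so that
  they form a subspace of the space of all functions with pointwise operations.  They are
  automatically \<open>K\<close>-linear, since \<open>scl C c x = x \<cdot> scl C c (ident C T)\<close>.\<close>

definition Lambda_homs ::
  "('o, 'm::ab_group_add, 'k, 'z) lin_cat_scheme \<Rightarrow> 'o \<Rightarrow> 'o \<Rightarrow> 'o \<Rightarrow> ('m \<Rightarrow> 'm) set" where
  "Lambda_homs C T X Y = {\<psi>.
     (\<forall>x. x \<notin> homs C T X \<longrightarrow> \<psi> x = 0) \<and>
     (\<forall>x\<in>homs C T X. \<psi> x \<in> homs C T Y) \<and>
     (\<forall>x\<in>homs C T X. \<forall>y\<in>homs C T X. \<psi> (x + y) = \<psi> x + \<psi> y) \<and>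
     (\<forall>x\<in>homs C T X. \<forall>a\<in>homs C T T. \<psi> (x \<cdot>\<^bsub>C\<^esub> a) = \<psi> x \<cdot>\<^bsub>C\<^esub> a)}"

definition dim_Lambda_homs ::
  "('o, 'm::ab_group_add, 'k::field, 'z) lin_cat_scheme \<Rightarrow> 'o \<Rightarrow> 'o \<Rightarrow> 'o \<Rightarrow> nat" where
  "dim_Lambda_homs C T X Y =
     vector_space.dim (\<lambda>c \<psi> x. scl C c (\<psi> x)) (Lambda_homs C T X Y)"

text \<open>The bilinear extension of \<open>dim_Lambda_homs\<close> from the basis of indecomposable objects.\<close>

definition K0_form ::
  "('o, 'm::ab_group_add, 'k::field, 'z) lin_cat_scheme \<Rightarrow> 'o
    \<Rightarrow> ('o \<Rightarrow>\<^sub>0 int) \<Rightarrow> ('o \<Rightarrow>\<^sub>0 int) \<Rightarrow> int" where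
  "K0_form C T x y = (\<Sum>A\<in>Poly_Mapping.keys x. \<Sum>B\<in>Poly_Mapping.keys y.
     Poly_Mapping.lookup x A * Poly_Mapping.lookup y B * int (dim_Lambda_homs C T A B))"


section \<open>Almost split triangles\<close>

definition almost_split ::
  "('o, 'm::ab_group_add, 'k, 'z) tri_cat_scheme \<Rightarrow> 'o \<Rightarrow> 'o \<Rightarrow> 'o \<Rightarrow> 'm \<Rightarrow> 'm \<Rightarrow> 'm \<Rightarrow> bool" where
  "almost_split C X Y Z f g h \<longleftrightarrow>
     tri C X Y Z f g h \<and> indecomposable C X \<and> indecomposable C Z \<and> h \<noteq> 0 \<and>
     (\<forall>X'. \<forall>u\<in>homs C X X'. \<not> section_mor C X X' u \<longrightarrow> (\<exists>u'\<in>homs C Y X'. u = u' \<cdot>\<^bsub>C\<^esub> f))"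

text \<open>The inverse suspension is determined up to isomorphism, which is all that matters for classes
  in the Grothendieck group.\<close>

definition susp_inv ::
  "('o, 'm::ab_group_add, 'k, 'z) tri_cat_scheme \<Rightarrow> 'o \<Rightarrow> 'o" where
  "susp_inv C X = (SOME Y. isomorphic C (susp C Y) X)"

definition ell ::
  "('o, 'm::ab_group_add, 'k, 'z) tri_cat_scheme \<Rightarrow> 'o set \<Rightarrow> 'o \<Rightarrow> ('o \<Rightarrow>\<^sub>0 int)" where
  "ell C I X = (THE l. \<exists>E f g h. almost_split C X E (susp_inv C X) f g h \<and>
     l = cls C I X + cls C I (susp_inv C X) - cls C I E)"

end

theory Submission
  imports Defs
begin


text \<open>
  Write \<open>F = Hom(T, -)\<close> and \<open>J\<close> for the representatives outside \<open>add(susp T)\<close>.  By the cluster-tilting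
  condition, a morphism factors through \<open>add(susp T)\<close> if and only if \<open>F\<close> kills it
  (\<open>F_null_factors\<close>), so the kernel of the projection is generated by the defects
  \<open>[X] + [Z] - [Y]\<close> of the triangles \<open>X \<rightarrow> Y \<rightarrow> Z \<rightarrow> susp X\<close> whose last morphism is killed by \<open>F\<close>.  For
  such a triangle \<open>F X \<rightarrow> F Y \<rightarrow> F Z \<rightarrow> 0\<close> is exact; hence \<open>\<langle>defect, B\<rangle>\<close> is the dimension of the
  cokernel of \<open>Hom(F Y, F B) \<rightarrow> Hom(F X, F B)\<close> and in particular nonnegative (\<open>pairing_defect\<close>).

  For \<open>A\<close> in \<open>J\<close> the almost split triangle starting in \<open>A\<close> is of this kind.  Since \<open>F\<close> is full
  (\<open>induced_surj\<close>), its defect \<open>ell A\<close> pairs to zero with every other element of \<open>J\<close> and to a positive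
  number with \<open>A\<close> itself (\<open>pairing_ell_other\<close>, \<open>pairing_ell_self\<close>).  This orthogonality makes the
  elements \<open>ell A\<close> linearly independent, and it yields the coefficients of every element of their span.

  Suppose that there are only finitely many indecomposable objects.  A triangle as above with nonzero
  last morphism \<open>h\<close> has a component \<open>q\<close>, the composite of \<open>h\<close> with the suspension of some \<open>X \<rightarrow> A\<close>, that
  generates a simple functor (\<open>ex_minimal_component\<close>).  It factors through the almost split triangle
  of \<open>A\<close> by a retraction, and two split octahedra then produce a triangle of the same kind whose defect
  is smaller by exactly \<open>ell A\<close> (\<open>defect_step\<close>).  As pairings with defects are nonnegative, this
  process stops, and every defect is a sum of elements \<open>ell A\<close> (\<open>defect_in_generate_L\<close>).

  Conversely, the triangle \<open>T \<rightarrow> 0 \<rightarrow> susp T\<close> has a defect that pairs nontrivially with every element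
  of \<open>J\<close>, while an element of the span of the \<open>ell A\<close> pairs nontrivially with finitely many only
  (\<open>generate_imp_finite\<close>).  So if the \<open>ell A\<close> generate the kernel, then \<open>J\<close> is finite, and the remaining
  indecomposable objects are the suspended summands of \<open>T\<close>.
\<close>

section \<open>Linear algebra on finite-dimensional subspaces\<close>

text \<open>Composition and suspension are linear on the Hom spaces only, and the ambient space of all morphisms may
  have infinite dimension, so both linearity and finite dimension are properties relative to a subspace.\<close>

definition linear_within ::
  "('k \<Rightarrow> 'v \<Rightarrow> 'v) \<Rightarrow> ('k \<Rightarrow> 'w \<Rightarrow> 'w) \<Rightarrow> ('v::ab_group_add) set \<Rightarrow> ('v \<Rightarrow> 'w::ab_group_add) \<Rightarrow> bool" where
  "linear_within s1 s2 V f \<longleftrightarrow> (\<forall>x\<in>V. \<forall>y\<in>V. f (x + y) = f x + f y) \<and> (\<forall>c. \<forall>x\<in>V. f (s1 c x) = s2 c (f x))"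

text \<open>A copy of the locale \<open>vector_space\<close>, so that the constants introduced below are not also
  introduced for every real vector space.\<close>

locale subspace_theory = vector_space
begin

definition fin_subspace :: "'b set \<Rightarrow> bool" where
  "fin_subspace V \<longleftrightarrow> subspace V \<and> (\<exists>B. finite B \<and> span B = V)"

lemma fin_subspace_subset:
  assumes V: "fin_subspace V" and W: "subspace W" "W \<subseteq> V"
  shows "fin_subspace W"
proof -
  obtain F where F: "finite F" "span F = V" using V by (auto simp: fin_subspace_def)
  obtain B where B: "B \<subseteq> W" "independent B" "W \<subseteq> span B"
    by (rule maximal_independent_subset)
  have "finite B" using independent_span_bound[OF F(1) B(2)] B(1) W(2) F(2) by auto
  moreover have "span B = W" by (rule span_subspace[OF B(1,3) W(1)])
  ultimately show ?thesis using W by (auto simp: fin_subspace_def)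
qed

lemma fin_subspace_basis_extend:
  assumes V: "fin_subspace V" and N: "subspace N" "N \<subseteq> V"
  obtains A B where "A \<subseteq> B" "finite B" "independent B" "span A = N" "span B = V"
proof -
  obtain F where F: "finite F" "span F = V" using V by (auto simp: fin_subspace_def)
  have sV: "subspace V" using V by (simp add: fin_subspace_def)
  obtain A where A: "A \<subseteq> N" "independent A" "N \<subseteq> span A"
    by (rule maximal_independent_subset)
  have "A \<subseteq> V" using A N by blast
  then obtain B where B: "A \<subseteq> B" "B \<subseteq> V" "independent B" "V \<subseteq> span B"
    using maximal_independent_subset_extend[of A V] A by metis
  have "finite B" using independent_span_bound[OF F(1) B(3)] B(2) F(2) by auto
  moreover have "span A = N" by (rule span_subspace[OF A(1,3) N(1)])
  moreover have "span B = V" by (rule span_subspace[OF B(2,4) sV])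
  ultimately show thesis using that B by blast
qed

lemma span_Int_span_Diff:
  assumes "independent B" "finite B" "A \<subseteq> B" "x \<in> span A" "x \<in> span (B - A)"
  shows "x = 0"
proof -
  have fA: "finite A" using assms finite_subset by blast
  obtain u where u: "x = (\<Sum>v\<in>A. u v *s v)" using assms(4) span_finite[OF fA] by auto
  obtain w where w: "x = (\<Sum>v\<in>B-A. w v *s v)"
    using assms(5) span_finite[of "B - A"] assms(2) by auto
  let ?z = "\<lambda>v. if v \<in> A then u v else - w v"
  have "(\<Sum>v\<in>B. ?z v *s v) = (\<Sum>v\<in>B-A. ?z v *s v) + (\<Sum>v\<in>A. ?z v *s v)"
    using assms by (simp add: sum.subset_diff)
  also have "(\<Sum>v\<in>A. ?z v *s v) = x" unfolding u by (rule sum.cong) auto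
  also have "(\<Sum>v\<in>B-A. ?z v *s v) = - x" unfolding w by (simp add: sum_negf[symmetric] scale_minus_left)
  finally have "(\<Sum>v\<in>B. ?z v *s v) = 0" by simp
  then have "?z v = 0" if "v \<in> B" for v
    using independentD[OF assms(1,2) order_refl, of ?z v] that by blast
  then have "u v = 0" if "v \<in> A" for v using assms(3) that by (metis subsetD)
  then show ?thesis unfolding u by simp
qed

lemma fin_subspace_dim_less:
  assumes V: "fin_subspace V" and N: "subspace N" "N \<subseteq> V" "N \<noteq> V"
  shows "dim N < dim V"
proof -
  obtain A B where AB: "A \<subseteq> B" "finite B" "independent B" "span A = N" "span B = V"
    using fin_subspace_basis_extend[OF V N(1,2)] .
  have "independent A" using AB independent_mono by blast
  then have "dim N = card A" "dim V = card B" using AB dim_span_eq_card_independent by metis+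
  moreover have "A \<subset> B" using AB N by blast
  ultimately show ?thesis using AB psubset_card_mono by metis
qed

lemma ex_functional_separating:
  assumes R: "subspace R" and t: "t \<notin> R"
  shows "\<exists>\<xi>. (\<forall>x y. \<xi> (x + y) = \<xi> x + \<xi> y) \<and> (\<forall>c x. \<xi> (c *s x) = c * \<xi> x) \<and> (\<forall>x\<in>R. \<xi> x = 0) \<and> \<xi> t = 1"
proof -
  interpret k: vector_space "(*) :: 'a \<Rightarrow> 'a \<Rightarrow> 'a" by unfold_locales (simp_all add: distrib_left distrib_right mult.assoc)
  interpret p: vector_space_pair scale "(*) :: 'a \<Rightarrow> 'a \<Rightarrow> 'a" ..
  obtain B where B: "B \<subseteq> R" "independent B" "R \<subseteq> span B"
    by (rule maximal_independent_subset)
  have sB: "span B = R" by (rule span_subspace[OF B(1,3) R])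
  then have i: "independent (insert t B)" using B t by (auto simp: independent_insert)
  obtain g where g: "Vector_Spaces.linear scale (*) g" "\<forall>x\<in>insert t B. g x = (if x = t then 1 else 0)"
    using p.linear_independent_extend[OF i, of "\<lambda>x. if x = t then 1 else 0"] by blast
  have tB: "t \<notin> B" using B t by auto
  have "g x = 0" if "x \<in> R" for x
  proof (rule p.linear_eq_0_on_span[OF g(1), of B])
    show "g y = 0" if "y \<in> B" for y using g(2) tB that by auto
    show "x \<in> span B" using that sB by simp
  qed
  moreover have "g t = 1" using g(2) by simp
  moreover have "g (x + y) = g x + g y" "g (c *s x) = c * g x" for x y c
    using p.linear_add[OF g(1)] p.linear_scale[OF g(1)] by auto
  ultimately show ?thesis by blast
qed

end

locale subspace_theory_pair = vs1: subspace_theory s1 + vs2: subspace_theory s2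
  for s1 :: "'k::field \<Rightarrow> 'v::ab_group_add \<Rightarrow> 'v" and s2 :: "'k \<Rightarrow> 'w::ab_group_add \<Rightarrow> 'w"
begin

sublocale vector_space_pair s1 s2 ..

lemma linear_within_extend:
  assumes V: "vs1.subspace V" and f: "linear_within s1 s2 V f"
  obtains g where "Vector_Spaces.linear s1 s2 g" "\<forall>x\<in>V. g x = f x"
proof -
  obtain B where B: "B \<subseteq> V" "vs1.independent B" "V \<subseteq> vs1.span B"
    by (rule vs1.maximal_independent_subset)
  obtain g where g: "Vector_Spaces.linear s1 s2 g" "\<forall>x\<in>B. g x = f x"
    using linear_independent_extend[OF B(2)] by blast
  have f0: "f 0 = 0" using f vs1.subspace_0[OF V] unfolding linear_within_def
    by (metis vs1.scale_zero_left vs2.scale_zero_left)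
  have "vs1.subspace {x\<in>V. g x = f x}"
    using V f g(1) f0 unfolding vs1.subspace_def linear_within_def
    by (auto simp: linear_0[OF g(1)] linear_add[OF g(1)] linear_scale[OF g(1)])
  then have "vs1.span B \<subseteq> {x\<in>V. g x = f x}"
    using g(2) B(1) by (intro vs1.span_minimal) auto
  then show thesis using that g(1) B(3) by blast
qed

lemma fin_subspace_image:
  assumes V: "vs1.fin_subspace V" and f: "linear_within s1 s2 V f"
  shows "vs2.fin_subspace (f ` V)"
proof -
  have sV: "vs1.subspace V" using V by (simp add: vs1.fin_subspace_def)
  obtain g where g: "Vector_Spaces.linear s1 s2 g" "\<forall>x\<in>V. g x = f x"
    using linear_within_extend[OF sV f] .
  obtain F where F: "finite F" "vs1.span F = V" using V by (auto simp: vs1.fin_subspace_def)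
  have "f ` V = g ` V" using g(2) by auto
  also have "\<dots> = vs2.span (g ` F)" using linear_span_image[OF g(1)] F by simp
  finally show ?thesis using F(1) unfolding vs2.fin_subspace_def by (metis finite_imageI vs2.subspace_span)
qed

text \<open>A basis of the kernel extends to a basis of \<open>V\<close>, and \<open>f\<close> maps the added vectors injectively onto a
  basis of the image.\<close>

lemma rank_nullity_within:
  assumes V: "vs1.fin_subspace V" and f: "linear_within s1 s2 V f"
  shows "vs1.subspace {x\<in>V. f x = 0}"
    and "vs1.dim V = vs1.dim {x\<in>V. f x = 0} + vs2.dim (f ` V)"
proof -
  have sV: "vs1.subspace V" using V by (simp add: vs1.fin_subspace_def)
  obtain g where g: "Vector_Spaces.linear s1 s2 g" "\<forall>x\<in>V. g x = f x"
    using linear_within_extend[OF sV f] .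
  let ?N = "{x\<in>V. f x = 0}"
  have N_eq: "?N = V \<inter> {x. g x = 0}" using g(2) by auto
  show sN: "vs1.subspace ?N" unfolding N_eq
    using sV linear_subspace_kernel[OF g(1)] by (rule vs1.subspace_inter)
  obtain A B where AB: "A \<subseteq> B" "finite B" "vs1.independent B" "vs1.span A = ?N" "vs1.span B = V"
    using vs1.fin_subspace_basis_extend[OF V sN] by auto
  let ?D = "B - A"
  have spD: "vs1.span ?D \<subseteq> V" using AB(5) vs1.span_mono[of ?D B] by auto
  have inj: "inj_on g (vs1.span ?D)"
  proof (subst linear_inj_on_iff_eq_0[OF g(1) vs1.subspace_span], intro ballI impI)
    fix x assume x: "x \<in> vs1.span ?D" "g x = 0"
    then have "x \<in> vs1.span A" using AB(4) spD g(2) by auto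
    then show "x = 0" using vs1.span_Int_span_Diff[OF AB(3,2,1)] x(1) by blast
  qed
  have iD: "vs1.independent ?D" using AB(3) vs1.independent_mono by blast
  have "vs2.independent (g ` ?D)"
    by (rule linear_independent_injective_image[OF g(1) iD inj])
  moreover have "vs2.span (g ` ?D) = f ` V"
  proof -
    have "g a = 0" if "a \<in> A" for a
    proof -
      have "a \<in> vs1.span A" using that by (rule vs1.span_base)
      then show ?thesis using AB(4) g(2) by auto
    qed
    then have "g ` B \<subseteq> insert 0 (g ` ?D)" by auto
    then have "vs2.span (g ` B) \<subseteq> vs2.span (g ` ?D)"
      using vs2.span_mono[of "g ` B" "insert 0 (g ` ?D)"] by simp
    moreover have "vs2.span (g ` ?D) \<subseteq> vs2.span (g ` B)" by (intro vs2.span_mono) auto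
    moreover have "vs2.span (g ` B) = g ` V" using linear_span_image[OF g(1), of B] AB(5) by simp
    moreover have "g ` V = f ` V" using g(2) by auto
    ultimately show ?thesis by auto
  qed
  ultimately have "vs2.dim (f ` V) = card (g ` ?D)"
    using vs2.dim_span_eq_card_independent by metis
  also have "\<dots> = card ?D"
    using inj_on_subset[OF inj vs1.span_superset] by (rule card_image)
  finally have d: "vs2.dim (f ` V) = card ?D" .
  have "vs1.dim ?N = card A"
    using AB vs1.independent_mono[OF AB(3,1)] vs1.dim_span_eq_card_independent by metis
  moreover have "vs1.dim V = card B"
    using AB(3,5) vs1.dim_span_eq_card_independent by metis
  moreover have "card B = card A + card ?D"
    using AB(1,2) by (metis card_Diff_subset card_mono finite_subset le_add_diff_inverse)
  ultimately show "vs1.dim V = vs1.dim ?N + vs2.dim (f ` V)" using d by simp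
qed

end

context subspace_theory
begin

lemma dim_zero_space: "dim {0} = 0"
  using dim_span_eq_card_independent[OF independent_empty] by simp

text \<open>The common kernels \<open>V_k\<close> of the first \<open>k\<close> projections filter \<open>V\<close>, and the \<open>k\<close>-th projection maps
  \<open>V_k\<close> onto the \<open>k\<close>-th summand with kernel \<open>V_(k+1)\<close>.\<close>

lemma dim_direct_sum:
  fixes n :: nat
  assumes V: "fin_subspace V"
    and W: "\<And>a. a < n \<Longrightarrow> subspace (W a)"
    and p: "\<And>a x. a < n \<Longrightarrow> x \<in> V \<Longrightarrow> p a x \<in> W a"
    and lin: "\<And>a. a < n \<Longrightarrow> linear_within scale scale V (p a)"
    and i: "\<And>a x. a < n \<Longrightarrow> x \<in> W a \<Longrightarrow> i a x \<in> V"
    and pi: "\<And>a x. a < n \<Longrightarrow> x \<in> W a \<Longrightarrow> p a (i a x) = x"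
    and pi0: "\<And>a b x. a < n \<Longrightarrow> b < n \<Longrightarrow> a \<noteq> b \<Longrightarrow> x \<in> W b \<Longrightarrow> p a (i b x) = 0"
    and inj: "\<And>x. x \<in> V \<Longrightarrow> (\<And>a. a < n \<Longrightarrow> p a x = 0) \<Longrightarrow> x = 0"
  shows "dim V = (\<Sum>a<n. dim (W a))"
proof -
  interpret vp: subspace_theory_pair scale scale ..
  define U where "U k = {x\<in>V. \<forall>a<k. p a x = 0}" for k
  have sV: "subspace V" using V by (simp add: fin_subspace_def)
  have USuc: "U (Suc k) = {x\<in>U k. p k x = 0}" for k by (auto simp: U_def less_Suc_eq)
  have main: "fin_subspace (U k) \<and> dim V = dim (U k) + (\<Sum>a<k. dim (W a))" if "k \<le> n" for k
    using that
  proof (induction k)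
    case 0
    then show ?case using V by (simp add: U_def)
  next
    case (Suc k)
    then have k: "k < n" and IH: "fin_subspace (U k)" "dim V = dim (U k) + (\<Sum>a<k. dim (W a))" by auto
    have l: "linear_within scale scale (U k) (p k)"
      using lin[OF k] by (auto simp: linear_within_def U_def)
    have im: "p k ` U k = W k"
    proof
      show "p k ` U k \<subseteq> W k" using p[OF k] by (auto simp: U_def)
      show "W k \<subseteq> p k ` U k"
      proof
        fix x assume x: "x \<in> W k"
        have "i k x \<in> U k" using i[OF k x] pi0[of _ k x] k x by (auto simp: U_def)
        then show "x \<in> p k ` U k" using pi[OF k x] by (metis imageI)
      qed
    qed
    have "subspace (U (Suc k))" unfolding USuc by (rule vp.rank_nullity_within(1)[OF IH(1) l])
    moreover have "U (Suc k) \<subseteq> V" by (auto simp: U_def)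
    ultimately have "fin_subspace (U (Suc k))" using fin_subspace_subset[OF V] by blast
    moreover have "dim (U k) = dim (U (Suc k)) + dim (W k)"
      unfolding USuc using vp.rank_nullity_within(2)[OF IH(1) l] im by simp
    ultimately show ?case using IH(2) by simp
  qed
  have "U n = {0}"
  proof
    show "U n \<subseteq> {0}" using inj by (auto simp: U_def)
    have "p a 0 = 0" if "a < n" for a
      using lin[OF that] subspace_0[OF sV] unfolding linear_within_def
      by (metis scale_zero_left)
    then show "{0} \<subseteq> U n" using subspace_0[OF sV] by (auto simp: U_def)
  qed
  then show ?thesis using main[of n] dim_zero_space by simp
qed

end


section \<open>Linear categories\<close>

context linear_category
begin

sublocale ft: subspace_theory "scl C" ..

lemma hom_0: "0 \<in> homs C X Y"
  using homs_subspace vs.subspace_0 by blast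

lemma hom_add: "f \<in> homs C X Y \<Longrightarrow> g \<in> homs C X Y \<Longrightarrow> f + g \<in> homs C X Y"
  using homs_subspace vs.subspace_add by blast

lemma hom_minus: "f \<in> homs C X Y \<Longrightarrow> - f \<in> homs C X Y"
  using homs_subspace vs.subspace_neg by blast

lemma hom_diff: "f \<in> homs C X Y \<Longrightarrow> g \<in> homs C X Y \<Longrightarrow> f - g \<in> homs C X Y"
  using homs_subspace vs.subspace_diff by blast

lemma hom_scl: "f \<in> homs C X Y \<Longrightarrow> scl C c f \<in> homs C X Y"
  using homs_subspace vs.subspace_scale by blast

lemma hom_sum: "(\<And>a. a \<in> A \<Longrightarrow> f a \<in> homs C X Y) \<Longrightarrow> (\<Sum>a\<in>A. f a) \<in> homs C X Y"
  using homs_subspace vs.subspace_sum by blast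

lemma cmp_0_left: "f \<in> homs C X Y \<Longrightarrow> 0 \<cdot> f = 0"
  using cmp_add_left[of f X Y 0 Y 0] hom_0 by simp

lemma cmp_0_right: "g \<in> homs C Y Z \<Longrightarrow> g \<cdot> 0 = 0"
  using cmp_add_right[of 0 Y Y 0 g Z] hom_0 by simp

lemma cmp_minus_left: "f \<in> homs C X Y \<Longrightarrow> g \<in> homs C Y Z \<Longrightarrow> (- g) \<cdot> f = - (g \<cdot> f)"
  using cmp_add_left[of f X Y g Z "- g"] hom_minus cmp_0_left[of f X Y]
  by (simp add: eq_neg_iff_add_eq_0 add.commute)

lemma cmp_minus_right: "f \<in> homs C X Y \<Longrightarrow> g \<in> homs C Y Z \<Longrightarrow> g \<cdot> (- f) = - (g \<cdot> f)"
  using cmp_add_right[of f X Y "- f" g Z] hom_minus cmp_0_right[of g Y Z]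
  by (simp add: eq_neg_iff_add_eq_0 add.commute)

lemma cmp_diff_left:
  "f \<in> homs C X Y \<Longrightarrow> g \<in> homs C Y Z \<Longrightarrow> g' \<in> homs C Y Z \<Longrightarrow> (g - g') \<cdot> f = g \<cdot> f - g' \<cdot> f"
  using cmp_add_left[of f X Y g Z "- g'"] hom_minus cmp_minus_left[of f X Y g' Z] by simp

lemma cmp_diff_right:
  "f \<in> homs C X Y \<Longrightarrow> f' \<in> homs C X Y \<Longrightarrow> g \<in> homs C Y Z \<Longrightarrow> g \<cdot> (f - f') = g \<cdot> f - g \<cdot> f'"
  using cmp_add_right[of f X Y "- f'" g Z] hom_minus cmp_minus_right[of f' X Y g Z] by simp

lemma cmp_sum_left:
  assumes f: "f \<in> homs C X Y" and g: "\<And>a. a \<in> A \<Longrightarrow> g a \<in> homs C Y Z"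
  shows "(\<Sum>a\<in>A. g a) \<cdot> f = (\<Sum>a\<in>A. g a \<cdot> f)"
  using g
proof (induction A rule: infinite_finite_induct)
  case (insert a A)
  then have "(\<Sum>a\<in>A. g a) \<in> homs C Y Z" by (intro hom_sum) auto
  then show ?case using insert cmp_add_left[OF f, of "g a" Z] by simp
qed (use f cmp_0_left in auto)

lemma cmp_sum_right:
  assumes g: "g \<in> homs C Y Z" and f: "\<And>a. a \<in> A \<Longrightarrow> f a \<in> homs C X Y"
  shows "g \<cdot> (\<Sum>a\<in>A. f a) = (\<Sum>a\<in>A. g \<cdot> f a)"
  using f
proof (induction A rule: infinite_finite_induct)
  case (insert a A)
  then have "(\<Sum>a\<in>A. f a) \<in> homs C X Y" by (intro hom_sum) auto
  then show ?case using insert cmp_add_right[of "f a" X Y _ g Z] g by simp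
qed (use g cmp_0_right in auto)

lemma zero_object_iff: "zero_object C X \<longleftrightarrow> ident C X = 0"
proof
  assume "zero_object C X"
  then show "ident C X = 0" using ident_closed[of X] by (auto simp: zero_object_def)
next
  assume z: "ident C X = 0"
  have "f = 0" if "f \<in> homs C X Y" for f Y
    using ident_right[OF that] cmp_0_right[OF that] z by simp
  moreover have "f = 0" if "f \<in> homs C Y X" for f Y
    using ident_left[OF that] cmp_0_left[OF that] z by simp
  ultimately show "zero_object C X" unfolding zero_object_def using hom_0 by blast
qed

lemma isomorphism_comp:
  assumes "isomorphism C X Y f" "isomorphism C Y Z g"
  shows "isomorphism C X Z (g \<cdot> f)"
proof -
  obtain f' where f: "f \<in> homs C X Y" "f' \<in> homs C Y X" "f' \<cdot> f = ident C X" "f \<cdot> f' = ident C Y"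
    using assms by (auto simp: isomorphism_def)
  obtain g' where g: "g \<in> homs C Y Z" "g' \<in> homs C Z Y" "g' \<cdot> g = ident C Y" "g \<cdot> g' = ident C Z"
    using assms by (auto simp: isomorphism_def)
  have c: "g \<cdot> f \<in> homs C X Z" "f' \<cdot> g' \<in> homs C Z X" "g' \<cdot> (g \<cdot> f) = f" "f \<cdot> (f' \<cdot> g') = g'"
    using f g cmp_closed[OF f(1) g(1)] cmp_closed[OF g(2) f(2)] cmp_assoc[OF f(1) g(1,2)]
      cmp_assoc[OF g(2) f(2,1)] ident_left[OF f(1)] ident_left[OF g(2)] by simp_all
  have "(f' \<cdot> g') \<cdot> (g \<cdot> f) = f' \<cdot> (g' \<cdot> (g \<cdot> f))"
    by (rule cmp_assoc[OF c(1) g(2) f(2)])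
  moreover have "(g \<cdot> f) \<cdot> (f' \<cdot> g') = g \<cdot> (f \<cdot> (f' \<cdot> g'))"
    by (rule cmp_assoc[OF c(2) f(1) g(1)])
  ultimately show ?thesis using c f g by (auto simp: isomorphism_def)
qed

lemma isomorphism_ident: "isomorphism C X X (ident C X)"
  using ident_closed ident_left by (auto simp: isomorphism_def)

lemma isomorphic_refl: "isomorphic C X X"
  using isomorphism_ident by (auto simp: isomorphic_def)

lemma isomorphic_sym: "isomorphic C X Y \<Longrightarrow> isomorphic C Y X"
  by (auto simp: isomorphic_def isomorphism_def)

lemma isomorphic_trans: "isomorphic C X Y \<Longrightarrow> isomorphic C Y Z \<Longrightarrow> isomorphic C X Z"
  unfolding isomorphic_def using isomorphism_comp by blast

lemma section_of_iso_comp: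
  assumes "f \<in> homs C A X" "g \<in> homs C X A" "isomorphism C A A (g \<cdot> f)"
  shows "section_mor C A X f"
proof -
  obtain k where k: "k \<in> homs C A A" "k \<cdot> (g \<cdot> f) = ident C A"
    using assms by (auto simp: isomorphism_def)
  have "(k \<cdot> g) \<cdot> f = ident C A" using cmp_assoc[OF assms(1,2) k(1)] k by simp
  then show ?thesis using assms k cmp_closed unfolding section_mor_def by blast
qed

lemma section_of_comp:
  assumes "f \<in> homs C A X" "g \<in> homs C X Y" "section_mor C A Y (g \<cdot> f)"
  shows "section_mor C A X f"
proof -
  obtain r where r: "r \<in> homs C Y A" "r \<cdot> (g \<cdot> f) = ident C A"
    using assms by (auto simp: section_mor_def)
  then have "(r \<cdot> g) \<cdot> f = ident C A" using cmp_assoc[OF assms(1,2)] by simp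
  then show ?thesis using assms r cmp_closed unfolding section_mor_def by blast
qed

lemma local_end_sum:
  assumes "local_end C A" "x \<in> homs C A A" "y \<in> homs C A A" "isomorphism C A A (x + y)"
  shows "isomorphism C A A x \<or> isomorphism C A A y"
  using assms unfolding local_end_def by blast

lemma local_end_one_minus:
  assumes "local_end C A" "x \<in> homs C A A" "\<not> isomorphism C A A x"
  shows "isomorphism C A A (ident C A - x)"
  using local_end_sum[OF assms(1,2), of "ident C A - x"] assms isomorphism_ident hom_diff ident_closed
  by simp

text \<open>The idempotent \<open>s \<cdot> r\<close> of a local ring is \<open>0\<close> or \<open>1\<close>.\<close>

lemma section_into_local_iso:
  assumes B: "local_end C B" and A: "ident C A \<noteq> 0" and s: "section_mor C A B s"
  shows "isomorphism C A B s"
proof -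
  obtain r where r: "s \<in> homs C A B" "r \<in> homs C B A" "r \<cdot> s = ident C A"
    using s by (auto simp: section_mor_def)
  define e where "e = s \<cdot> r"
  have e: "e \<in> homs C B B" using r cmp_closed e_def by blast
  have es: "e \<cdot> s = s" using cmp_assoc[OF r(1,2,1)] r ident_right unfolding e_def by simp
  have ee: "e \<cdot> e = e" using cmp_assoc[OF r(2,1) e] es unfolding e_def by simp
  have "isomorphism C B B e \<or> isomorphism C B B (ident C B - e)"
    using local_end_one_minus[OF B e] by blast
  then show ?thesis
  proof
    assume "isomorphism C B B e"
    then obtain k where k: "k \<in> homs C B B" "k \<cdot> e = ident C B" by (auto simp: isomorphism_def)
    have "e = k \<cdot> (e \<cdot> e)" using cmp_assoc[OF e e k(1)] k ident_left[OF e] by simp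
    then have "e = ident C B" using ee k by simp
    then show ?thesis using r unfolding e_def isomorphism_def by blast
  next
    assume "isomorphism C B B (ident C B - e)"
    then obtain k where k: "k \<in> homs C B B" "k \<cdot> (ident C B - e) = ident C B"
      by (auto simp: isomorphism_def)
    have d: "ident C B - e \<in> homs C B B" using e hom_diff ident_closed by blast
    have "(ident C B - e) \<cdot> s = 0"
      using cmp_diff_left[OF r(1) ident_closed e] es ident_left[OF r(1)] by simp
    then have "s = 0"
      using cmp_assoc[OF r(1) d k(1)] k ident_left[OF r(1)] cmp_0_right[OF k(1)] by simp
    then have "ident C A = 0" using r cmp_0_right by metis
    then show ?thesis using A by simp
  qed
qed

lemma direct_sum2I:
  assumes "i1 \<in> homs C X S" "i2 \<in> homs C Y S" "p1 \<in> homs C S X" "p2 \<in> homs C S Y"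
    "p1 \<cdot> i1 = ident C X" "p1 \<cdot> i2 = 0" "p2 \<cdot> i1 = 0" "p2 \<cdot> i2 = ident C Y"
    "i1 \<cdot> p1 + i2 \<cdot> p2 = ident C S"
  shows "direct_sum C S [X, Y]"
  unfolding direct_sum_def
  by (rule exI[of _ "\<lambda>a. if a = 0 then i1 else i2"], rule exI[of _ "\<lambda>a. if a = 0 then p1 else p2"])
    (use assms in \<open>auto simp: less_Suc_eq numeral_2_eq_2\<close>)

lemma direct_sum2E:
  assumes "direct_sum C S [X, Y]"
  obtains i1 i2 p1 p2 where
    "i1 \<in> homs C X S" "i2 \<in> homs C Y S" "p1 \<in> homs C S X" "p2 \<in> homs C S Y"
    "p1 \<cdot> i1 = ident C X" "p1 \<cdot> i2 = 0" "p2 \<cdot> i1 = 0" "p2 \<cdot> i2 = ident C Y"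
    "i1 \<cdot> p1 + i2 \<cdot> p2 = ident C S"
proof -
  obtain i p where h: "\<forall>a<length [X,Y]. i a \<in> homs C ([X,Y] ! a) S \<and> p a \<in> homs C S ([X,Y] ! a)"
     "\<forall>a<length [X,Y]. \<forall>b<length [X,Y]. p a \<cdot> i b = (if a = b then ident C ([X,Y] ! a) else 0)"
     "(\<Sum>a<length [X,Y]. i a \<cdot> p a) = ident C S"
    using assms unfolding direct_sum_def by blast
  have "p 0 \<cdot> i 0 = ident C X" "p 0 \<cdot> i 1 = 0" "p 1 \<cdot> i 0 = 0" "p 1 \<cdot> i 1 = ident C Y"
    using h(2)[rule_format, of 0 0] h(2)[rule_format, of 0 1] h(2)[rule_format, of 1 0]
      h(2)[rule_format, of 1 1] by simp_all
  moreover have "i 0 \<cdot> p 0 + i 1 \<cdot> p 1 = ident C S" using h(3) by (simp add: numeral_2_eq_2)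
  ultimately show thesis using that[of "i 0" "i 1" "p 0" "p 1"] h(1)[rule_format, of 0] h(1)[rule_format, of 1]
    by auto
qed

lemma direct_sum_Nil: "direct_sum C X [] \<longleftrightarrow> zero_object C X"
  unfolding direct_sum_def zero_object_iff by auto

lemma direct_sum_isomorphic_summands:
  assumes S: "direct_sum C S Xs" and len: "length Ys = length Xs"
    and iso: "\<And>a. a < length Xs \<Longrightarrow> isomorphic C (Xs ! a) (Ys ! a)"
  shows "direct_sum C S Ys"
proof -
  obtain i p where h: "\<forall>a<length Xs. i a \<in> homs C (Xs ! a) S \<and> p a \<in> homs C S (Xs ! a)"
     "\<forall>a<length Xs. \<forall>b<length Xs. p a \<cdot> i b = (if a = b then ident C (Xs ! a) else 0)"
     "(\<Sum>a<length Xs. i a \<cdot> p a) = ident C S"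
    using S unfolding direct_sum_def by blast
  have "\<forall>a. \<exists>t t'. a < length Xs \<longrightarrow> t \<in> homs C (Xs ! a) (Ys ! a) \<and> t' \<in> homs C (Ys ! a) (Xs ! a) \<and>
     t' \<cdot> t = ident C (Xs ! a) \<and> t \<cdot> t' = ident C (Ys ! a)"
    using iso unfolding isomorphic_def isomorphism_def by blast
  then obtain t t' where t: "\<And>a. a < length Xs \<Longrightarrow> t a \<in> homs C (Xs ! a) (Ys ! a)"
     "\<And>a. a < length Xs \<Longrightarrow> t' a \<in> homs C (Ys ! a) (Xs ! a)"
     "\<And>a. a < length Xs \<Longrightarrow> t' a \<cdot> t a = ident C (Xs ! a)"
     "\<And>a. a < length Xs \<Longrightarrow> t a \<cdot> t' a = ident C (Ys ! a)"
    by metis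
  have 1: "i a \<cdot> t' a \<in> homs C (Ys ! a) S" "t a \<cdot> p a \<in> homs C S (Ys ! a)" if "a < length Xs" for a
    using t(1,2)[OF that] h(1) that cmp_closed by blast+
  have 2: "(t a \<cdot> p a) \<cdot> (i b \<cdot> t' b) = (if a = b then ident C (Ys ! a) else 0)"
    if a: "a < length Xs" and b: "b < length Xs" for a b
  proof -
    have p: "p a \<in> homs C S (Xs ! a)" and i: "i b \<in> homs C (Xs ! b) S" using h(1) a b by auto
    have "(t a \<cdot> p a) \<cdot> (i b \<cdot> t' b) = t a \<cdot> (p a \<cdot> (i b \<cdot> t' b))"
      by (rule cmp_assoc[OF 1(1)[OF b] p t(1)[OF a]])
    also have "p a \<cdot> (i b \<cdot> t' b) = (p a \<cdot> i b) \<cdot> t' b"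
      by (rule cmp_assoc[OF t(2)[OF b] i p, symmetric])
    also have "p a \<cdot> i b = (if a = b then ident C (Xs ! a) else 0)" using h(2) a b by blast
    finally show ?thesis
      using t[OF a] t(2)[OF b] by (auto simp: ident_left cmp_0_left[OF t(2)[OF b]] cmp_0_right[OF t(1)[OF a]])
  qed
  have "(i a \<cdot> t' a) \<cdot> (t a \<cdot> p a) = i a \<cdot> p a" if a: "a < length Xs" for a
  proof -
    have p: "p a \<in> homs C S (Xs ! a)" and i: "i a \<in> homs C (Xs ! a) S" using h(1) a by auto
    have "(i a \<cdot> t' a) \<cdot> (t a \<cdot> p a) = i a \<cdot> (t' a \<cdot> (t a \<cdot> p a))"
      by (rule cmp_assoc[OF 1(2)[OF a] t(2)[OF a] i])
    also have "t' a \<cdot> (t a \<cdot> p a) = (t' a \<cdot> t a) \<cdot> p a"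
      by (rule cmp_assoc[OF p t(1)[OF a] t(2)[OF a], symmetric])
    finally show ?thesis using t(3)[OF a] ident_left[OF p] by simp
  qed
  then have "(\<Sum>a<length Ys. (i a \<cdot> t' a) \<cdot> (t a \<cdot> p a)) = ident C S"
    using h(3) len by simp
  then show ?thesis unfolding direct_sum_def
    using 1 2 len by (intro exI[of _ "\<lambda>a. i a \<cdot> t' a"] exI[of _ "\<lambda>a. t a \<cdot> p a"]) auto
qed

text \<open>With \<open>direct_sum_tail\<close> below, this reduces sums of lists to binary sums.\<close>

lemma direct_sum_Cons:
  assumes S: "direct_sum C S [X, R]" and R: "direct_sum C R Xs"
  shows "direct_sum C S (X # Xs)"
proof -
  obtain i1 i2 p1 p2 where s:
    "i1 \<in> homs C X S" "i2 \<in> homs C R S" "p1 \<in> homs C S X" "p2 \<in> homs C S R"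
    "p1 \<cdot> i1 = ident C X" "p1 \<cdot> i2 = 0" "p2 \<cdot> i1 = 0" "p2 \<cdot> i2 = ident C R"
    "i1 \<cdot> p1 + i2 \<cdot> p2 = ident C S"
    using direct_sum2E[OF S] .
  obtain i p where h: "\<And>a. a<length Xs \<Longrightarrow> i a \<in> homs C (Xs ! a) R" "\<And>a. a<length Xs \<Longrightarrow> p a \<in> homs C R (Xs ! a)"
     "\<And>a b. a<length Xs \<Longrightarrow> b<length Xs \<Longrightarrow> p a \<cdot> i b = (if a = b then ident C (Xs ! a) else 0)"
     "(\<Sum>a<length Xs. i a \<cdot> p a) = ident C R"
    using R unfolding direct_sum_def by blast
  define j where "j = case_nat i1 (\<lambda>a. i2 \<cdot> i a)"
  define q where "q = case_nat p1 (\<lambda>a. p a \<cdot> p2)"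
  have j: "j 0 = i1" "j (Suc a) = i2 \<cdot> i a" and q: "q 0 = p1" "q (Suc a) = p a \<cdot> p2" for a
    by (simp_all add: j_def q_def)
  have jh: "j a \<in> homs C ((X # Xs) ! a) S" and qh: "q a \<in> homs C S ((X # Xs) ! a)"
    if "a < length (X # Xs)" for a
    using that s h(1,2) cmp_closed[OF h(1) s(2)] cmp_closed[OF s(4) h(2)]
    by (cases a; simp add: j q)+
  have qj: "q a \<cdot> j b = (if a = b then ident C ((X # Xs) ! a) else 0)"
    if ab: "a < length (X # Xs)" "b < length (X # Xs)" for a b
  proof (cases a)
    case 0
    have "p1 \<cdot> (i2 \<cdot> i b') = 0" if "b' < length Xs" for b'
      using cmp_assoc[OF h(1)[OF that] s(2,3)] s(6) cmp_0_left[OF h(1)[OF that]] by simp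
    then show ?thesis using 0 s(5) ab(2) by (cases b) (auto simp: j q)
  next
    case (Suc a')
    then have a': "a' < length Xs" using ab by simp
    show ?thesis
    proof (cases b)
      case 0
      have "(p a' \<cdot> p2) \<cdot> i1 = 0"
        using cmp_assoc[OF s(1,4) h(2)[OF a']] s(7) cmp_0_right[OF h(2)[OF a']] by simp
      then show ?thesis using Suc 0 by (simp add: j q)
    next
      case (Suc b')
      then have b': "b' < length Xs" using ab by simp
      have "(p a' \<cdot> p2) \<cdot> (i2 \<cdot> i b') = p a' \<cdot> (p2 \<cdot> (i2 \<cdot> i b'))"
        by (rule cmp_assoc[OF cmp_closed[OF h(1)[OF b'] s(2)] s(4) h(2)[OF a']])
      also have "p2 \<cdot> (i2 \<cdot> i b') = i b'"
        using cmp_assoc[OF h(1)[OF b'] s(2,4)] s(8) ident_left[OF h(1)[OF b']] by simp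
      finally show ?thesis using h(3)[OF a' b'] \<open>a = Suc a'\<close> Suc by (simp add: j q)
    qed
  qed
  have "(i2 \<cdot> i a) \<cdot> (p a \<cdot> p2) = i2 \<cdot> ((i a \<cdot> p a) \<cdot> p2)" if a: "a < length Xs" for a
    using cmp_assoc[OF cmp_closed[OF s(4) h(2)[OF a]] h(1)[OF a] s(2)] cmp_assoc[OF s(4) h(2)[OF a] h(1)[OF a]]
    by simp
  then have "(\<Sum>a<length Xs. (i2 \<cdot> i a) \<cdot> (p a \<cdot> p2)) = (\<Sum>a<length Xs. i2 \<cdot> ((i a \<cdot> p a) \<cdot> p2))"
    by simp
  also have "\<dots> = i2 \<cdot> (\<Sum>a<length Xs. (i a \<cdot> p a) \<cdot> p2)"
    by (rule cmp_sum_right[OF s(2), symmetric]) (use cmp_closed[OF s(4) cmp_closed[OF h(2) h(1)]] in auto)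
  also have "(\<Sum>a<length Xs. (i a \<cdot> p a) \<cdot> p2) = (\<Sum>a<length Xs. i a \<cdot> p a) \<cdot> p2"
    by (rule cmp_sum_left[OF s(4), symmetric]) (use cmp_closed[OF h(2) h(1)] in auto)
  finally have "(\<Sum>a<length Xs. (i2 \<cdot> i a) \<cdot> (p a \<cdot> p2)) = i2 \<cdot> p2"
    using h(4) ident_left[OF s(4)] by simp
  then have "(\<Sum>a<length (X # Xs). j a \<cdot> q a) = ident C S"
    using s(9) by (simp add: sum.lessThan_Suc_shift j q del: sum.lessThan_Suc)
  then show ?thesis unfolding direct_sum_def using jh qh qj by blast
qed

end

lemma (in additive_category) ex_direct_sum: "\<exists>S. direct_sum C S Xs"
proof (induction Xs)
  case Nil
  then show ?case using ex_zero_object direct_sum_Nil by blast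
next
  case (Cons X Xs)
  then show ?case using ex_biproduct direct_sum_Cons by blast
qed


section \<open>Classes of objects in the split Grothendieck group\<close>

definition pairing :: "('o \<Rightarrow> int) \<Rightarrow> ('o \<Rightarrow>\<^sub>0 int) \<Rightarrow> int" where
  "pairing \<phi> x = (\<Sum>A\<in>Poly_Mapping.keys x. Poly_Mapping.lookup x A * \<phi> A)"

lemma pairing_superset:
  assumes "finite S" "Poly_Mapping.keys x \<subseteq> S"
  shows "pairing \<phi> x = (\<Sum>A\<in>S. Poly_Mapping.lookup x A * \<phi> A)"
  unfolding pairing_def using assms
  by (intro sum.mono_neutral_left) (auto simp: in_keys_iff)

lemma pairing_add: "pairing \<phi> (x + y) = pairing \<phi> x + pairing \<phi> y"
proof -
  let ?S = "Poly_Mapping.keys x \<union> Poly_Mapping.keys y"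
  have "Poly_Mapping.keys (x + y) \<subseteq> ?S" by (rule keys_add)
  then show ?thesis
    by (simp add: pairing_superset[of ?S] lookup_add distrib_right sum.distrib)
qed

lemma pairing_minus: "pairing \<phi> (- x) = - pairing \<phi> x"
  by (simp add: pairing_def sum_negf)

lemma pairing_diff: "pairing \<phi> (x - y) = pairing \<phi> x - pairing \<phi> y"
  using pairing_add[of \<phi> x "- y"] pairing_minus[of \<phi> y] by simp

lemma pairing_0: "pairing \<phi> 0 = 0"
  by (simp add: pairing_def)

lemma pairing_frag_cmul: "pairing \<phi> (frag_cmul c x) = c * pairing \<phi> x"
  using pairing_superset[of "Poly_Mapping.keys x" "frag_cmul c x" \<phi>] keys_cmul[of c x]
  by (simp add: pairing_def sum_distrib_left mult.assoc)

lemma pairing_sum: "pairing \<phi> (\<Sum>a\<in>S. x a) = (\<Sum>a\<in>S. pairing \<phi> (x a))"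
  by (induction S rule: infinite_finite_induct) (simp_all add: pairing_0 pairing_add)

lemma pairing_frag_of: "pairing \<phi> (frag_of A) = \<phi> A"
  by (simp add: pairing_def)

lemma pairing_sum_list: "pairing \<phi> (\<Sum>Y\<leftarrow>Ys. frag_of Y) = (\<Sum>Y\<leftarrow>Ys. \<phi> Y)"
  by (induction Ys) (simp_all add: pairing_0 pairing_add pairing_frag_of)

lemma keys_sum_list_frag_of: "Poly_Mapping.keys (\<Sum>Y\<leftarrow>Ys. frag_of Y) \<subseteq> set Ys"
proof (induction Ys)
  case (Cons Y Ys)
  have "Poly_Mapping.keys (frag_of Y + (\<Sum>Y\<leftarrow>Ys. frag_of Y)) \<subseteq> {Y} \<union> Poly_Mapping.keys (\<Sum>Y\<leftarrow>Ys. frag_of Y)"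
    using keys_add[of "frag_of Y" "\<Sum>Y\<leftarrow>Ys. frag_of Y"] by simp
  then show ?case using Cons by auto
qed simp

context linear_category
begin

lemma local_end_ident_nonzero: "local_end C A \<Longrightarrow> ident C A \<noteq> 0"
  by (simp add: local_end_def)

lemma indecomposable_ident_nonzero: "indecomposable C A \<Longrightarrow> ident C A \<noteq> 0"
  by (simp add: indecomposable_def zero_object_iff)

text \<open>Conjugation by the isomorphism is an additive bijection between the endomorphism rings that
  preserves and reflects units.\<close>

lemma local_end_isomorphic:
  assumes A: "local_end C A" and iso: "isomorphic C A B"
  shows "local_end C B"
proof -
  obtain t t' where t: "t \<in> homs C A B" "t' \<in> homs C B A" "t' \<cdot> t = ident C A" "t \<cdot> t' = ident C B"
    using iso by (auto simp: isomorphic_def isomorphism_def)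
  define \<phi> where "\<phi> f = t' \<cdot> (f \<cdot> t)" for f
  have ft: "f \<cdot> t \<in> homs C A B" if "f \<in> homs C B B" for f by (rule cmp_closed[OF t(1) that])
  have \<phi>h: "\<phi> f \<in> homs C A A" if "f \<in> homs C B B" for f
    unfolding \<phi>_def by (rule cmp_closed[OF ft[OF that] t(2)])
  have recover: "t \<cdot> (\<phi> f \<cdot> t') = f" if f: "f \<in> homs C B B" for f
  proof -
    have "\<phi> f \<cdot> t' = t' \<cdot> ((f \<cdot> t) \<cdot> t')" unfolding \<phi>_def by (rule cmp_assoc[OF t(2) ft[OF f] t(2)])
    also have "(f \<cdot> t) \<cdot> t' = f" using cmp_assoc[OF t(2,1) f] t(4) ident_right[OF f] by simp
    finally show ?thesis using cmp_assoc[OF f t(2,1)] t(4) ident_left[OF f] by simp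
  qed
  have tiso: "isomorphism C A B t" "isomorphism C B A t'" using t by (auto simp: isomorphism_def)
  have iff: "isomorphism C A A (\<phi> f) \<longleftrightarrow> isomorphism C B B f" if f: "f \<in> homs C B B" for f
  proof
    assume "isomorphism C A A (\<phi> f)"
    then show "isomorphism C B B f"
      using isomorphism_comp[OF isomorphism_comp[OF tiso(2)] tiso(1)] recover[OF f] by metis
  next
    assume "isomorphism C B B f"
    then show "isomorphism C A A (\<phi> f)"
      unfolding \<phi>_def using isomorphism_comp[OF isomorphism_comp[OF tiso(1)] tiso(2)] by blast
  qed
  have "\<phi> (f + g) = \<phi> f + \<phi> g" if "f \<in> homs C B B" "g \<in> homs C B B" for f g
    unfolding \<phi>_def using cmp_add_left[OF t(1) that] cmp_add_right[OF ft[OF that(1)] ft[OF that(2)] t(2)] by simp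
  moreover have "ident C B \<noteq> 0"
  proof
    assume "ident C B = 0"
    then have "t = 0" using ident_left[OF t(1)] cmp_0_left[OF t(1)] by simp
    then show False using t(3) cmp_0_right[OF t(2)] local_end_ident_nonzero[OF A] by simp
  qed
  ultimately show ?thesis
    using A iff \<phi>h hom_add unfolding local_end_def by metis
qed

text \<open>The inclusion of \<open>R\<close> into \<open>S\<close> is assembled from the projections of \<open>R\<close> and the inclusions into \<open>S\<close>
  with index at least \<open>1\<close>; the projection from \<open>S\<close> onto \<open>R\<close> is obtained in the dual way.\<close>

lemma direct_sum_tail:
  assumes S: "direct_sum C S (X # Xs)" and R: "direct_sum C R Xs"
  shows "direct_sum C S [X, R]"
proof -
  let ?n = "length Xs"
  obtain i p where h: "\<forall>a<length (X # Xs). i a \<in> homs C ((X # Xs) ! a) S \<and> p a \<in> homs C S ((X # Xs) ! a)"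
     "\<forall>a<length (X # Xs). \<forall>b<length (X # Xs). p a \<cdot> i b = (if a = b then ident C ((X # Xs) ! a) else 0)"
     "(\<Sum>a<length (X # Xs). i a \<cdot> p a) = ident C S"
    using S unfolding direct_sum_def by blast
  obtain j q where k: "\<And>a. a<?n \<Longrightarrow> j a \<in> homs C (Xs ! a) R" "\<And>a. a<?n \<Longrightarrow> q a \<in> homs C R (Xs ! a)"
     "\<And>a b. a<?n \<Longrightarrow> b<?n \<Longrightarrow> q a \<cdot> j b = (if a = b then ident C (Xs ! a) else 0)"
     "(\<Sum>a<?n. j a \<cdot> q a) = ident C R"
    using R unfolding direct_sum_def by blast
  have i0: "i 0 \<in> homs C X S" and p0: "p 0 \<in> homs C S X"
    using h(1)[rule_format, of 0] by simp_all
  have iS: "i (Suc a) \<in> homs C (Xs ! a) S" and pS: "p (Suc a) \<in> homs C S (Xs ! a)" if "a < ?n" for a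
    using h(1)[rule_format, of "Suc a"] that by simp_all
  have p0i: "p 0 \<cdot> i 0 = ident C X" "p 0 \<cdot> i (Suc a) = 0" "p (Suc a) \<cdot> i 0 = 0" if "a < ?n" for a
    using h(2)[rule_format, of 0 0] h(2)[rule_format, of 0 "Suc a"] h(2)[rule_format, of "Suc a" 0] that
    by simp_all
  have p0i0: "p 0 \<cdot> i 0 = ident C X" using h(2)[rule_format, of 0 0] by simp
  have piS: "p (Suc a) \<cdot> i (Suc b) = (if a = b then ident C (Xs ! a) else 0)" if "a < ?n" "b < ?n" for a b
    using h(2)[rule_format, of "Suc a" "Suc b"] that by simp
  define i2 where "i2 = (\<Sum>a<?n. i (Suc a) \<cdot> q a)"
  define p2 where "p2 = (\<Sum>a<?n. j a \<cdot> p (Suc a))"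
  have iq: "i (Suc a) \<cdot> q a \<in> homs C R S" if "a < ?n" for a by (rule cmp_closed[OF k(2) iS]) fact+
  have jp: "j a \<cdot> p (Suc a) \<in> homs C S R" if "a < ?n" for a by (rule cmp_closed[OF pS k(1)]) fact+
  have i2: "i2 \<in> homs C R S" unfolding i2_def using iq by (intro hom_sum) auto
  have p2: "p2 \<in> homs C S R" unfolding p2_def using jp by (intro hom_sum) auto
  have "p 0 \<cdot> i2 = (\<Sum>a<?n. p 0 \<cdot> (i (Suc a) \<cdot> q a))"
    unfolding i2_def using iq by (intro cmp_sum_right[OF p0]) auto
  also have "\<dots> = 0"
    using cmp_assoc[OF k(2) iS p0] p0i(2) cmp_0_left[OF k(2)] by (intro sum.neutral) (auto simp flip: cmp_assoc)
  finally have a: "p 0 \<cdot> i2 = 0" .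
  have "p2 \<cdot> i 0 = (\<Sum>a<?n. (j a \<cdot> p (Suc a)) \<cdot> i 0)"
    unfolding p2_def using jp by (intro cmp_sum_left[OF i0]) auto
  also have "\<dots> = 0"
    using cmp_assoc[OF i0 pS k(1)] p0i(3) cmp_0_right[OF k(1)] by (intro sum.neutral) auto
  finally have b: "p2 \<cdot> i 0 = 0" .
  have p2i: "p2 \<cdot> i (Suc b) = j b" if bn: "b < ?n" for b
  proof -
    have "p2 \<cdot> i (Suc b) = (\<Sum>a<?n. (j a \<cdot> p (Suc a)) \<cdot> i (Suc b))"
      unfolding p2_def using jp by (intro cmp_sum_left[OF iS[OF bn]]) auto
    also have "\<dots> = (\<Sum>a<?n. if a = b then j b else 0)"
      using cmp_assoc[OF iS[OF bn] pS k(1)] piS[OF _ bn] cmp_0_right[OF k(1)] ident_right[OF k(1)]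
      by (intro sum.cong) auto
    also have "\<dots> = j b" using bn by simp
    finally show ?thesis .
  qed
  have qp2: "q a \<cdot> p2 = p (Suc a)" if an: "a < ?n" for a
  proof -
    have "q a \<cdot> p2 = (\<Sum>b<?n. q a \<cdot> (j b \<cdot> p (Suc b)))"
      unfolding p2_def using jp by (intro cmp_sum_right[OF k(2)[OF an]]) auto
    also have "\<dots> = (\<Sum>b<?n. if b = a then p (Suc a) else 0)"
    proof (rule sum.cong)
      fix b assume "b \<in> {..<?n}"
      then have bn: "b < ?n" by simp
      show "q a \<cdot> (j b \<cdot> p (Suc b)) = (if b = a then p (Suc a) else 0)"
        using cmp_assoc[OF pS[OF bn] k(1)[OF bn] k(2)[OF an]] k(3)[OF an bn] cmp_0_left[OF pS[OF bn]]
          ident_left[OF pS[OF bn]] by (auto split: if_splits)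
    qed simp
    also have "\<dots> = p (Suc a)" using an by simp
    finally show ?thesis .
  qed
  have "p2 \<cdot> i2 = (\<Sum>b<?n. p2 \<cdot> (i (Suc b) \<cdot> q b))"
    unfolding i2_def using iq by (intro cmp_sum_right[OF p2]) auto
  also have "\<dots> = (\<Sum>b<?n. j b \<cdot> q b)"
    using cmp_assoc[OF k(2) iS p2] p2i by (intro sum.cong) auto
  finally have c: "p2 \<cdot> i2 = ident C R" using k(4) by simp
  have "i2 \<cdot> p2 = (\<Sum>a<?n. (i (Suc a) \<cdot> q a) \<cdot> p2)"
    unfolding i2_def using iq by (intro cmp_sum_left[OF p2]) auto
  also have "\<dots> = (\<Sum>a<?n. i (Suc a) \<cdot> p (Suc a))"
    using cmp_assoc[OF p2 k(2) iS] qp2 by (intro sum.cong) auto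
  finally have "i 0 \<cdot> p 0 + i2 \<cdot> p2 = ident C S"
    using h(3) by (simp add: sum.lessThan_Suc_shift del: sum.lessThan_Suc)
  then show ?thesis using direct_sum2I[OF i0 i2 p0 p2 p0i0 a b c] by simp
qed

lemma direct_sum_zero_right:
  assumes S: "direct_sum C S [X, R]" and R: "zero_object C R"
  shows "isomorphic C S X"
proof -
  obtain i1 i2 p1 p2 where s:
    "i1 \<in> homs C X S" "i2 \<in> homs C R S" "p1 \<in> homs C S X" "p2 \<in> homs C S R"
    "p1 \<cdot> i1 = ident C X" "p1 \<cdot> i2 = 0" "p2 \<cdot> i1 = 0" "p2 \<cdot> i2 = ident C R"
    "i1 \<cdot> p1 + i2 \<cdot> p2 = ident C S"
    using direct_sum2E[OF S] .
  have "i2 = 0" using s(2) R by (auto simp: zero_object_def)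
  then have "i1 \<cdot> p1 = ident C S" using s(9) cmp_0_left[OF s(4)] by simp
  then show ?thesis using s(1,3,5) unfolding isomorphic_def isomorphism_def by blast
qed

text \<open>For \<open>A\<close> with local endomorphism ring these are the radical morphisms from \<open>A\<close> to \<open>X\<close>.\<close>

definition rad :: "'o \<Rightarrow> 'o \<Rightarrow> 'm set" where
  "rad A X = {f \<in> homs C A X. \<not> section_mor C A X f}"

lemma rad_subspace:
  assumes A: "local_end C A"
  shows "vs.subspace (rad A X)"
proof (rule vs.subspaceI)
  show "0 \<in> rad A X"
    using local_end_ident_nonzero[OF A] hom_0 cmp_0_right by (fastforce simp: rad_def section_mor_def)
next
  fix f g assume fg: "f \<in> rad A X" "g \<in> rad A X"
  then have h: "f \<in> homs C A X" "g \<in> homs C A X" by (auto simp: rad_def)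
  have "\<not> section_mor C A X (f + g)"
  proof
    assume "section_mor C A X (f + g)"
    then obtain r where r: "r \<in> homs C X A" "r \<cdot> (f + g) = ident C A" by (auto simp: section_mor_def)
    then have "isomorphism C A A (r \<cdot> f + r \<cdot> g)"
      using cmp_add_right[OF h r(1)] isomorphism_ident by simp
    then have "isomorphism C A A (r \<cdot> f) \<or> isomorphism C A A (r \<cdot> g)"
      using local_end_sum[OF A cmp_closed[OF h(1) r(1)] cmp_closed[OF h(2) r(1)]] by blast
    then show False using fg section_of_iso_comp r(1) h by (auto simp: rad_def)
  qed
  then show "f + g \<in> rad A X" using h hom_add by (simp add: rad_def)
next
  fix c f assume f: "f \<in> rad A X"
  then have h: "f \<in> homs C A X" by (auto simp: rad_def)
  have "\<not> section_mor C A X (scl C c f)"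
  proof
    assume "section_mor C A X (scl C c f)"
    then obtain r where r: "r \<in> homs C X A" "r \<cdot> scl C c f = ident C A" by (auto simp: section_mor_def)
    then have "scl C c r \<cdot> f = ident C A" using cmp_scl_left[OF h r(1)] cmp_scl_right[OF h r(1)] by simp
    then show False using f r(1) hom_scl by (auto simp: rad_def section_mor_def)
  qed
  then show "scl C c f \<in> rad A X" using h hom_scl by (simp add: rad_def)
qed

lemma rad_comp: "f \<in> rad A X \<Longrightarrow> g \<in> homs C X Y \<Longrightarrow> g \<cdot> f \<in> rad A Y"
  using section_of_comp cmp_closed by (auto simp: rad_def)

lemma cmp_linear_within:
  assumes "g \<in> homs C X Y" "V \<subseteq> homs C W X"
  shows "linear_within (scl C) (scl C) V (\<lambda>f. g \<cdot> f)"
  using assms cmp_add_right cmp_scl_right unfolding linear_within_def by (meson subsetD)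

text \<open>The family \<open>V\<close> is a subfunctor of \<open>Hom A -\<close>; the instances needed are the whole functor and its
  radical.\<close>

lemma dim_direct_sum_covariant:
  assumes S: "direct_sum C S Xs"
    and V: "\<And>X. ft.fin_subspace (V X)" "\<And>X. V X \<subseteq> homs C A X"
    and act: "\<And>X Y f g. f \<in> V X \<Longrightarrow> g \<in> homs C X Y \<Longrightarrow> g \<cdot> f \<in> V Y"
  shows "vs.dim (V S) = (\<Sum>X\<leftarrow>Xs. vs.dim (V X))"
proof -
  obtain i p where h: "\<And>a. a<length Xs \<Longrightarrow> i a \<in> homs C (Xs ! a) S" "\<And>a. a<length Xs \<Longrightarrow> p a \<in> homs C S (Xs ! a)"
     "\<And>a b. a<length Xs \<Longrightarrow> b<length Xs \<Longrightarrow> p a \<cdot> i b = (if a = b then ident C (Xs ! a) else 0)"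
     "(\<Sum>a<length Xs. i a \<cdot> p a) = ident C S"
    using S unfolding direct_sum_def by blast
  have sV: "vs.subspace (V X)" for X using V(1) by (simp add: ft.fin_subspace_def)
  have VD: "x \<in> homs C A X" if "x \<in> V X" for x X using V(2) that by blast
  have "vs.dim (V S) = (\<Sum>a<length Xs. vs.dim (V (Xs ! a)))"
  proof (rule ft.dim_direct_sum[where p = "\<lambda>a f. p a \<cdot> f" and i = "\<lambda>a f. i a \<cdot> f"])
    show "linear_within (scl C) (scl C) (V S) (\<lambda>f. p a \<cdot> f)" if "a < length Xs" for a
      by (rule cmp_linear_within[OF h(2)[OF that] V(2)])
    show "p a \<cdot> (i a \<cdot> x) = x" if a: "a < length Xs" and x: "x \<in> V (Xs ! a)" for a x
      using cmp_assoc[OF VD[OF x] h(1)[OF a] h(2)[OF a]] h(3)[OF a a] ident_left[OF VD[OF x]] by simp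
    show "p a \<cdot> (i b \<cdot> x) = 0" if "a < length Xs" "b < length Xs" "a \<noteq> b" "x \<in> V (Xs ! b)" for a b x
      using cmp_assoc[OF VD[OF that(4)] h(1)[OF that(2)] h(2)[OF that(1)]] h(3)[OF that(1,2)] that(3)
        cmp_0_left[OF VD[OF that(4)]] by simp
    show "x = 0" if x: "x \<in> V S" and 0: "\<And>a. a < length Xs \<Longrightarrow> p a \<cdot> x = 0" for x
    proof -
      have "x = (\<Sum>a<length Xs. i a \<cdot> p a) \<cdot> x" using h(4) ident_left[OF VD[OF x]] by simp
      also have "\<dots> = (\<Sum>a<length Xs. (i a \<cdot> p a) \<cdot> x)"
        by (rule cmp_sum_left[OF VD[OF x]]) (use cmp_closed[OF h(2) h(1)] in auto)
      also have "\<dots> = 0"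
        using cmp_assoc[OF VD[OF x] h(2) h(1)] 0 cmp_0_right[OF h(1)] by (intro sum.neutral) auto
      finally show ?thesis .
    qed
  qed (use V sV act h in auto)
  then show ?thesis by (simp add: sum_list_sum_nth atLeast0LessThan)
qed

end

locale krull_schmidt_category = additive_category C
  for C :: "('o, 'm::ab_group_add, 'k::field, 'z) lin_cat_scheme" (structure) +
  fixes I :: "'o set"
  assumes hom_fin: "hom_finite C" and krull_schmidt: "krull_schmidt C"
    and reps: "indec_representatives C I"
begin

lemma hom_fin_subspace: "ft.fin_subspace (homs C X Y)"
  using hom_fin homs_subspace by (auto simp: ft.fin_subspace_def hom_finite_def)

text \<open>A nonzero summand in a Krull-Schmidt decomposition of an indecomposable object is the whole object.\<close>

lemma indecomposable_local_end:
  assumes X: "indecomposable C X"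
  shows "local_end C X"
proof -
  obtain Xs where Xs: "direct_sum C X Xs" "\<And>Y. Y \<in> set Xs \<Longrightarrow> local_end C Y"
    using krull_schmidt unfolding krull_schmidt_def by blast
  have "Xs \<noteq> []" using Xs(1) X direct_sum_Nil by (auto simp: indecomposable_def)
  then obtain Y Ys where Ys: "Xs = Y # Ys" by (cases Xs) auto
  obtain R where R: "direct_sum C R Ys" using ex_direct_sum by blast
  have d: "direct_sum C X [Y, R]" using direct_sum_tail Xs(1) R Ys by blast
  have "\<not> zero_object C Y" using Xs(2) Ys local_end_ident_nonzero by (auto simp: zero_object_iff)
  then have "zero_object C R" using X d by (auto simp: indecomposable_def)
  then have "isomorphic C X Y" by (rule direct_sum_zero_right[OF d])
  then show ?thesis using local_end_isomorphic[of Y X] isomorphic_sym Xs(2) Ys by auto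
qed

lemma local_end_indecomposable:
  assumes X: "local_end C X"
  shows "indecomposable C X"
  unfolding indecomposable_def
proof (intro conjI allI impI)
  show "\<not> zero_object C X" using local_end_ident_nonzero[OF X] by (simp add: zero_object_iff)
  fix A B assume "direct_sum C X [A, B]"
  then obtain i1 i2 p1 p2 where s:
    "i1 \<in> homs C A X" "i2 \<in> homs C B X" "p1 \<in> homs C X A" "p2 \<in> homs C X B"
    "p1 \<cdot> i1 = ident C A" "p1 \<cdot> i2 = 0" "p2 \<cdot> i1 = 0" "p2 \<cdot> i2 = ident C B"
    "i1 \<cdot> p1 + i2 \<cdot> p2 = ident C X"
    by (rule direct_sum2E)
  show "zero_object C A \<or> zero_object C B"
  proof (cases "zero_object C A")
    case False
    then have "isomorphism C A X i1"
      using section_into_local_iso[OF X] s by (auto simp: zero_object_iff section_mor_def)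
    then obtain r where r: "r \<in> homs C X A" "i1 \<cdot> r = ident C X" by (auto simp: isomorphism_def)
    have "p2 = (p2 \<cdot> i1) \<cdot> r" using cmp_assoc[OF r(1) s(1,4)] r(2) ident_right[OF s(4)] by simp
    then have "p2 = 0" using s(7) cmp_0_left[OF r(1)] by simp
    then show ?thesis using s(8) cmp_0_left[OF s(2)] by (simp add: zero_object_iff)
  qed simp
qed

lemma rep_indecomposable: "A \<in> I \<Longrightarrow> indecomposable C A"
  using reps by (simp add: indec_representatives_def)

lemma rep_local_end: "A \<in> I \<Longrightarrow> local_end C A"
  using rep_indecomposable indecomposable_local_end by blast

lemma ex_rep: "indecomposable C X \<Longrightarrow> \<exists>A\<in>I. isomorphic C X A"
  using reps unfolding indec_representatives_def by blast

lemma rep_unique: "A \<in> I \<Longrightarrow> B \<in> I \<Longrightarrow> isomorphic C A B \<Longrightarrow> A = B"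
  using reps isomorphic_refl rep_indecomposable unfolding indec_representatives_def by blast

lemma ex_decomposition: "\<exists>Ys. set Ys \<subseteq> I \<and> direct_sum C X Ys"
proof -
  obtain Xs where Xs: "direct_sum C X Xs" "\<And>Y. Y \<in> set Xs \<Longrightarrow> indecomposable C Y"
    using krull_schmidt unfolding krull_schmidt_def by blast
  have "\<forall>Y\<in>set Xs. \<exists>A\<in>I. isomorphic C Y A" using Xs(2) ex_rep by blast
  then obtain r where r: "\<And>Y. Y \<in> set Xs \<Longrightarrow> r Y \<in> I \<and> isomorphic C Y (r Y)" by metis
  have "direct_sum C X (map r Xs)"
    by (rule direct_sum_isomorphic_summands[OF Xs(1)]) (use r in auto)
  then show ?thesis using r by (intro exI[of _ "map r Xs"]) auto
qed

text \<open>For indecomposable \<open>A\<close>, the multiplicity of \<open>A\<close> in \<open>X\<close> times \<open>mult A A\<close>.\<close>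

definition mult :: "'o \<Rightarrow> 'o \<Rightarrow> int" where
  "mult A X = int (vs.dim (homs C A X)) - int (vs.dim (rad A X))"

lemma rad_fin_subspace: "local_end C A \<Longrightarrow> ft.fin_subspace (rad A X)"
  by (rule ft.fin_subspace_subset[OF hom_fin_subspace rad_subspace]) (auto simp: rad_def)

lemma mult_direct_sum:
  assumes A: "A \<in> I" and S: "direct_sum C S Xs"
  shows "mult A S = (\<Sum>X\<leftarrow>Xs. mult A X)"
proof -
  have "vs.dim (homs C A S) = (\<Sum>X\<leftarrow>Xs. vs.dim (homs C A X))"
    by (rule dim_direct_sum_covariant[OF S hom_fin_subspace]) (auto intro: cmp_closed)
  moreover have "vs.dim (rad A S) = (\<Sum>X\<leftarrow>Xs. vs.dim (rad A X))"
    by (rule dim_direct_sum_covariant[OF S rad_fin_subspace])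
      (use A rep_local_end rad_comp in \<open>auto simp: rad_def\<close>)
  moreover have "int (\<Sum>X\<leftarrow>Xs. f X) - int (\<Sum>X\<leftarrow>Xs. g X) = (\<Sum>X\<leftarrow>Xs. int (f X) - int (g X))"
    for f g :: "'o \<Rightarrow> nat" by (induction Xs) auto
  ultimately show ?thesis by (simp add: mult_def)
qed

lemma mult_rep_neq:
  assumes "A \<in> I" "B \<in> I" "A \<noteq> B"
  shows "mult A B = 0"
proof -
  have "rad A B = homs C A B"
    using section_into_local_iso[OF rep_local_end[OF assms(2)]
        local_end_ident_nonzero[OF rep_local_end[OF assms(1)]]] rep_unique[OF assms(1,2)] assms(3)
    by (auto simp: rad_def isomorphic_def)
  then show ?thesis by (simp add: mult_def)
qed

lemma mult_rep_pos:
  assumes A: "A \<in> I"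
  shows "mult A A > 0"
proof -
  have "ident C A \<notin> rad A A" using ident_closed ident_left[OF ident_closed] by (auto simp: rad_def section_mor_def)
  then have "rad A A \<noteq> homs C A A" using ident_closed by auto
  then have "vs.dim (rad A A) < vs.dim (homs C A A)"
    by (intro ft.fin_subspace_dim_less[OF hom_fin_subspace rad_subspace[OF rep_local_end[OF A]]])
      (auto simp: rad_def)
  then show ?thesis by (simp add: mult_def)
qed

lemma pairing_mult:
  assumes A: "A \<in> I" and x: "Poly_Mapping.keys x \<subseteq> I"
  shows "pairing (mult A) x = Poly_Mapping.lookup x A * mult A A"
proof -
  have "pairing (mult A) x = (\<Sum>B\<in>insert A (Poly_Mapping.keys x). Poly_Mapping.lookup x B * mult A B)"
    by (rule pairing_superset) auto
  also have "\<dots> = (\<Sum>B\<in>{A}. Poly_Mapping.lookup x B * mult A B)"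
    by (rule sum.mono_neutral_right) (use mult_rep_neq[OF A] x in auto)
  finally show ?thesis by simp
qed

text \<open>The Krull-Schmidt theorem: two decompositions have the same multiplicities because
  \<open>mult A\<close> is additive.\<close>

lemma decomposition_unique:
  assumes "set Ys \<subseteq> I" "direct_sum C X Ys" "set Zs \<subseteq> I" "direct_sum C X Zs"
  shows "(\<Sum>Y\<leftarrow>Ys. frag_of Y) = (\<Sum>Y\<leftarrow>Zs. frag_of Y)"
proof (rule poly_mapping_eqI)
  fix A
  have k: "Poly_Mapping.keys (\<Sum>Y\<leftarrow>Ys. frag_of Y) \<subseteq> I" "Poly_Mapping.keys (\<Sum>Y\<leftarrow>Zs. frag_of Y) \<subseteq> I"
    using keys_sum_list_frag_of[of Ys] keys_sum_list_frag_of[of Zs] assms(1,3) by auto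
  show "Poly_Mapping.lookup (\<Sum>Y\<leftarrow>Ys. frag_of Y) A = Poly_Mapping.lookup (\<Sum>Y\<leftarrow>Zs. frag_of Y) A"
  proof (cases "A \<in> I")
    case True
    have "pairing (mult A) (\<Sum>Y\<leftarrow>Ys. frag_of Y) = pairing (mult A) (\<Sum>Y\<leftarrow>Zs. frag_of Y)"
      using mult_direct_sum[OF True assms(2)] mult_direct_sum[OF True assms(4)]
      by (simp add: pairing_sum_list)
    then show ?thesis using pairing_mult[OF True k(1)] pairing_mult[OF True k(2)] mult_rep_pos[OF True] by simp
  next
    case False
    then show ?thesis using k by (metis in_keys_iff subsetD)
  qed
qed

lemma cls_eq:
  assumes "set Ys \<subseteq> I" "direct_sum C X Ys"
  shows "cls C I X = (\<Sum>Y\<leftarrow>Ys. frag_of Y)"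
  unfolding cls_def
  by (rule the_equality) (use assms decomposition_unique in blast)+

lemma keys_cls: "Poly_Mapping.keys (cls C I X) \<subseteq> I"
  using ex_decomposition[of X] cls_eq keys_sum_list_frag_of by (metis order_trans)

lemma pairing_cls:
  assumes "\<And>S Xs. direct_sum C S Xs \<Longrightarrow> \<phi> S = (\<Sum>X\<leftarrow>Xs. \<phi> X)"
  shows "pairing \<phi> (cls C I X) = \<phi> X"
proof -
  obtain Ys where "set Ys \<subseteq> I" "direct_sum C X Ys" using ex_decomposition by blast
  then show ?thesis using assms cls_eq pairing_sum_list by metis
qed

lemma lookup_cls:
  assumes A: "A \<in> I"
  shows "Poly_Mapping.lookup (cls C I X) A * mult A A = mult A X"
proof -
  have "pairing (mult A) (cls C I X) = mult A X"
    by (rule pairing_cls) (rule mult_direct_sum[OF A])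
  then show ?thesis using pairing_mult[OF A keys_cls] by metis
qed

lemma cls_eqI:
  assumes "\<And>A. A \<in> I \<Longrightarrow> Poly_Mapping.lookup x A * mult A A = mult A X" "Poly_Mapping.keys x \<subseteq> I"
  shows "cls C I X = x"
proof (rule poly_mapping_eqI)
  fix A show "Poly_Mapping.lookup (cls C I X) A = Poly_Mapping.lookup x A"
  proof (cases "A \<in> I")
    case True
    then show ?thesis using assms(1)[OF True] lookup_cls[OF True] mult_rep_pos[OF True]
      by (metis mult_cancel_right less_irrefl)
  next
    case False
    then show ?thesis using keys_cls assms(2) by (metis in_keys_iff subsetD)
  qed
qed

lemma cls_direct_sum:
  assumes "direct_sum C S [X, Y]"
  shows "cls C I S = cls C I X + cls C I Y"
proof (rule cls_eqI)
  fix A assume A: "A \<in> I"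
  show "Poly_Mapping.lookup (cls C I X + cls C I Y) A * mult A A = mult A S"
    using mult_direct_sum[OF A assms] lookup_cls[OF A] by (simp add: lookup_add distrib_right)
next
  show "Poly_Mapping.keys (cls C I X + cls C I Y) \<subseteq> I"
    using keys_add keys_cls by (meson Un_least order_trans)
qed

lemma cls_zero_object: "zero_object C X \<Longrightarrow> cls C I X = 0"
  using cls_eq[of "[]" X] direct_sum_Nil by simp

end


section \<open>Triangulated categories\<close>

context triangulated_category
begin

lemma smap_hom: "f \<in> homs C X Y \<Longrightarrow> smap C f \<in> homs C (susp C X) (susp C Y)"
  using smap_fully_faithful bij_betwE by blast

lemma ex_smap: "u \<in> homs C (susp C X) (susp C Y) \<Longrightarrow> \<exists>f\<in>homs C X Y. smap C f = u"
  using smap_fully_faithful[of X Y] unfolding bij_betw_def by (metis imageE)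

lemma smap_inj: "f \<in> homs C X Y \<Longrightarrow> g \<in> homs C X Y \<Longrightarrow> smap C f = smap C g \<Longrightarrow> f = g"
  using smap_fully_faithful[of X Y] unfolding bij_betw_def by (meson inj_onD)

lemma smap_0: "smap C 0 = 0"
  using smap_add[OF hom_0 hom_0] by simp

lemma smap_minus: "f \<in> homs C X Y \<Longrightarrow> smap C (- f) = - smap C f"
  using smap_add[of f X Y "- f"] hom_minus smap_0 by (simp add: eq_neg_iff_add_eq_0 add.commute)

lemma smap_diff: "f \<in> homs C X Y \<Longrightarrow> g \<in> homs C X Y \<Longrightarrow> smap C (f - g) = smap C f - smap C g"
  using smap_add[of f X Y "- g"] hom_minus smap_minus[of g X Y] by simp

lemma smap_eq_0: "f \<in> homs C X Y \<Longrightarrow> smap C f = 0 \<Longrightarrow> f = 0"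
  using smap_inj[OF _ hom_0] smap_0 by metis

lemma smap_sum:
  "(\<And>a. a \<in> A \<Longrightarrow> f a \<in> homs C X Y) \<Longrightarrow> smap C (\<Sum>a\<in>A. f a) = (\<Sum>a\<in>A. smap C (f a))"
proof (induction A rule: infinite_finite_induct)
  case (insert a A)
  then have "(\<Sum>a\<in>A. f a) \<in> homs C X Y" by (intro hom_sum) auto
  then show ?case using insert smap_add[of "f a" X Y] by simp
qed (use smap_0 in auto)

lemma zero_object_susp: "zero_object C (susp C X) \<longleftrightarrow> zero_object C X"
  unfolding zero_object_iff using smap_ident[of X] smap_0 smap_eq_0[OF ident_closed] by metis

lemma smap_isomorphism: "isomorphism C X Y f \<Longrightarrow> isomorphism C (susp C X) (susp C Y) (smap C f)"
  unfolding isomorphism_def using smap_hom smap_ident smap_cmp by metis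

lemma susp_isomorphic: "isomorphic C X Y \<Longrightarrow> isomorphic C (susp C X) (susp C Y)"
  unfolding isomorphic_def using smap_isomorphism by blast

lemma isomorphism_of_smap:
  assumes f: "f \<in> homs C X Y" and i: "isomorphism C (susp C X) (susp C Y) (smap C f)"
  shows "isomorphism C X Y f"
proof -
  obtain g' where g': "g' \<in> homs C (susp C Y) (susp C X)" "g' \<cdot> smap C f = ident C (susp C X)"
    "smap C f \<cdot> g' = ident C (susp C Y)" using i by (auto simp: isomorphism_def)
  obtain g where g: "g \<in> homs C Y X" "smap C g = g'" using ex_smap g'(1) by blast
  have "smap C (g \<cdot> f) = smap C (ident C X)" "smap C (f \<cdot> g) = smap C (ident C Y)"
    using smap_cmp[OF f g(1)] smap_cmp[OF g(1) f] g' g smap_ident by simp_all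
  then have "g \<cdot> f = ident C X" "f \<cdot> g = ident C Y"
    using smap_inj[OF cmp_closed[OF f g(1)] ident_closed] smap_inj[OF cmp_closed[OF g(1) f] ident_closed] by blast+
  then show ?thesis using f g by (auto simp: isomorphism_def)
qed

lemma local_end_susp:
  assumes "local_end C (susp C X)"
  shows "local_end C X"
  unfolding local_end_def
proof (intro conjI ballI impI)
  show "ident C X \<noteq> 0" using local_end_ident_nonzero[OF assms] smap_ident[of X] smap_0 by auto
  fix f g assume fg: "f \<in> homs C X X" "g \<in> homs C X X" "\<not> isomorphism C X X f" "\<not> isomorphism C X X g"
  show "\<not> isomorphism C X X (f + g)"
  proof
    assume "isomorphism C X X (f + g)"
    then have "isomorphism C (susp C X) (susp C X) (smap C f + smap C g)"
      using smap_isomorphism smap_add[OF fg(1,2)] by metis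
    then have "isomorphism C (susp C X) (susp C X) (smap C f) \<or> isomorphism C (susp C X) (susp C X) (smap C g)"
      using local_end_sum[OF assms smap_hom smap_hom] fg by blast
    then show False using isomorphism_of_smap fg by blast
  qed
qed

lemma susp_direct_sum2: "direct_sum C S [X, Y] \<Longrightarrow> direct_sum C (susp C S) [susp C X, susp C Y]"
proof (erule direct_sum2E)
  fix i1 i2 p1 p2 assume s:
    "i1 \<in> homs C X S" "i2 \<in> homs C Y S" "p1 \<in> homs C S X" "p2 \<in> homs C S Y"
    "p1 \<cdot> i1 = ident C X" "p1 \<cdot> i2 = 0" "p2 \<cdot> i1 = 0" "p2 \<cdot> i2 = ident C Y"
    "i1 \<cdot> p1 + i2 \<cdot> p2 = ident C S"
  show ?thesis
  proof (rule direct_sum2I[OF smap_hom[OF s(1)] smap_hom[OF s(2)] smap_hom[OF s(3)] smap_hom[OF s(4)]])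
    show "smap C p1 \<cdot> smap C i1 = ident C (susp C X)" "smap C p1 \<cdot> smap C i2 = 0"
      "smap C p2 \<cdot> smap C i1 = 0" "smap C p2 \<cdot> smap C i2 = ident C (susp C Y)"
      using smap_cmp[OF s(1,3)] smap_cmp[OF s(2,3)] smap_cmp[OF s(1,4)] smap_cmp[OF s(2,4)] s(5-8)
        smap_ident smap_0 by simp_all
    show "smap C i1 \<cdot> smap C p1 + smap C i2 \<cdot> smap C p2 = ident C (susp C S)"
      using smap_cmp[OF s(3,1)] smap_cmp[OF s(4,2)] s(9) smap_ident
        smap_add[OF cmp_closed[OF s(3,1)] cmp_closed[OF s(4,2)]] by simp
  qed
qed

lemma direct_sum2_of_susp: "direct_sum C (susp C S) [susp C X, susp C Y] \<Longrightarrow> direct_sum C S [X, Y]"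
proof (erule direct_sum2E)
  fix i1' i2' p1' p2' assume s':
    "i1' \<in> homs C (susp C X) (susp C S)" "i2' \<in> homs C (susp C Y) (susp C S)"
    "p1' \<in> homs C (susp C S) (susp C X)" "p2' \<in> homs C (susp C S) (susp C Y)"
    "p1' \<cdot> i1' = ident C (susp C X)" "p1' \<cdot> i2' = 0" "p2' \<cdot> i1' = 0" "p2' \<cdot> i2' = ident C (susp C Y)"
    "i1' \<cdot> p1' + i2' \<cdot> p2' = ident C (susp C S)"
  obtain i1 i2 p1 p2 where s:
    "i1 \<in> homs C X S" "i2 \<in> homs C Y S" "p1 \<in> homs C S X" "p2 \<in> homs C S Y"
    and m: "smap C i1 = i1'" "smap C i2 = i2'" "smap C p1 = p1'" "smap C p2 = p2'"
    using ex_smap s'(1-4) by metis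
  show ?thesis
  proof (rule direct_sum2I[OF s])
    show "p1 \<cdot> i1 = ident C X"
      by (rule smap_inj[OF cmp_closed[OF s(1,3)] ident_closed]) (use smap_cmp[OF s(1,3)] m s' smap_ident in simp)
    show "p1 \<cdot> i2 = 0"
      by (rule smap_inj[OF cmp_closed[OF s(2,3)] hom_0]) (use smap_cmp[OF s(2,3)] m s' smap_0 in simp)
    show "p2 \<cdot> i1 = 0"
      by (rule smap_inj[OF cmp_closed[OF s(1,4)] hom_0]) (use smap_cmp[OF s(1,4)] m s' smap_0 in simp)
    show "p2 \<cdot> i2 = ident C Y"
      by (rule smap_inj[OF cmp_closed[OF s(2,4)] ident_closed]) (use smap_cmp[OF s(2,4)] m s' smap_ident in simp)
    show "i1 \<cdot> p1 + i2 \<cdot> p2 = ident C S"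
      by (rule smap_inj[OF hom_add[OF cmp_closed[OF s(3,1)] cmp_closed[OF s(4,2)]] ident_closed])
        (use smap_cmp[OF s(3,1)] smap_cmp[OF s(4,2)] m s'(9) smap_ident
          smap_add[OF cmp_closed[OF s(3,1)] cmp_closed[OF s(4,2)]] in simp)
  qed
qed

lemma tri_hom1: "tri C X Y Z f g h \<Longrightarrow> f \<in> homs C X Y" using tri_homs by blast
lemma tri_hom2: "tri C X Y Z f g h \<Longrightarrow> g \<in> homs C Y Z" using tri_homs by blast
lemma tri_hom3: "tri C X Y Z f g h \<Longrightarrow> h \<in> homs C Z (susp C X)" using tri_homs by blast
lemmas tri_hom = tri_hom1 tri_hom2 tri_hom3

lemma rotate: "tri C X Y Z f g h \<Longrightarrow> tri C Y Z (susp C X) g h (- smap C f)"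
  using tri_rotate[OF tri_hom] by blast

lemma tri_cmp1:
  assumes t: "tri C X Y Z f g h"
  shows "g \<cdot> f = 0"
proof -
  note h = tri_hom[OF t]
  obtain O' where O': "zero_object C O'" using ex_zero_object by blast
  obtain c where c: "c \<in> homs C O' Z" "g \<cdot> f = c \<cdot> 0"
    using tri_morphism[OF tri_ident[OF O', of X] t ident_closed h(1)] by blast
  then show ?thesis using cmp_0_right by simp
qed

lemma tri_cmp2: "tri C X Y Z f g h \<Longrightarrow> h \<cdot> g = 0"
  using tri_cmp1 rotate by blast

lemma tri_cmp3: assumes t: "tri C X Y Z f g h" shows "smap C f \<cdot> h = 0"
  using tri_cmp1[OF rotate[OF rotate[OF t]]] cmp_minus_left[OF tri_hom3[OF t] smap_hom[OF tri_hom1[OF t]]]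
  by simp

lemma zero_object_hom: "zero_object C X \<Longrightarrow> f \<in> homs C X Y \<Longrightarrow> f = 0"
  "zero_object C X \<Longrightarrow> f \<in> homs C Y X \<Longrightarrow> f = 0"
  by (auto simp: zero_object_def)

lemma tri_zero_ident:
  assumes O': "zero_object C O'"
  shows "tri C O' W W 0 (ident C W) 0"
proof -
  have "tri C W W (susp C O') (ident C W) 0 0" using tri_ident zero_object_susp O' by blast
  then show ?thesis using tri_rotate[OF hom_0[of O' W] ident_closed hom_0[of W "susp C O'"]] smap_0 by simp
qed

text \<open>The pair \<open>(0, u)\<close> extends to a morphism from the given triangle to the triangle \<open>0 \<rightarrow> W \<rightarrow> W\<close>.  This
  lemma, its dual \<open>weak_kernel\<close>, and their rotations are the exactness of the Hom functors.\<close>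

lemma weak_cokernel:
  assumes t: "tri C X Y Z f g h" and u: "u \<in> homs C Y W" "u \<cdot> f = 0"
  shows "\<exists>u'\<in>homs C Z W. u = u' \<cdot> g"
proof -
  obtain O' where O': "zero_object C O'" using ex_zero_object by blast
  have "0 \<cdot> 0 = u \<cdot> f" using u(2) cmp_0_left[OF hom_0] by simp
  then obtain c where c: "c \<in> homs C Z W" "ident C W \<cdot> u = c \<cdot> g"
    using tri_morphism[OF t tri_zero_ident[OF O'] hom_0 u(1)] u(2) cmp_0_left[OF hom_0[of X O']] by auto
  then show ?thesis using ident_left[OF u(1)] by auto
qed

lemma weak_cokernel_rotated:
  assumes t: "tri C X Y Z f g h" and u: "u \<in> homs C Z W" "u \<cdot> g = 0"
  shows "\<exists>u'\<in>homs C (susp C X) W. u = u' \<cdot> h"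
  using weak_cokernel[OF rotate[OF t] u] .

lemma weak_cokernel_susp:
  assumes t: "tri C X Y Z f g h" and u: "u \<in> homs C X W" "smap C u \<cdot> h = 0"
  shows "\<exists>u'\<in>homs C Y W. u = u' \<cdot> f"
proof -
  note h = tri_hom[OF t]
  obtain w where w: "w \<in> homs C (susp C Y) (susp C W)" "smap C u = w \<cdot> (- smap C f)"
    using weak_cokernel[OF rotate[OF rotate[OF t]] smap_hom[OF u(1)] u(2)] by blast
  obtain v where v: "v \<in> homs C Y W" "smap C v = w" using ex_smap w(1) by blast
  have "smap C u = smap C ((- v) \<cdot> f)"
    using w(2) v cmp_minus_right[OF smap_hom[OF h(1)] w(1)] smap_cmp[OF h(1) v(1)]
      smap_minus[OF cmp_closed[OF h(1) v(1)]] cmp_minus_left[OF h(1) v(1)] by simp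
  then have "u = (- v) \<cdot> f" using smap_inj[OF u(1) cmp_closed[OF h(1) hom_minus[OF v(1)]]] by blast
  then show ?thesis using hom_minus[OF v(1)] by blast
qed

text \<open>Dually, \<open>(u, 0)\<close> extends to a morphism from the triangle \<open>W \<rightarrow> 0 \<rightarrow> susp W\<close> to the rotated triangle.\<close>

lemma weak_kernel:
  assumes t: "tri C X Y Z f g h" and u: "u \<in> homs C W Y" "g \<cdot> u = 0"
  shows "\<exists>u'\<in>homs C W X. u = f \<cdot> u'"
proof -
  note h = tri_hom[OF t]
  obtain O' where O': "zero_object C O'" using ex_zero_object by blast
  have r: "tri C W O' (susp C W) 0 0 (- smap C (ident C W))"
    using rotate[OF tri_ident[OF O']] .
  have "g \<cdot> u = 0 \<cdot> 0" using u(2) cmp_0_left[OF hom_0] by simp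
  then obtain c where c: "c \<in> homs C (susp C W) (susp C X)"
    "(- smap C f) \<cdot> c = smap C u \<cdot> (- smap C (ident C W))"
    using tri_morphism[OF r rotate[OF t] u(1) hom_0[of O' Z]] u(2) cmp_0_left[OF hom_0[of W O']] by auto
  obtain v where v: "v \<in> homs C W X" "smap C v = c" using ex_smap c(1) by blast
  have "smap C (f \<cdot> v) = smap C u"
    using c(2) v smap_cmp[OF v(1) h(1)] cmp_minus_left[OF c(1) smap_hom[OF h(1)]]
      cmp_minus_right[OF ident_closed smap_hom[OF u(1)]] ident_right[OF smap_hom[OF u(1)]]
    by (simp add: smap_ident)
  then have "f \<cdot> v = u" using smap_inj[OF cmp_closed[OF v(1) h(1)] u(1)] by blast
  then show ?thesis using v by blast
qed

lemma weak_kernel_rotated: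
  assumes t: "tri C X Y Z f g h" and u: "u \<in> homs C W Z" "h \<cdot> u = 0"
  shows "\<exists>u'\<in>homs C W Y. u = g \<cdot> u'"
  using weak_kernel[OF rotate[OF t] u] .

lemma weak_kernel_susp:
  assumes t: "tri C X Y Z f g h" and u: "u \<in> homs C W (susp C X)" "smap C f \<cdot> u = 0"
  shows "\<exists>u'\<in>homs C W Z. u = h \<cdot> u'"
  using weak_kernel[OF rotate[OF rotate[OF t]] u(1)] u(2)
    cmp_minus_left[OF u(1) smap_hom[OF tri_hom1[OF t]]] by simp

lemma tri_replace_third:
  assumes t: "tri C X Y Z f g h" and q: "q \<in> homs C Z Z'" "q' \<in> homs C Z' Z"
    "q' \<cdot> q = ident C Z" "q \<cdot> q' = ident C Z'"
  shows "tri C X Y Z' f (q \<cdot> g) (h \<cdot> q')"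
proof (rule tri_iso[OF t])
  note h = tri_hom[OF t]
  show "f \<in> homs C X Y" "q \<cdot> g \<in> homs C Y Z'" "h \<cdot> q' \<in> homs C Z' (susp C X)"
    using h cmp_closed[OF h(2) q(1)] cmp_closed[OF q(2) h(3)] by simp_all
  show "isomorphism C X X (ident C X)" "isomorphism C Y Y (ident C Y)" "isomorphism C Z Z' q"
    using isomorphism_ident q by (auto simp: isomorphism_def)
  show "f \<cdot> ident C X = ident C Y \<cdot> f" using ident_left[OF h(1)] ident_right[OF h(1)] by simp
  show "(q \<cdot> g) \<cdot> ident C Y = q \<cdot> g" using ident_right[OF cmp_closed[OF h(2) q(1)]] .
  show "(h \<cdot> q') \<cdot> q = smap C (ident C X) \<cdot> h"
    using cmp_assoc[OF q(1,2) h(3)] q(3) ident_right[OF h(3)] ident_left[OF h(3)] smap_ident by simp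
qed

text \<open>The cone of \<open>v\<close> is only isomorphic to a suspension, because \<open>susp\<close> is an autoequivalence rather than an
  automorphism.\<close>

lemma ex_tri_second:
  assumes v: "v \<in> homs C Z V"
  shows "\<exists>K i c. tri C K Z V i v c"
proof -
  obtain U a b where t: "tri C Z V U v a b" using tri_exists[OF v] by blast
  obtain K where "isomorphic C (susp C K) U" using susp_essentially_surjective by blast
  then obtain q q' where q: "q \<in> homs C U (susp C K)" "q' \<in> homs C (susp C K) U"
    "q' \<cdot> q = ident C U" "q \<cdot> q' = ident C (susp C K)"
    by (auto simp: isomorphic_def isomorphism_def)
  have t': "tri C Z V (susp C K) v (q \<cdot> a) (b \<cdot> q')" by (rule tri_replace_third[OF t q])
  obtain j where j: "j \<in> homs C K Z" "smap C j = b \<cdot> q'" using ex_smap tri_hom3[OF t'] by blast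
  have "tri C K Z V (- j) v (q \<cdot> a)"
    using tri_rotate[OF hom_minus[OF j(1)] v tri_hom2[OF t']] t' smap_minus[OF j(1)] j(2) by simp
  then show ?thesis by blast
qed

lemma ex_tri_third:
  assumes h: "h \<in> homs C Z (susp C X)"
  shows "\<exists>E f g. tri C X E Z f g h"
proof -
  obtain E g c where t: "tri C E Z (susp C X) g h c" using ex_tri_second[OF h] by blast
  obtain f where f: "f \<in> homs C X E" "smap C f = c" using ex_smap tri_hom3[OF t] by blast
  have "tri C X E Z (- f) g h"
    using tri_rotate[OF hom_minus[OF f(1)] tri_hom1[OF t] h] t smap_minus[OF f(1)] f(2) by simp
  then show ?thesis by blast
qed

lemma direct_sum_of_retraction:
  assumes t: "tri C X Y Z f g 0" and r: "r \<in> homs C Y X" "r \<cdot> f = ident C X"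
  shows "direct_sum C Y [X, Z]"
proof -
  note h = tri_hom[OF t]
  have epi: "u = 0" if "u \<in> homs C Z W" "u \<cdot> g = 0" for u W
    using weak_cokernel_rotated[OF t that] cmp_0_right by auto
  let ?e = "ident C Y - f \<cdot> r"
  have fr: "f \<cdot> r \<in> homs C Y Y" by (rule cmp_closed[OF r(1) h(1)])
  have e: "?e \<in> homs C Y Y" using hom_diff[OF ident_closed fr] .
  have "?e \<cdot> f = 0"
    using cmp_diff_left[OF h(1) ident_closed fr] ident_left[OF h(1)] cmp_assoc[OF h(1) r(1) h(1)] r(2)
      ident_right[OF h(1)] by simp
  then obtain s where s: "s \<in> homs C Z Y" "?e = s \<cdot> g" using weak_cokernel[OF t e] by blast
  have "(g \<cdot> s) \<cdot> g = g \<cdot> ?e" using cmp_assoc[OF h(2) s(1) h(2)] s(2) by simp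
  also have "\<dots> = g"
    using cmp_diff_right[OF ident_closed fr h(2)] ident_right[OF h(2)] cmp_assoc[OF r(1) h(1,2)]
      tri_cmp1[OF t] cmp_0_left[OF r(1)] by simp
  finally have "(g \<cdot> s - ident C Z) \<cdot> g = 0"
    using cmp_diff_left[OF h(2) cmp_closed[OF s(1) h(2)] ident_closed] ident_left[OF h(2)] by simp
  then have gs: "g \<cdot> s = ident C Z"
    using epi[OF hom_diff[OF cmp_closed[OF s(1) h(2)] ident_closed]] by simp
  have "(r \<cdot> s) \<cdot> g = r \<cdot> ?e" using cmp_assoc[OF h(2) s(1) r(1)] s(2) by simp
  also have "\<dots> = 0"
    using cmp_diff_right[OF ident_closed fr r(1)] ident_right[OF r(1)] cmp_assoc[OF r(1) h(1) r(1)]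
      r(2) ident_left[OF r(1)] by simp
  finally have rs: "r \<cdot> s = 0" using epi[OF cmp_closed[OF s(1) r(1)]] by simp
  have "f \<cdot> r + s \<cdot> g = ident C Y" using s(2) by (simp add: algebra_simps)
  then show ?thesis using direct_sum2I[OF h(1) s(1) r(1) h(2) r(2) rs tri_cmp1[OF t] gs] by simp
qed

text \<open>When the third morphism vanishes, the identity of \<open>X\<close> factors through \<open>f\<close>.\<close>

lemma direct_sum_of_tri:
  assumes t: "tri C X Y Z f g 0"
  shows "direct_sum C Y [X, Z]"
proof -
  have "smap C (ident C X) \<cdot> 0 = 0" using cmp_0_right[OF ident_closed] smap_ident by simp
  then obtain r where "r \<in> homs C Y X" "ident C X = r \<cdot> f"
    using weak_cokernel_susp[OF t ident_closed] by blast
  then show ?thesis using direct_sum_of_retraction[OF t] by simp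
qed

text \<open>The octahedron on the composite \<open>h \<cdot> v\<close> yields a triangle \<open>susp K \<rightarrow> susp Z' \<rightarrow> susp E\<close>
  whose connecting morphism is minus the suspension of \<open>c \<cdot> g\<close>, so that it splits.\<close>

lemma octahedron_split:
  assumes t1: "tri C X E V f g h" and t2: "tri C K Z V i v c" and t3: "tri C X Z' Z f' g' (h \<cdot> v)"
    and 0: "c \<cdot> g = 0"
  shows "direct_sum C Z' [K, E]"
proof -
  obtain F G where "tri C (susp C K) (susp C Z') (susp C E) F G (smap C c \<cdot> - smap C g)"
    using tri_octahedral[OF rotate[OF t2] rotate[OF rotate[OF t1]] rotate[OF rotate[OF t3]]] by blast
  moreover have "smap C c \<cdot> - smap C g = 0"
    using cmp_minus_right[OF smap_hom[OF tri_hom2[OF t1]] smap_hom[OF tri_hom3[OF t2]]]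
      smap_cmp[OF tri_hom2[OF t1] tri_hom3[OF t2]] 0 smap_0 by simp
  ultimately have "direct_sum C (susp C Z') [susp C K, susp C E]" using direct_sum_of_tri by simp
  then show ?thesis by (rule direct_sum2_of_susp)
qed

end


section \<open>Cluster-tilting objects\<close>

context linear_category
begin

lemma sum_component_eq:
  assumes i: "\<And>a. a < n \<Longrightarrow> i a \<in> homs C (Xs a) S" and p: "\<And>a. a < n \<Longrightarrow> p a \<in> homs C S (Xs a)"
    and s: "(\<Sum>a<n. i a \<cdot> p a) = ident C S" and u: "u \<in> homs C S B"
  shows "u = (\<Sum>a<(n::nat). (u \<cdot> i a) \<cdot> p a)"
proof -
  have "u = u \<cdot> (\<Sum>a<n. i a \<cdot> p a)" using s ident_right[OF u] by simp
  also have "\<dots> = (\<Sum>a<n. u \<cdot> (i a \<cdot> p a))"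
    by (rule cmp_sum_right[OF u]) (use cmp_closed[OF p i] in auto)
  also have "\<dots> = (\<Sum>a<n. (u \<cdot> i a) \<cdot> p a)"
    using cmp_assoc[OF p i u] by (intro sum.cong) auto
  finally show ?thesis .
qed

lemma sum_component_eq':
  assumes i: "\<And>a. a < n \<Longrightarrow> i a \<in> homs C (Xs a) S" and p: "\<And>a. a < n \<Longrightarrow> p a \<in> homs C S (Xs a)"
    and s: "(\<Sum>a<n. i a \<cdot> p a) = ident C S" and u: "u \<in> homs C B S"
  shows "u = (\<Sum>a<(n::nat). i a \<cdot> (p a \<cdot> u))"
proof -
  have "u = (\<Sum>a<n. i a \<cdot> p a) \<cdot> u" using s ident_left[OF u] by simp
  also have "\<dots> = (\<Sum>a<n. (i a \<cdot> p a) \<cdot> u)"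
    by (rule cmp_sum_left[OF u]) (use cmp_closed[OF p i] in auto)
  also have "\<dots> = (\<Sum>a<n. i a \<cdot> (p a \<cdot> u))"
    using cmp_assoc[OF u p i] by (intro sum.cong) auto
  finally show ?thesis .
qed

lemma homs_zero_direct_sum:
  assumes "direct_sum C S [X, Y]" "homs C A X = {0}" "homs C A Y = {0}"
  shows "homs C A S = {0}"
proof -
  obtain i1 i2 p1 p2 where s:
    "i1 \<in> homs C X S" "i2 \<in> homs C Y S" "p1 \<in> homs C S X" "p2 \<in> homs C S Y"
    "p1 \<cdot> i1 = ident C X" "p1 \<cdot> i2 = 0" "p2 \<cdot> i1 = 0" "p2 \<cdot> i2 = ident C Y"
    "i1 \<cdot> p1 + i2 \<cdot> p2 = ident C S"
    using direct_sum2E[OF assms(1)] .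
  have "u = 0" if u: "u \<in> homs C A S" for u
  proof -
    have "p1 \<cdot> u = 0" "p2 \<cdot> u = 0" using cmp_closed[OF u s(3)] cmp_closed[OF u s(4)] assms by auto
    then have "(i1 \<cdot> p1 + i2 \<cdot> p2) \<cdot> u = 0"
      using cmp_add_left[OF u cmp_closed[OF s(3,1)] cmp_closed[OF s(4,2)]] cmp_assoc[OF u s(3,1)]
        cmp_assoc[OF u s(4,2)] cmp_0_right[OF s(1)] cmp_0_right[OF s(2)] by simp
    then show ?thesis using s(9) ident_left[OF u] by simp
  qed
  then show ?thesis using hom_0 by blast
qed

lemma homs_zero_retract:
  assumes s: "section_mor C X Y s" and Y: "homs C A Y = {0}"
  shows "homs C A X = {0}"
proof -
  obtain r where r: "s \<in> homs C X Y" "r \<in> homs C Y X" "r \<cdot> s = ident C X"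
    using s by (auto simp: section_mor_def)
  have "u = 0" if u: "u \<in> homs C A X" for u
  proof -
    have "u = r \<cdot> (s \<cdot> u)" using cmp_assoc[OF u r(1,2)] r(3) ident_left[OF u] by simp
    moreover have "s \<cdot> u = 0" using cmp_closed[OF u r(1)] Y by auto
    ultimately show ?thesis using cmp_0_right[OF r(2)] by simp
  qed
  then show ?thesis using hom_0 by blast
qed

lemma homs_zero_isomorphic: "isomorphic C X Y \<Longrightarrow> homs C A X = {0} \<Longrightarrow> homs C A Y = {0}"
  using homs_zero_retract[of Y X] unfolding isomorphic_def isomorphism_def section_mor_def by blast

end

lemma (in additive_category) add_closure_direct_sum:
  "direct_sum C S Xs \<Longrightarrow> set Xs \<subseteq> \<A> \<Longrightarrow> S \<in> add_closure C \<A>"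
proof (induction Xs arbitrary: S)
  case Nil
  then have "zero_object C S" by (simp add: direct_sum_Nil)
  then show ?case by (rule add_closure.zero)
next
  case (Cons X Xs)
  obtain R where R: "direct_sum C R Xs" using ex_direct_sum by blast
  have "direct_sum C S [X, R]" using direct_sum_tail[OF Cons.prems(1) R] .
  moreover have "X \<in> add_closure C \<A>" using Cons.prems(2) by (intro add_closure.base) simp
  moreover have "R \<in> add_closure C \<A>" using Cons.IH[OF R] Cons.prems(2) by simp
  ultimately show ?case by (rule add_closure.sum[rotated 2])
qed

locale cluster_tilting_category = triangulated_category C + krull_schmidt_category C I
  for C :: "('o, 'm::ab_group_add, 'k::field, 'z) tri_cat_scheme" (structure) and I :: "'o set" +
  fixes T :: 'o and Ts :: "'o list"
  assumes cy: "two_calabi_yau C" and ct: "basic_cluster_tilting C T Ts"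
begin

abbreviation "addT \<equiv> add_closure C (set Ts)"
abbreviation "addST \<equiv> add_susp C Ts"

lemma T_sum: "direct_sum C T Ts"
  using ct by (simp add: basic_cluster_tilting_def)

lemma addT_iff: "X \<in> addT \<longleftrightarrow> homs C T (susp C X) = {0}"
  using ct by (simp add: basic_cluster_tilting_def)

lemma T_in_addT: "T \<in> addT"
  using add_closure_direct_sum[OF T_sum] by blast

lemma addT_susp: "X \<in> addT \<Longrightarrow> susp C X \<in> addST"
  unfolding add_susp_def
proof (induction rule: add_closure.induct)
  case (base X)
  then show ?case by (intro add_closure.base) simp
next
  case (zero X)
  then show ?case using add_closure.zero[of C "susp C X"] by (simp add: zero_object_susp)
next
  case (sum X Y Z)
  show ?case by (rule add_closure.sum[OF sum.IH susp_direct_sum2[OF sum.hyps(3)]])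
next
  case (iso X Y)
  show ?case by (rule add_closure.iso[OF iso.IH susp_isomorphic[OF iso.hyps(2)]])
qed

text \<open>This is the cluster-tilting condition read at a desuspension of \<open>X\<close>.\<close>

lemma addST_iff: "X \<in> addST \<longleftrightarrow> homs C T X = {0}"
proof
  show "X \<in> addST \<Longrightarrow> homs C T X = {0}"
    unfolding add_susp_def
  proof (induction rule: add_closure.induct)
    case (base X)
    then obtain Y where "X = susp C Y" "Y \<in> set Ts" by blast
    then have "Y \<in> addT" by (intro add_closure.base)
    then show ?case using \<open>X = susp C Y\<close> by (simp add: addT_iff)
  next
    case (zero X)
    then show ?case by (simp add: zero_object_def)
  next
    case (sum X Y Z)
    show ?case by (rule homs_zero_direct_sum[OF sum.hyps(3) sum.IH])
  next
    case (iso X Y)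
    show ?case by (rule homs_zero_isomorphic[OF iso.hyps(2) iso.IH])
  qed
next
  assume X: "homs C T X = {0}"
  obtain Y where Y: "isomorphic C (susp C Y) X" using susp_essentially_surjective by blast
  then have "homs C T (susp C Y) = {0}" by (intro homs_zero_isomorphic[OF isomorphic_sym X])
  then have "susp C Y \<in> addST" by (intro addT_susp) (simp add: addT_iff)
  then show "X \<in> addST" using Y unfolding add_susp_def by (rule add_closure.iso)
qed

text \<open>\<open>F_null Z h\<close> means that \<open>F h = 0\<close>, where \<open>Z\<close> is the source of \<open>h\<close>.\<close>

definition F_null :: "'o \<Rightarrow> 'm \<Rightarrow> bool" where
  "F_null Z h \<longleftrightarrow> (\<forall>t\<in>homs C T Z. h \<cdot> t = 0)"

text \<open>The condition holds for the summands of \<open>T\<close>, and \<open>add(T)\<close> is built from them by operations that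
  preserve it.\<close>

lemma addT_faithful: "X \<in> addT \<Longrightarrow> w \<in> homs C X B \<Longrightarrow> F_null X w \<Longrightarrow> w = 0"
proof (induction arbitrary: w rule: add_closure.induct)
  case (base X)
  then obtain a where a: "a < length Ts" "X = Ts ! a" by (metis in_set_conv_nth)
  obtain i p where ip: "i \<in> homs C X T" "p \<in> homs C T X" "p \<cdot> i = ident C X"
    using T_sum a unfolding direct_sum_def by metis
  have "w = (w \<cdot> p) \<cdot> i" using cmp_assoc[OF ip(1,2) base(2)] ip(3) ident_right[OF base(2)] by simp
  then show ?case using base(3) ip(2) cmp_0_left[OF ip(1)] by (simp add: F_null_def)
next
  case (zero X)
  then show ?case using zero_object_hom(1) by blast
next
  case (sum X Y Z)
  obtain i1 i2 p1 p2 where s: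
    "i1 \<in> homs C X Z" "i2 \<in> homs C Y Z" "p1 \<in> homs C Z X" "p2 \<in> homs C Z Y"
    "p1 \<cdot> i1 = ident C X" "p1 \<cdot> i2 = 0" "p2 \<cdot> i1 = 0" "p2 \<cdot> i2 = ident C Y"
    "i1 \<cdot> p1 + i2 \<cdot> p2 = ident C Z"
    using direct_sum2E[OF sum(3)] .
  note w = sum.prems(1)
  have "F_null X (w \<cdot> i1)" "F_null Y (w \<cdot> i2)"
    using sum.prems(2) cmp_assoc[OF _ s(1) w] cmp_assoc[OF _ s(2) w] cmp_closed[OF _ s(1)] cmp_closed[OF _ s(2)]
    unfolding F_null_def by metis+
  then have 0: "w \<cdot> i1 = 0" "w \<cdot> i2 = 0"
    using sum.IH cmp_closed[OF s(1) w] cmp_closed[OF s(2) w] by blast+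
  have "w = w \<cdot> (i1 \<cdot> p1 + i2 \<cdot> p2)" using s(9) ident_right[OF w] by simp
  also have "\<dots> = (w \<cdot> i1) \<cdot> p1 + (w \<cdot> i2) \<cdot> p2"
    using cmp_add_right[OF cmp_closed[OF s(3,1)] cmp_closed[OF s(4,2)] w] cmp_assoc[OF s(3,1) w]
      cmp_assoc[OF s(4,2) w] by simp
  finally show ?case using 0 cmp_0_left[OF s(3)] cmp_0_left[OF s(4)] by simp
next
  case (iso X Y)
  obtain t t' where t: "t \<in> homs C X Y" "t' \<in> homs C Y X" "t \<cdot> t' = ident C Y"
    using iso(2) by (auto simp: isomorphic_def isomorphism_def)
  note w = iso.prems(1)
  have "F_null X (w \<cdot> t)"
    using iso.prems(2) cmp_assoc[OF _ t(1) w] cmp_closed[OF _ t(1)] unfolding F_null_def by metis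
  then have "w \<cdot> t = 0" using iso.IH cmp_closed[OF t(1) w] by blast
  then show ?case using cmp_assoc[OF t(2,1) w] t(3) ident_right[OF w] cmp_0_left[OF t(2)] by simp
qed

text \<open>Up to suspension, this is the vanishing of the morphisms from \<open>add(T)\<close> to \<open>A\<close>, which is a statement
  about \<open>Hom T A\<close> because \<open>F\<close> is faithful on \<open>add(T)\<close>.\<close>

lemma addST_susp_hom_zero:
  assumes W: "W \<in> addST" and A: "A \<in> addST" and u: "u \<in> homs C W (susp C A)"
  shows "u = 0"
proof -
  obtain K where K: "isomorphic C (susp C K) W" using susp_essentially_surjective by blast
  have "homs C T W = {0}" using W by (simp add: addST_iff)
  then have KT: "K \<in> addT" unfolding addT_iff by (rule homs_zero_isomorphic[OF isomorphic_sym[OF K]])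
  obtain t t' where t: "t \<in> homs C (susp C K) W" "t' \<in> homs C W (susp C K)" "t \<cdot> t' = ident C W"
    using K by (auto simp: isomorphic_def isomorphism_def)
  obtain w where w: "w \<in> homs C K A" "smap C w = u \<cdot> t" using ex_smap cmp_closed[OF t(1) u] by blast
  have "F_null K w" using cmp_closed[OF _ w(1), of _ T] A unfolding F_null_def addST_iff by auto
  then have "u \<cdot> t = 0" using addT_faithful[OF KT w(1)] w(2) smap_0 by simp
  then show ?thesis using cmp_assoc[OF t(2,1) u] t(3) ident_right[OF u] cmp_0_left[OF t(2)] by simp
qed

text \<open>A spanning list of \<open>Hom T X\<close> gives a morphism from a power of \<open>T\<close> to \<open>X\<close> that is surjective
  under \<open>F\<close>; the long exact sequence puts its cocone into \<open>add(T)\<close>.\<close>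

lemma ex_approximation:
  obtains K S n i p \<kappa> \<pi> c where
    "tri C K S X \<kappa> \<pi> c" "K \<in> addT"
    "\<And>a. a < (n::nat) \<Longrightarrow> i a \<in> homs C T S" "\<And>a. a < n \<Longrightarrow> p a \<in> homs C S T"
    "(\<Sum>a<n. i a \<cdot> p a) = ident C S"
    "\<And>x. x \<in> homs C T X \<Longrightarrow> \<exists>s\<in>homs C T S. x = \<pi> \<cdot> s"
proof -
  obtain B where B: "finite B" "vs.span B = homs C T X"
    using hom_fin unfolding hom_finite_def by blast
  obtain xs where xs: "set xs = B" using finite_list[OF B(1)] by blast
  let ?n = "length xs"
  have xsh: "xs ! a \<in> homs C T X" if "a < ?n" for a
  proof -
    have "xs ! a \<in> B" using that xs nth_mem by blast
    then show ?thesis using B(2) vs.span_base by blast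
  qed
  obtain S where S: "direct_sum C S (replicate ?n T)" using ex_direct_sum by blast
  obtain i p where ip: "\<And>a. a < ?n \<Longrightarrow> i a \<in> homs C T S" "\<And>a. a < ?n \<Longrightarrow> p a \<in> homs C S T"
    "\<And>a b. a < ?n \<Longrightarrow> b < ?n \<Longrightarrow> p a \<cdot> i b = (if a = b then ident C T else 0)"
    "(\<Sum>a<?n. i a \<cdot> p a) = ident C S"
  proof -
    obtain i p where
      "\<forall>a<length (replicate ?n T). i a \<in> homs C (replicate ?n T ! a) S \<and> p a \<in> homs C S (replicate ?n T ! a)"
      "\<forall>a<length (replicate ?n T). \<forall>b<length (replicate ?n T).
         p a \<cdot> i b = (if a = b then ident C (replicate ?n T ! a) else 0)"
      "(\<Sum>a<length (replicate ?n T). i a \<cdot> p a) = ident C S"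
      using S unfolding direct_sum_def by blast
    then show thesis by (intro that[of i p]) simp_all
  qed
  define \<pi> where "\<pi> = (\<Sum>a<?n. xs ! a \<cdot> p a)"
  have \<pi>: "\<pi> \<in> homs C S X" unfolding \<pi>_def using cmp_closed[OF ip(2) xsh] by (intro hom_sum) auto
  have \<pi>i: "\<pi> \<cdot> i b = xs ! b" if b: "b < ?n" for b
  proof -
    have "\<pi> \<cdot> i b = (\<Sum>a<?n. (xs ! a \<cdot> p a) \<cdot> i b)"
      unfolding \<pi>_def by (rule cmp_sum_left[OF ip(1)[OF b]]) (use cmp_closed[OF ip(2) xsh] in auto)
    also have "\<dots> = (\<Sum>a<?n. if a = b then xs ! b else 0)"
      using cmp_assoc[OF ip(1)[OF b] ip(2) xsh] ip(3)[OF _ b] ident_right[OF xsh] cmp_0_right[OF xsh]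
      by (intro sum.cong) auto
    finally show ?thesis using b by simp
  qed
  let ?R = "{x \<in> homs C T X. \<exists>s\<in>homs C T S. x = \<pi> \<cdot> s}"
  have "vs.subspace ?R"
  proof (rule vs.subspaceI)
    show "0 \<in> ?R" using hom_0 cmp_0_right[OF \<pi>] by auto
  next
    fix x y assume "x \<in> ?R" "y \<in> ?R"
    then obtain s s' where "x \<in> homs C T X" "y \<in> homs C T X" "s \<in> homs C T S" "s' \<in> homs C T S"
      "x = \<pi> \<cdot> s" "y = \<pi> \<cdot> s'" by blast
    then show "x + y \<in> ?R" using hom_add cmp_add_right[OF _ _ \<pi>] by (auto intro!: bexI[of _ "s + s'"])
  next
    fix c x assume "x \<in> ?R"
    then obtain s where "x \<in> homs C T X" "s \<in> homs C T S" "x = \<pi> \<cdot> s" by blast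
    then show "scl C c x \<in> ?R" using hom_scl cmp_scl_right[OF _ \<pi>] by (auto intro!: bexI[of _ "scl C c s"])
  qed
  moreover have "B \<subseteq> ?R"
  proof
    fix x assume "x \<in> B"
    then obtain b where "b < ?n" "x = xs ! b" using xs by (metis in_set_conv_nth)
    then show "x \<in> ?R" using \<pi>i[of b, symmetric] ip(1)[of b] xsh[of b] by blast
  qed
  ultimately have "homs C T X \<subseteq> ?R" using vs.span_minimal[of B ?R] unfolding B(2) by blast
  then have surj: "\<exists>s\<in>homs C T S. x = \<pi> \<cdot> s" if "x \<in> homs C T X" for x using that by blast
  obtain K \<kappa> c where t: "tri C K S X \<kappa> \<pi> c" using ex_tri_second[OF \<pi>] by blast
  note th = tri_hom[OF t]
  \<comment> \<open>\<open>u\<close> vanishes in \<open>Hom T (susp S) = 0\<close>, so it comes from \<open>Hom T X\<close>, all of which lifts to \<open>S\<close>.\<close>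
  have "u = 0" if u: "u \<in> homs C T (susp C K)" for u
  proof -
    have Su: "smap C \<kappa> \<cdot> u \<in> homs C T (susp C S)" using cmp_closed[OF u smap_hom[OF th(1)]] .
    have ss: "(\<Sum>a<?n. smap C (i a) \<cdot> smap C (p a)) = ident C (susp C S)"
    proof -
      have "(\<Sum>a<?n. smap C (i a) \<cdot> smap C (p a)) = (\<Sum>a<?n. smap C (i a \<cdot> p a))"
        using smap_cmp[OF ip(2,1)] by (intro sum.cong) auto
      also have "\<dots> = smap C (\<Sum>a<?n. i a \<cdot> p a)"
        by (rule smap_sum[symmetric]) (use cmp_closed[OF ip(2,1)] in auto)
      finally show ?thesis using ip(4) smap_ident by simp
    qed
    have "smap C (p a) \<cdot> v = 0" if "a < ?n" "v \<in> homs C T (susp C S)" for a v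
      using cmp_closed[OF that(2) smap_hom[OF ip(2)[OF that(1)]]] T_in_addT addT_iff[of T] by auto
    then have "smap C \<kappa> \<cdot> u = 0"
      using sum_component_eq'[OF smap_hom[OF ip(1)] smap_hom[OF ip(2)] ss Su] Su
        cmp_0_right[OF smap_hom[OF ip(1)]] by (simp add: sum.neutral)
    then obtain x where x: "x \<in> homs C T X" "u = c \<cdot> x" using weak_kernel_susp[OF t u] by blast
    then obtain s where s: "s \<in> homs C T S" "x = \<pi> \<cdot> s" using surj by blast
    show ?thesis using x s cmp_assoc[OF s(1) th(2,3)] tri_cmp2[OF t] cmp_0_left[OF s(1)] by simp
  qed
  then have "K \<in> addT" unfolding addT_iff using hom_0 by blast
  then show thesis by (intro that[OF t _ ip(1,2,4) surj]) auto
qed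

text \<open>A morphism killed by \<open>F\<close> vanishes on the approximation \<open>S \<rightarrow> Z\<close>, hence factors through its cone,
  which lies in \<open>add(susp T)\<close>.  Together with \<open>factors_F_null\<close>, this describes the defining triangles
  of \<open>K0_rel\<close> by the condition \<open>F h = 0\<close>.\<close>

lemma F_null_factors:
  assumes h: "h \<in> homs C Z Y" "F_null Z h"
  shows "\<exists>W\<in>addST. \<exists>a\<in>homs C Z W. \<exists>b\<in>homs C W Y. h = b \<cdot> a"
proof -
  obtain K S n i p \<kappa> \<pi> c where a: "tri C K S Z \<kappa> \<pi> c" "K \<in> addT"
    "\<And>a. a < (n::nat) \<Longrightarrow> i a \<in> homs C T S" "\<And>a. a < n \<Longrightarrow> p a \<in> homs C S T"
    "(\<Sum>a<n. i a \<cdot> p a) = ident C S"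
    by (rule ex_approximation[of Z]) blast
  note th = tri_hom[OF a(1)]
  have "(h \<cdot> \<pi>) \<cdot> i b = 0" if "b < n" for b
    using cmp_assoc[OF a(3)[OF that] th(2) h(1)] cmp_closed[OF a(3)[OF that] th(2)] h(2)
    by (simp add: F_null_def)
  then have "h \<cdot> \<pi> = 0"
    using sum_component_eq[OF a(3,4,5) cmp_closed[OF th(2) h(1)]] cmp_0_left[OF a(4)]
    by (simp add: sum.neutral)
  then obtain b where "b \<in> homs C (susp C K) Y" "h = b \<cdot> c"
    using weak_cokernel_rotated[OF a(1) h(1)] by blast
  then show ?thesis using addT_susp[OF a(2)] th(3) by blast
qed

lemma factors_F_null:
  assumes "W \<in> addST" "a \<in> homs C Z W" "b \<in> homs C W Y" "h = b \<cdot> a"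
  shows "F_null Z h"
  unfolding F_null_def
proof
  fix t assume t: "t \<in> homs C T Z"
  have "a \<cdot> t = 0" using cmp_closed[OF t assms(2)] assms(1) unfolding addST_iff by blast
  then show "h \<cdot> t = 0" using assms(4) cmp_assoc[OF t assms(2,3)] cmp_0_right[OF assms(3)] by simp
qed

section \<open>Homomorphisms of modules over the endomorphism algebra\<close>

abbreviation LH :: "'o \<Rightarrow> 'o \<Rightarrow> ('m \<Rightarrow> 'm) set" where
  "LH X B \<equiv> Lambda_homs C T X B"

sublocale fs: subspace_theory "\<lambda>c (\<psi> :: 'm \<Rightarrow> 'm) x. scl C c (\<psi> x)"
  by unfold_locales (simp_all add: fun_eq_iff vs.scale_right_distrib vs.scale_left_distrib)

sublocale lfs: subspace_theory_pair "scl C" "\<lambda>c (\<psi> :: 'm \<Rightarrow> 'm) x. scl C c (\<psi> x)" ..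

sublocale ffs: subspace_theory_pair "\<lambda>c (\<psi> :: 'm \<Rightarrow> 'm) x. scl C c (\<psi> x)" "\<lambda>c (\<psi> :: 'm \<Rightarrow> 'm) x. scl C c (\<psi> x)" ..

lemma LH_out: "\<psi> \<in> LH X B \<Longrightarrow> x \<notin> homs C T X \<Longrightarrow> \<psi> x = 0"
  by (simp add: Lambda_homs_def)

lemma LH_hom: "\<psi> \<in> LH X B \<Longrightarrow> x \<in> homs C T X \<Longrightarrow> \<psi> x \<in> homs C T B"
  by (simp add: Lambda_homs_def)

lemma LH_add: "\<psi> \<in> LH X B \<Longrightarrow> x \<in> homs C T X \<Longrightarrow> y \<in> homs C T X \<Longrightarrow> \<psi> (x + y) = \<psi> x + \<psi> y"
  by (simp add: Lambda_homs_def)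

lemma LH_act: "\<psi> \<in> LH X B \<Longrightarrow> x \<in> homs C T X \<Longrightarrow> a \<in> homs C T T \<Longrightarrow> \<psi> (x \<cdot> a) = \<psi> x \<cdot> a"
  by (simp add: Lambda_homs_def)

lemma LHI:
  assumes "\<And>x. x \<notin> homs C T X \<Longrightarrow> \<psi> x = 0" "\<And>x. x \<in> homs C T X \<Longrightarrow> \<psi> x \<in> homs C T B"
    "\<And>x y. x \<in> homs C T X \<Longrightarrow> y \<in> homs C T X \<Longrightarrow> \<psi> (x + y) = \<psi> x + \<psi> y"
    "\<And>x a. x \<in> homs C T X \<Longrightarrow> a \<in> homs C T T \<Longrightarrow> \<psi> (x \<cdot> a) = \<psi> x \<cdot> a"
  shows "\<psi> \<in> LH X B"
  using assms by (simp add: Lambda_homs_def)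

lemma LH_0: "\<psi> \<in> LH X B \<Longrightarrow> \<psi> 0 = 0"
  using LH_add[of \<psi> X B 0 0] hom_0 by simp

lemma LH_sum:
  assumes \<psi>: "\<psi> \<in> LH X B"
  shows "(\<And>a. a \<in> A \<Longrightarrow> x a \<in> homs C T X) \<Longrightarrow> \<psi> (\<Sum>a\<in>A. x a) = (\<Sum>a\<in>A. \<psi> (x a))"
proof (induction A rule: infinite_finite_induct)
  case (insert a A)
  then have "(\<Sum>a\<in>A. x a) \<in> homs C T X" by (intro hom_sum) auto
  then show ?case using insert LH_add[OF \<psi>, of "x a"] by simp
qed (use LH_0[OF \<psi>] in auto)

lemma LH_eqI:
  assumes "\<psi> \<in> LH X B" "\<psi>' \<in> LH X B" "\<And>x. x \<in> homs C T X \<Longrightarrow> \<psi> x = \<psi>' x"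
  shows "\<psi> = \<psi>'"
  using assms LH_out by (metis ext)

lemma LH_subspace: "fs.subspace (LH X B)"
proof (rule fs.subspaceI)
  show "0 \<in> LH X B" by (rule LHI) (use hom_0 cmp_0_left in auto)
next
  fix \<psi> \<psi>' assume p: "\<psi> \<in> LH X B" "\<psi>' \<in> LH X B"
  show "\<psi> + \<psi>' \<in> LH X B"
    by (rule LHI)
      (simp_all add: LH_out[OF p(1)] LH_out[OF p(2)] LH_hom[OF p(1)] LH_hom[OF p(2)] hom_add
        LH_add[OF p(1)] LH_add[OF p(2)] LH_act[OF p(1)] LH_act[OF p(2)]
        cmp_add_left[OF _ LH_hom[OF p(1)] LH_hom[OF p(2)]] add_ac(1,2) add.left_commute
        cmp_add_left[OF _ LH_hom[OF p(2)] LH_hom[OF p(1)]])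
next
  fix c \<psi> assume p: "\<psi> \<in> LH X B"
  show "(\<lambda>x. scl C c (\<psi> x)) \<in> LH X B"
    by (rule LHI)
      (simp_all add: LH_out[OF p] LH_hom[OF p] hom_scl LH_add[OF p] LH_act[OF p]
        cmp_scl_left[OF _ LH_hom[OF p]] vs.scale_right_distrib)
qed

text \<open>\<open>induced X u\<close> is \<open>F u\<close> for a morphism \<open>u\<close> with source \<open>X\<close>, and \<open>pullback X f\<close> is
  composition with \<open>F f\<close> for a morphism \<open>f\<close> with source \<open>X\<close>.\<close>

definition induced :: "'o \<Rightarrow> 'm \<Rightarrow> 'm \<Rightarrow> 'm" where
  "induced X u = (\<lambda>x. if x \<in> homs C T X then u \<cdot> x else 0)"

definition pullback :: "'o \<Rightarrow> 'm \<Rightarrow> ('m \<Rightarrow> 'm) \<Rightarrow> 'm \<Rightarrow> 'm" where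
  "pullback X f \<psi> = (\<lambda>x. if x \<in> homs C T X then \<psi> (f \<cdot> x) else 0)"

lemma hom_T_comp: "x \<in> homs C T X \<Longrightarrow> a \<in> homs C T T \<Longrightarrow> x \<cdot> a \<in> homs C T X"
  by (rule cmp_closed)

lemma induced_LH:
  assumes u: "u \<in> homs C X B"
  shows "induced X u \<in> LH X B"
  by (rule LHI)
    (use u cmp_closed[OF _ u] cmp_add_right[OF _ _ u] cmp_assoc[OF _ _ u] hom_add hom_T_comp in
      \<open>auto simp: induced_def\<close>)

lemma induced_linear: "linear_within (scl C) (\<lambda>c \<psi> x. scl C c (\<psi> x)) (homs C X B) (induced X)"
  unfolding linear_within_def induced_def
  using cmp_add_left cmp_scl_left by (auto simp: fun_eq_iff)

lemma pullback_LH: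
  assumes f: "f \<in> homs C X Y" and \<psi>: "\<psi> \<in> LH Y B"
  shows "pullback X f \<psi> \<in> LH X B"
proof (rule LHI)
  fix x a assume x: "x \<in> homs C T X" and a: "a \<in> homs C T T"
  show "pullback X f \<psi> (x \<cdot> a) = pullback X f \<psi> x \<cdot> a"
    using x a hom_T_comp[OF x a] cmp_assoc[OF a x f] LH_act[OF \<psi> cmp_closed[OF x f] a]
    by (simp add: pullback_def)
qed (use LH_hom[OF \<psi>] cmp_closed[OF _ f] cmp_add_right[OF _ _ f] LH_add[OF \<psi>] hom_add in
      \<open>auto simp: pullback_def\<close>)

lemma pullback_linear:
  "linear_within (\<lambda>c \<psi> x. scl C c (\<psi> x)) (\<lambda>c \<psi> x. scl C c (\<psi> x)) V (pullback X f)"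
  unfolding linear_within_def pullback_def by (auto simp: fun_eq_iff)

text \<open>Fullness of \<open>F\<close>: on a power of \<open>T\<close> it is the Yoneda lemma, and the approximation triangle
  \<open>K \<rightarrow> S \<rightarrow> X\<close> reduces \<open>X\<close> to this case.\<close>

lemma induced_surj:
  assumes \<psi>: "\<psi> \<in> LH X B"
  shows "\<exists>u\<in>homs C X B. \<psi> = induced X u"
proof -
  obtain K S n i p \<kappa> \<pi> c where a: "tri C K S X \<kappa> \<pi> c" "K \<in> addT"
    "\<And>a. a < (n::nat) \<Longrightarrow> i a \<in> homs C T S" "\<And>a. a < n \<Longrightarrow> p a \<in> homs C S T"
    "(\<Sum>a<n. i a \<cdot> p a) = ident C S"
    "\<And>x. x \<in> homs C T X \<Longrightarrow> \<exists>s\<in>homs C T S. x = \<pi> \<cdot> s"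
    by (rule ex_approximation[of X]) blast
  note th = tri_hom[OF a(1)]
  have \<pi>i: "\<pi> \<cdot> i b \<in> homs C T X" if "b < n" for b by (rule cmp_closed[OF a(3)[OF that] th(2)])
  define u where "u = (\<Sum>b<n. \<psi> (\<pi> \<cdot> i b) \<cdot> p b)"
  have up: "\<psi> (\<pi> \<cdot> i b) \<cdot> p b \<in> homs C S B" if "b < n" for b
    by (rule cmp_closed[OF a(4)[OF that] LH_hom[OF \<psi> \<pi>i[OF that]]])
  have u: "u \<in> homs C S B" unfolding u_def using up by (intro hom_sum) auto
  have us: "u \<cdot> s = \<psi> (\<pi> \<cdot> s)" if s: "s \<in> homs C T S" for s
  proof -
    have ps: "p b \<cdot> s \<in> homs C T T" if "b < n" for b by (rule cmp_closed[OF s a(4)[OF that]])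
    have "u \<cdot> s = (\<Sum>b<n. (\<psi> (\<pi> \<cdot> i b) \<cdot> p b) \<cdot> s)"
      unfolding u_def by (rule cmp_sum_left[OF s]) (use up in auto)
    also have "\<dots> = (\<Sum>b<n. \<psi> ((\<pi> \<cdot> i b) \<cdot> (p b \<cdot> s)))"
      using cmp_assoc[OF s a(4) LH_hom[OF \<psi> \<pi>i]] LH_act[OF \<psi> \<pi>i ps] by (intro sum.cong) auto
    also have "\<dots> = \<psi> (\<Sum>b<n. (\<pi> \<cdot> i b) \<cdot> (p b \<cdot> s))"
      by (rule LH_sum[OF \<psi>, symmetric]) (use cmp_closed[OF ps \<pi>i] in auto)
    also have "(\<Sum>b<n. (\<pi> \<cdot> i b) \<cdot> (p b \<cdot> s)) = (\<Sum>b<n. \<pi> \<cdot> (i b \<cdot> (p b \<cdot> s)))"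
      using cmp_assoc[OF ps a(3) th(2)] by (intro sum.cong) auto
    also have "\<dots> = \<pi> \<cdot> (\<Sum>b<n. i b \<cdot> (p b \<cdot> s))"
      by (rule cmp_sum_right[OF th(2), symmetric]) (use cmp_closed[OF ps a(3)] in auto)
    also have "(\<Sum>b<n. i b \<cdot> (p b \<cdot> s)) = s" using sum_component_eq'[OF a(3,4,5) s] by simp
    finally show ?thesis .
  qed
  have "F_null K (u \<cdot> \<kappa>)"
    unfolding F_null_def
  proof
    fix t assume t: "t \<in> homs C T K"
    have "(u \<cdot> \<kappa>) \<cdot> t = \<psi> (\<pi> \<cdot> (\<kappa> \<cdot> t))" using cmp_assoc[OF t th(1) u] us[OF cmp_closed[OF t th(1)]] by simp
    also have "\<pi> \<cdot> (\<kappa> \<cdot> t) = 0" using cmp_assoc[OF t th(1,2)] tri_cmp1[OF a(1)] cmp_0_left[OF t] by simp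
    finally show "(u \<cdot> \<kappa>) \<cdot> t = 0" using LH_0[OF \<psi>] by simp
  qed
  then have "u \<cdot> \<kappa> = 0" using addT_faithful[OF a(2) cmp_closed[OF th(1) u]] by blast
  then obtain v where v: "v \<in> homs C X B" "u = v \<cdot> \<pi>" using weak_cokernel[OF a(1) u] by blast
  have "\<psi> = induced X v"
  proof (rule LH_eqI[OF \<psi> induced_LH[OF v(1)]])
    fix x assume x: "x \<in> homs C T X"
    then obtain s where s: "s \<in> homs C T S" "x = \<pi> \<cdot> s" using a(6) by blast
    show "\<psi> x = induced X v x"
      using us[OF s(1)] v(2) cmp_assoc[OF s(1) th(2) v(1)] s(2) x by (simp add: induced_def)
  qed
  then show ?thesis using v(1) by blast
qed

lemma LH_fin_subspace: "fs.fin_subspace (LH X B)"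
proof -
  have "induced X ` homs C X B = LH X B"
  proof
    show "induced X ` homs C X B \<subseteq> LH X B" using induced_LH by blast
    show "LH X B \<subseteq> induced X ` homs C X B" using induced_surj by blast
  qed
  then show ?thesis using lfs.fin_subspace_image[OF hom_fin_subspace induced_linear, of X B] by simp
qed

text \<open>The target \<open>B\<close> is the first argument, so that \<open>hdim B\<close> is the function on objects that \<open>pairing\<close>
  extends linearly.\<close>

definition hdim :: "'o \<Rightarrow> 'o \<Rightarrow> int" where
  "hdim B X = int (dim_Lambda_homs C T X B)"

lemma hdim_eq: "hdim B X = int (fs.dim (LH X B))"
  by (simp add: hdim_def dim_Lambda_homs_def)

lemma hdim_direct_sum:
  assumes S: "direct_sum C S Xs"
  shows "hdim B S = (\<Sum>X\<leftarrow>Xs. hdim B X)"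
proof -
  obtain i p where h: "\<And>a. a<length Xs \<Longrightarrow> i a \<in> homs C (Xs ! a) S" "\<And>a. a<length Xs \<Longrightarrow> p a \<in> homs C S (Xs ! a)"
     "\<And>a b. a<length Xs \<Longrightarrow> b<length Xs \<Longrightarrow> p a \<cdot> i b = (if a = b then ident C (Xs ! a) else 0)"
     "(\<Sum>a<length Xs. i a \<cdot> p a) = ident C S"
    using S unfolding direct_sum_def by blast
  have key: "pullback (Xs ! a) (i a) (pullback S (p b) \<psi>) = (if a = b then \<psi> else 0)"
    if a: "a < length Xs" and b: "b < length Xs" and \<psi>: "\<psi> \<in> LH (Xs ! b) B" for a b \<psi>
  proof
    fix x
    show "pullback (Xs ! a) (i a) (pullback S (p b) \<psi>) x = (if a = b then \<psi> else 0) x"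
    proof (cases "x \<in> homs C T (Xs ! a)")
      case True
      then have "pullback (Xs ! a) (i a) (pullback S (p b) \<psi>) x = \<psi> (p b \<cdot> (i a \<cdot> x))"
        using cmp_closed[OF True h(1)[OF a]] by (simp add: pullback_def)
      also have "p b \<cdot> (i a \<cdot> x) = (if a = b then x else 0)"
        using cmp_assoc[OF True h(1)[OF a] h(2)[OF b]] h(3)[OF b a] ident_left[OF True] cmp_0_left[OF True]
        by (auto split: if_splits)
      finally show ?thesis using LH_0[OF \<psi>] by simp
    next
      case False
      then show ?thesis using LH_out[OF \<psi>] by (auto simp: pullback_def)
    qed
  qed
  have "fs.dim (LH S B) = (\<Sum>a<length Xs. fs.dim (LH (Xs ! a) B))"
  proof (rule fs.dim_direct_sum[where p = "\<lambda>a. pullback (Xs ! a) (i a)" and i = "\<lambda>a. pullback S (p a)"])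
    show "pullback (Xs ! a) (i a) (pullback S (p a) \<psi>) = \<psi>"
      if "a < length Xs" "\<psi> \<in> LH (Xs ! a) B" for a \<psi> using key[OF that(1) that] by simp
    show "pullback (Xs ! a) (i a) (pullback S (p b) \<psi>) = 0"
      if "a < length Xs" "b < length Xs" "a \<noteq> b" "\<psi> \<in> LH (Xs ! b) B" for a b \<psi>
      using key[OF that(1,2,4)] that(3) by simp
    show "\<psi> = 0" if \<psi>: "\<psi> \<in> LH S B" and 0: "\<And>a. a < length Xs \<Longrightarrow> pullback (Xs ! a) (i a) \<psi> = 0" for \<psi>
    proof
      fix x
      show "\<psi> x = 0 x"
      proof (cases "x \<in> homs C T S")
        case True
        have px: "p a \<cdot> x \<in> homs C T (Xs ! a)" if "a < length Xs" for a by (rule cmp_closed[OF True h(2)[OF that]])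
        have "\<psi> x = \<psi> (\<Sum>a<length Xs. i a \<cdot> (p a \<cdot> x))" using sum_component_eq'[OF h(1,2,4) True] by simp
        also have "\<dots> = (\<Sum>a<length Xs. \<psi> (i a \<cdot> (p a \<cdot> x)))"
          by (rule LH_sum[OF \<psi>]) (use cmp_closed[OF px h(1)] in auto)
        also have "\<dots> = 0"
        proof (rule sum.neutral, rule ballI)
          fix a assume "a \<in> {..<length Xs}"
          then have a: "a < length Xs" by simp
          have "pullback (Xs ! a) (i a) \<psi> (p a \<cdot> x) = 0" using 0[OF a] by simp
          then show "\<psi> (i a \<cdot> (p a \<cdot> x)) = 0" using px[OF a] by (simp add: pullback_def)
        qed
        finally show ?thesis by simp
      next
        case False
        then show ?thesis using LH_out[OF \<psi>] by simp
      qed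
    qed
  qed (use LH_fin_subspace LH_subspace pullback_LH[OF h(1)] pullback_LH[OF h(2)] pullback_linear in auto)
  moreover have "int (\<Sum>X\<leftarrow>Xs. f X) = (\<Sum>X\<leftarrow>Xs. int (f X))" for f :: "'o \<Rightarrow> nat"
    by (induction Xs) auto
  ultimately show ?thesis by (simp add: hdim_eq sum_list_sum_nth atLeast0LessThan)
qed

lemma pairing_hdim_cls: "pairing (hdim B) (cls C I X) = hdim B X"
  by (rule pairing_cls) (rule hdim_direct_sum)

lemma K0_form_eq_pairing: "K0_form C T x (frag_of B) = pairing (hdim B) x"
  by (simp add: K0_form_def pairing_def hdim_def)

definition defect :: "'o \<Rightarrow> 'o \<Rightarrow> 'o \<Rightarrow> 'o \<Rightarrow>\<^sub>0 int" where
  "defect X Y Z = cls C I X + cls C I Z - cls C I Y"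

text \<open>If \<open>F h = 0\<close>, then \<open>F X \<rightarrow> F Y \<rightarrow> F Z \<rightarrow> 0\<close> is exact, and \<open>Hom(-, F B)\<close> turns it into a left exact
  sequence.  Hence the defect of the triangle pairs with \<open>B\<close> to the dimension of the cokernel of
  the last map.\<close>

lemma pairing_defect:
  assumes t: "tri C X Y Z f g h" and h0: "F_null Z h"
  shows "pairing (hdim B) (defect X Y Z) = int (fs.dim (LH X B)) - int (fs.dim (pullback X f ` LH Y B))"
proof -
  note th = tri_hom[OF t]
  have surj: "\<exists>y\<in>homs C T Y. z = g \<cdot> y" if "z \<in> homs C T Z" for z
    using weak_kernel_rotated[OF t that] h0 that by (simp add: F_null_def)
  let ?N = "{\<psi>\<in>LH Y B. pullback X f \<psi> = 0}"
  have N: "?N = pullback Y g ` LH Z B"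
  proof (intro equalityI subsetI)
    fix \<psi> assume "\<psi> \<in> pullback Y g ` LH Z B"
    then obtain \<chi> where \<chi>: "\<chi> \<in> LH Z B" "\<psi> = pullback Y g \<chi>" by blast
    have "pullback X f \<psi> x = 0" for x
    proof (cases "x \<in> homs C T X")
      case True
      then show ?thesis
        using \<chi> cmp_closed[OF True th(1)] cmp_assoc[OF True th(1,2)] tri_cmp1[OF t] cmp_0_left[OF True]
          LH_0[OF \<chi>(1)] by (simp add: pullback_def)
    qed (simp add: pullback_def)
    then show "\<psi> \<in> ?N" using \<chi> pullback_LH[OF th(2)] by auto
  next
    fix \<psi> assume "\<psi> \<in> ?N"
    then have \<psi>: "\<psi> \<in> LH Y B" "\<And>x. pullback X f \<psi> x = 0" by (simp_all add: fun_eq_iff)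
    \<comment> \<open>\<open>\<psi>\<close> descends along the surjection \<open>F g\<close>, because it vanishes on the image of \<open>F f\<close>.\<close>
    define s where "s z = (SOME y. y \<in> homs C T Y \<and> z = g \<cdot> y)" for z
    have s: "s z \<in> homs C T Y" "z = g \<cdot> s z" if "z \<in> homs C T Z" for z
      using someI_ex[of "\<lambda>y. y \<in> homs C T Y \<and> z = g \<cdot> y"] surj[OF that] unfolding s_def by blast+
    define \<chi> where "\<chi> z = (if z \<in> homs C T Z then \<psi> (s z) else 0)" for z
    have \<chi>g: "\<chi> (g \<cdot> y) = \<psi> y" if y: "y \<in> homs C T Y" for y
    proof -
      have gy: "g \<cdot> y \<in> homs C T Z" by (rule cmp_closed[OF y th(2)])
      have "g \<cdot> (y - s (g \<cdot> y)) = 0"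
        using cmp_diff_right[OF y s(1)[OF gy] th(2)] s(2)[OF gy] by simp
      then obtain x where x: "x \<in> homs C T X" "y - s (g \<cdot> y) = f \<cdot> x"
        using weak_kernel[OF t hom_diff[OF y s(1)[OF gy]]] by blast
      have "\<psi> (f \<cdot> x) = 0" using \<psi>(2)[of x] x(1) by (simp add: pullback_def)
      moreover have "y = f \<cdot> x + s (g \<cdot> y)" using x(2) by (simp add: algebra_simps)
      ultimately show ?thesis
        using LH_add[OF \<psi>(1) cmp_closed[OF x(1) th(1)] s(1)[OF gy]] gy unfolding \<chi>_def by simp
    qed
    have "\<chi> \<in> LH Z B"
    proof (rule LHI)
      show "\<chi> z = 0" if "z \<notin> homs C T Z" for z using that by (simp add: \<chi>_def)
      show "\<chi> z \<in> homs C T B" if "z \<in> homs C T Z" for z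
        using LH_hom[OF \<psi>(1) s(1)[OF that]] that by (simp add: \<chi>_def)
      show "\<chi> (z + z') = \<chi> z + \<chi> z'" if z: "z \<in> homs C T Z" "z' \<in> homs C T Z" for z z'
        using \<chi>g[OF hom_add[OF s(1)[OF z(1)] s(1)[OF z(2)]]] cmp_add_right[OF s(1)[OF z(1)] s(1)[OF z(2)] th(2)]
          s(2)[OF z(1)] s(2)[OF z(2)] LH_add[OF \<psi>(1) s(1)[OF z(1)] s(1)[OF z(2)]] z
        by (simp add: \<chi>_def)
      show "\<chi> (z \<cdot> a) = \<chi> z \<cdot> a" if z: "z \<in> homs C T Z" and a: "a \<in> homs C T T" for z a
        using \<chi>g[OF hom_T_comp[OF s(1)[OF z] a]] cmp_assoc[OF a s(1)[OF z] th(2)] s(2)[OF z]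
          LH_act[OF \<psi>(1) s(1)[OF z] a] z by (simp add: \<chi>_def)
    qed
    moreover have "\<psi> = pullback Y g \<chi>"
      by (rule LH_eqI[OF \<psi>(1) pullback_LH[OF th(2) \<open>\<chi> \<in> LH Z B\<close>]])
        (use \<chi>g in \<open>simp add: pullback_def\<close>)
    ultimately show "\<psi> \<in> pullback Y g ` LH Z B" by blast
  qed
  have "{\<chi>\<in>LH Z B. pullback Y g \<chi> = 0} = {0}"
  proof (intro equalityI subsetI)
    fix \<chi> assume "\<chi> \<in> {\<chi>\<in>LH Z B. pullback Y g \<chi> = 0}"
    then have \<chi>: "\<chi> \<in> LH Z B" "\<And>y. pullback Y g \<chi> y = 0" by (simp_all add: fun_eq_iff)
    have "\<chi> = 0"
    proof (rule LH_eqI[OF \<chi>(1) fs.subspace_0[OF LH_subspace]])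
      fix z assume "z \<in> homs C T Z"
      then obtain y where y: "y \<in> homs C T Y" "z = g \<cdot> y" using surj by blast
      then show "\<chi> z = 0 z" using \<chi>(2)[of y] by (simp add: pullback_def)
    qed
    then show "\<chi> \<in> {0}" by simp
  next
    fix \<chi> :: "'m \<Rightarrow> 'm" assume "\<chi> \<in> {0}"
    then show "\<chi> \<in> {\<chi>\<in>LH Z B. pullback Y g \<chi> = 0}"
      using fs.subspace_0[OF LH_subspace] by (auto simp: pullback_def)
  qed
  then have "fs.dim (LH Z B) = fs.dim (pullback Y g ` LH Z B)"
    using ffs.rank_nullity_within(2)[OF LH_fin_subspace[of Z B] pullback_linear[of _ Y g]] fs.dim_zero_space by simp
  then have "fs.dim (LH Y B) = fs.dim (LH Z B) + fs.dim (pullback X f ` LH Y B)"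
    using ffs.rank_nullity_within(2)[OF LH_fin_subspace[of Y B] pullback_linear[of _ X f]] N by simp
  then show ?thesis
    by (simp add: defect_def pairing_add pairing_diff pairing_hdim_cls hdim_eq)
qed

lemma pullback_image_subspace:
  assumes f: "f \<in> homs C X Y"
  shows "fs.subspace (pullback X f ` LH Y B)" "pullback X f ` LH Y B \<subseteq> LH X B"
  using ffs.fin_subspace_image[OF LH_fin_subspace[of Y B] pullback_linear[of _ X f]] pullback_LH[OF f]
  by (auto simp: fs.fin_subspace_def)

lemma pairing_defect_nonneg:
  assumes t: "tri C X Y Z f g h" and h0: "F_null Z h"
  shows "pairing (hdim B) (defect X Y Z) \<ge> 0"
proof -
  note s = pullback_image_subspace[OF tri_hom1[OF t], of B]
  have "fs.dim (pullback X f ` LH Y B) \<le> fs.dim (LH X B)"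
  proof (cases "pullback X f ` LH Y B = LH X B")
    case False
    then show ?thesis using fs.fin_subspace_dim_less[OF LH_fin_subspace s] by simp
  qed simp
  then show ?thesis using pairing_defect[OF assms] by simp
qed

end


section \<open>Almost split triangles\<close>

context cluster_tilting_category
begin

text \<open>The duality as a pairing of \<open>Hom X (susp Y)\<close> with \<open>Hom Y (susp X)\<close>: it is nondegenerate, represents
  all functionals, and lets a morphism move from one argument to the other.\<close>

lemma cy_form:
  obtains \<phi> :: "'o \<Rightarrow> 'o \<Rightarrow> 'm \<Rightarrow> 'm \<Rightarrow> 'k" where
    "\<And>X Y g. g \<in> homs C Y (susp C X) \<Longrightarrow> \<phi> X Y 0 g = 0"
    "\<And>X Y f. f \<in> homs C X (susp C Y) \<Longrightarrow> f \<noteq> 0 \<Longrightarrow> \<exists>g\<in>homs C Y (susp C X). \<phi> X Y f g \<noteq> 0"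
    "\<And>X Y \<xi>. (\<forall>x y. \<xi> (x + y) = \<xi> x + \<xi> y) \<Longrightarrow> (\<forall>c x. \<xi> (scl C c x) = c * \<xi> x) \<Longrightarrow>
       \<exists>f\<in>homs C X (susp C Y). \<forall>g\<in>homs C Y (susp C X). \<phi> X Y f g = \<xi> g"
    "\<And>X Y Y' v f g. v \<in> homs C Y Y' \<Longrightarrow> f \<in> homs C X (susp C Y) \<Longrightarrow> g \<in> homs C Y' (susp C X) \<Longrightarrow>
       \<phi> X Y' (smap C v \<cdot> f) g = \<phi> X Y f (g \<cdot> v)"
    "\<And>X X' Y u f g. u \<in> homs C X' X \<Longrightarrow> f \<in> homs C X (susp C Y) \<Longrightarrow> g \<in> homs C Y (susp C X') \<Longrightarrow>
       \<phi> X' Y (f \<cdot> u) g = \<phi> X Y f (smap C u \<cdot> g)"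
proof -
  obtain \<phi> :: "'o \<Rightarrow> 'o \<Rightarrow> 'm \<Rightarrow> 'm \<Rightarrow> 'k" where
    bij: "\<And>X Y. bij_betw (\<phi> X Y) (homs C X (susp C Y)) (dual_space (scl C) (homs C Y (susp C X)))"
    and scl: "\<forall>X Y c. \<forall>f\<in>homs C X (susp C Y). \<forall>g\<in>homs C Y (susp C X). \<phi> X Y (scl C c f) g = c * \<phi> X Y f g"
    and nat: "\<forall>X X' Y Y'. \<forall>u\<in>homs C X' X. \<forall>v\<in>homs C Y Y'. \<forall>f\<in>homs C X (susp C Y). \<forall>g\<in>homs C Y' (susp C X').
        \<phi> X' Y' (smap C v \<cdot> f \<cdot> u) g = \<phi> X Y f (smap C u \<cdot> g \<cdot> v)"
    using cy unfolding two_calabi_yau_def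
    by (elim exE conjE) (rule that; (assumption | (erule allE, erule allE, assumption)))
  have 0: "\<phi> X Y 0 g = 0" if "g \<in> homs C Y (susp C X)" for X Y g
    using scl[rule_format, OF hom_0 that, of 0] by simp
  have 1: "\<exists>g\<in>homs C Y (susp C X). \<phi> X Y f g \<noteq> 0"
    if f: "f \<in> homs C X (susp C Y)" "f \<noteq> 0" for X Y f
  proof (rule ccontr)
    assume a: "\<not> (\<exists>g\<in>homs C Y (susp C X). \<phi> X Y f g \<noteq> 0)"
    have "\<phi> X Y f \<in> extensional (homs C Y (susp C X))" "\<phi> X Y 0 \<in> extensional (homs C Y (susp C X))"
      using bij_betwE[OF bij[of X Y]] f(1) hom_0 unfolding dual_space_def by blast+
    then have "\<phi> X Y f = \<phi> X Y 0"
      by (rule extensionalityI) (use a 0 in auto)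
    then show False using bij[of X Y] f hom_0 unfolding bij_betw_def by (metis inj_onD)
  qed
  have 2: "\<exists>f\<in>homs C X (susp C Y). \<forall>g\<in>homs C Y (susp C X). \<phi> X Y f g = \<xi> g"
    if \<xi>: "\<forall>x y. \<xi> (x + y) = \<xi> x + \<xi> y" "\<forall>c x. \<xi> (scl C c x) = c * \<xi> x" for X Y \<xi>
  proof -
    let ?r = "restrict \<xi> (homs C Y (susp C X))"
    have "?r \<in> dual_space (scl C) (homs C Y (susp C X))"
      using \<xi> hom_add hom_scl by (auto simp: dual_space_def)
    then obtain f where f: "f \<in> homs C X (susp C Y)" "\<phi> X Y f = ?r"
      using bij[of X Y] unfolding bij_betw_def by (metis imageE)
    then show ?thesis by (intro bexI[of _ f]) auto
  qed
  have 3: "\<phi> X Y' (smap C v \<cdot> f) g = \<phi> X Y f (g \<cdot> v)"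
    if h: "v \<in> homs C Y Y'" "f \<in> homs C X (susp C Y)" "g \<in> homs C Y' (susp C X)" for X Y Y' v f g
    using nat[rule_format, OF ident_closed h] ident_right[OF h(2)] smap_ident
      ident_left[OF cmp_closed[OF h(1,3)]] by simp
  have 4: "\<phi> X' Y (f \<cdot> u) g = \<phi> X Y f (smap C u \<cdot> g)"
    if h: "u \<in> homs C X' X" "f \<in> homs C X (susp C Y)" "g \<in> homs C Y (susp C X')" for X X' Y u f g
    using nat[rule_format, OF h(1) ident_closed h(2,3)] ident_right[OF h(3)] smap_ident
      ident_left[OF cmp_closed[OF h(1,2)]] by simp
  show thesis by (rule that[of \<phi>, OF 0 1 2 3 4])
qed

text \<open>\<open>almost_vanishing X h\<close> is the property of the third morphism of an almost split triangle that
  starts in \<open>X\<close>.\<close>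

definition almost_vanishing :: "'o \<Rightarrow> 'm \<Rightarrow> bool" where
  "almost_vanishing X h \<longleftrightarrow> (\<forall>X'. \<forall>u\<in>homs C X X'. \<not> section_mor C X X' u \<longrightarrow> smap C u \<cdot> h = 0)"

text \<open>Under the Calabi-Yau duality such a morphism is a functional on \<open>Hom A (susp Z)\<close>, which is a copy of
  \<open>End A\<close>, that is nonzero but vanishes on the radical.\<close>

lemma ex_almost_vanishing:
  assumes A: "local_end C A" and Z: "isomorphic C A (susp C Z)"
  shows "\<exists>h\<in>homs C Z (susp C A). h \<noteq> 0 \<and> almost_vanishing A h"
proof -
  obtain \<phi> :: "'o \<Rightarrow> 'o \<Rightarrow> 'm \<Rightarrow> 'm \<Rightarrow> 'k" where
    0: "\<And>X Y g. g \<in> homs C Y (susp C X) \<Longrightarrow> \<phi> X Y 0 g = 0"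
    and nd: "\<And>X Y f. f \<in> homs C X (susp C Y) \<Longrightarrow> f \<noteq> 0 \<Longrightarrow> \<exists>g\<in>homs C Y (susp C X). \<phi> X Y f g \<noteq> 0"
    and rep: "\<And>X Y \<xi>. (\<forall>x y. \<xi> (x + y) = \<xi> x + \<xi> y) \<Longrightarrow> (\<forall>c x. \<xi> (scl C c x) = c * \<xi> x) \<Longrightarrow>
       \<exists>f\<in>homs C X (susp C Y). \<forall>g\<in>homs C Y (susp C X). \<phi> X Y f g = \<xi> g"
    and nat: "\<And>X Y Y' v f g. v \<in> homs C Y Y' \<Longrightarrow> f \<in> homs C X (susp C Y) \<Longrightarrow> g \<in> homs C Y' (susp C X) \<Longrightarrow>
       \<phi> X Y' (smap C v \<cdot> f) g = \<phi> X Y f (g \<cdot> v)"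
    by (rule cy_form) blast
  obtain \<theta> where \<theta>: "isomorphism C A (susp C Z) \<theta>" using Z by (auto simp: isomorphic_def)
  then have \<theta>h: "\<theta> \<in> homs C A (susp C Z)" by (simp add: isomorphism_def)
  have "\<theta> \<notin> rad A (susp C Z)" using \<theta> by (auto simp: rad_def isomorphism_def section_mor_def)
  then obtain \<xi> where \<xi>: "\<forall>x y. \<xi> (x + y) = \<xi> x + \<xi> y" "\<forall>c x. \<xi> (scl C c x) = c * \<xi> x"
    "\<forall>x\<in>rad A (susp C Z). \<xi> x = 0" "\<xi> \<theta> = 1"
    using ft.ex_functional_separating[OF rad_subspace[OF A]] by blast
  obtain h where h: "h \<in> homs C Z (susp C A)" "\<forall>g\<in>homs C A (susp C Z). \<phi> Z A h g = \<xi> g"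
    using rep[OF \<xi>(1,2)] by blast
  have "h \<noteq> 0" using h(2) \<xi>(4) 0[OF \<theta>h] \<theta>h by auto
  moreover have "smap C u \<cdot> h = 0" if u: "u \<in> homs C A X'" "\<not> section_mor C A X' u" for u X'
  proof (rule ccontr)
    assume "smap C u \<cdot> h \<noteq> 0"
    then obtain g where g: "g \<in> homs C X' (susp C Z)" "\<phi> Z X' (smap C u \<cdot> h) g \<noteq> 0"
      using nd[OF cmp_closed[OF h(1) smap_hom[OF u(1)]]] by blast
    have "u \<in> rad A X'" using u by (simp add: rad_def)
    then have "g \<cdot> u \<in> rad A (susp C Z)" using rad_comp g(1) by blast
    then have "\<phi> Z A h (g \<cdot> u) = 0" using h(2) \<xi>(3) cmp_closed[OF u(1) g(1)] by simp
    then show False using g(2) nat[OF u(1) h(1) g(1)] by simp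
  qed
  ultimately show ?thesis using h(1) unfolding almost_vanishing_def by blast
qed

lemma susp_inv_isomorphic: "isomorphic C (susp C (susp_inv C X)) X"
  unfolding susp_inv_def by (rule someI_ex) (rule susp_essentially_surjective)

lemma susp_inv_local_end: "local_end C X \<Longrightarrow> local_end C (susp_inv C X)"
  using local_end_susp local_end_isomorphic[OF _ isomorphic_sym[OF susp_inv_isomorphic]] by blast

lemma ex_almost_split:
  assumes A: "indecomposable C A"
  shows "\<exists>E f g h. almost_split C A E (susp_inv C A) f g h"
proof -
  let ?Z = "susp_inv C A"
  have l: "local_end C A" using A indecomposable_local_end by blast
  obtain h where h: "h \<in> homs C ?Z (susp C A)" "h \<noteq> 0" "almost_vanishing A h"
    using ex_almost_vanishing[OF l isomorphic_sym[OF susp_inv_isomorphic]] by blast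
  obtain E f g where t: "tri C A E ?Z f g h" using ex_tri_third[OF h(1)] by blast
  have "\<exists>u'\<in>homs C E X'. u = u' \<cdot> f" if "u \<in> homs C A X'" "\<not> section_mor C A X' u" for X' u
    using weak_cokernel_susp[OF t that(1)] h(3) that unfolding almost_vanishing_def by blast
  then show ?thesis
    unfolding almost_split_def using t h(2) A local_end_indecomposable[OF susp_inv_local_end[OF l]] by blast
qed

lemma almost_split_nonsection:
  assumes "almost_split C X Y Z f g h"
  shows "\<not> section_mor C X Y f"
proof
  assume "section_mor C X Y f"
  then obtain r where r: "r \<in> homs C Y X" "r \<cdot> f = ident C X" by (auto simp: section_mor_def)
  have t: "tri C X Y Z f g h" and h0: "h \<noteq> 0" using assms by (auto simp: almost_split_def)
  note th = tri_hom[OF t]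
  have "h = smap C (r \<cdot> f) \<cdot> h" using r(2) smap_ident ident_left[OF th(3)] by simp
  also have "\<dots> = smap C r \<cdot> (smap C f \<cdot> h)"
    using smap_cmp[OF th(1) r(1)] cmp_assoc[OF th(3) smap_hom[OF th(1)] smap_hom[OF r(1)]] by simp
  also have "\<dots> = 0" using tri_cmp3[OF t] cmp_0_right[OF smap_hom[OF r(1)]] by simp
  finally show False using h0 by simp
qed

lemma almost_split_almost_vanishing:
  assumes "almost_split C X Y Z f g h"
  shows "almost_vanishing X h"
  unfolding almost_vanishing_def
proof (intro allI ballI impI)
  have t: "tri C X Y Z f g h" using assms by (auto simp: almost_split_def)
  note th = tri_hom[OF t]
  fix X' u assume "u \<in> homs C X X'" "\<not> section_mor C X X' u"
  then obtain u' where u': "u' \<in> homs C Y X'" "u = u' \<cdot> f" using assms unfolding almost_split_def by blast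
  show "smap C u \<cdot> h = 0"
    using u'(2) smap_cmp[OF th(1) u'(1)] cmp_assoc[OF th(3) smap_hom[OF th(1)] smap_hom[OF u'(1)]]
      tri_cmp3[OF t] cmp_0_right[OF smap_hom[OF u'(1)]] by simp
qed

text \<open>The right almost split property follows from the left one by moving \<open>v\<close> to the other
  argument of the duality pairing.\<close>

lemma almost_split_retraction:
  assumes as: "almost_split C X Y Z f g h" and XZ: "isomorphic C (susp C Z) X"
    and v: "v \<in> homs C W Z" "h \<cdot> v \<noteq> 0"
  shows "\<exists>s\<in>homs C Z W. v \<cdot> s = ident C Z"
proof -
  obtain \<phi> :: "'o \<Rightarrow> 'o \<Rightarrow> 'm \<Rightarrow> 'm \<Rightarrow> 'k" where
    0: "\<And>X Y g. g \<in> homs C Y (susp C X) \<Longrightarrow> \<phi> X Y 0 g = 0"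
    and nd: "\<And>X Y f. f \<in> homs C X (susp C Y) \<Longrightarrow> f \<noteq> 0 \<Longrightarrow> \<exists>g\<in>homs C Y (susp C X). \<phi> X Y f g \<noteq> 0"
    and nat: "\<And>X Y Y' v f g. v \<in> homs C Y Y' \<Longrightarrow> f \<in> homs C X (susp C Y) \<Longrightarrow> g \<in> homs C Y' (susp C X) \<Longrightarrow>
       \<phi> X Y' (smap C v \<cdot> f) g = \<phi> X Y f (g \<cdot> v)"
    and nat': "\<And>X X' Y u f g. u \<in> homs C X' X \<Longrightarrow> f \<in> homs C X (susp C Y) \<Longrightarrow> g \<in> homs C Y (susp C X') \<Longrightarrow>
       \<phi> X' Y (f \<cdot> u) g = \<phi> X Y f (smap C u \<cdot> g)"
    by (rule cy_form) blast
  have h: "h \<in> homs C Z (susp C X)" using as tri_hom3 by (auto simp: almost_split_def)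
  have X: "indecomposable C X" using as by (auto simp: almost_split_def)
  then have lZ: "local_end C (susp C Z)"
    using local_end_isomorphic[OF indecomposable_local_end isomorphic_sym[OF XZ]] by blast
  obtain w where w: "w \<in> homs C X (susp C W)" "\<phi> W X (h \<cdot> v) w \<noteq> 0"
    using nd[OF cmp_closed[OF v(1) h] v(2)] by blast
  define s where "s = smap C v \<cdot> w"
  have s: "s \<in> homs C X (susp C Z)" unfolding s_def by (rule cmp_closed[OF w(1) smap_hom[OF v(1)]])
  have "\<phi> Z X h s \<noteq> 0" using w(2) nat'[OF v(1) h w(1)] by (simp add: s_def)
  then have "\<phi> Z (susp C Z) (smap C s \<cdot> h) (ident C (susp C Z)) \<noteq> 0"
    using nat[OF s h ident_closed] ident_left[OF s] by simp
  then have "smap C s \<cdot> h \<noteq> 0" using 0[OF ident_closed] by auto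
  then have "section_mor C X (susp C Z) s"
    using almost_split_almost_vanishing[OF as] s unfolding almost_vanishing_def by blast
  then have "isomorphism C X (susp C Z) s"
    by (rule section_into_local_iso[OF lZ indecomposable_ident_nonzero[OF X]])
  then obtain s' where s': "s' \<in> homs C (susp C Z) X" "s \<cdot> s' = ident C (susp C Z)"
    by (auto simp: isomorphism_def)
  obtain r where r: "r \<in> homs C Z W" "smap C r = w \<cdot> s'" using ex_smap cmp_closed[OF s'(1) w(1)] by blast
  have "smap C (v \<cdot> r) = smap C (ident C Z)"
    using smap_cmp[OF r(1) v(1)] r(2) cmp_assoc[OF s'(1) w(1) smap_hom[OF v(1)]] s'(2) smap_ident
    by (simp add: s_def)
  then have "v \<cdot> r = ident C Z" using smap_inj[OF cmp_closed[OF r(1) v(1)] ident_closed] by blast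
  then show ?thesis using r(1) by blast
qed

text \<open>The first morphism \<open>f\<close> of the almost split triangle is itself not a section, so the suspension of \<open>f\<close>
  kills \<open>q\<close>.\<close>

lemma almost_vanishing_factors:
  assumes as: "almost_split C X Y Z f g h" and XZ: "isomorphic C (susp C Z) X"
    and q: "q \<in> homs C W (susp C X)" "q \<noteq> 0" "almost_vanishing X q"
  shows "\<exists>v\<in>homs C W Z. \<exists>s\<in>homs C Z W. q = h \<cdot> v \<and> v \<cdot> s = ident C Z"
proof -
  have t: "tri C X Y Z f g h" using as by (auto simp: almost_split_def)
  have "smap C f \<cdot> q = 0"
    using q(3) almost_split_nonsection[OF as] tri_hom1[OF t] unfolding almost_vanishing_def by blast
  then obtain v where v: "v \<in> homs C W Z" "q = h \<cdot> v" using weak_kernel_susp[OF t q(1)] by blast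
  then show ?thesis using almost_split_retraction[OF as XZ v(1)] q(2) by blast
qed

text \<open>Writing \<open>Z\<close> as the sum of \<open>V\<close> and the cocone \<open>K\<close> of the retraction \<open>v\<close>, the cocone of \<open>h \<cdot> v\<close> is the sum
  of \<open>E\<close> and \<open>K\<close>.\<close>

lemma cls_of_retraction:
  assumes t: "tri C X E V f g h" and v: "v \<in> homs C Z V" and s: "s \<in> homs C V Z" "v \<cdot> s = ident C V"
    and t': "tri C X Z' Z f' g' (h \<cdot> v)"
  shows "cls C I Z' = cls C I E + cls C I Z - cls C I V"
proof -
  obtain K i c where k: "tri C K Z V i v c" using ex_tri_second[OF v] by blast
  note c = tri_hom3[OF k]
  have "c = (c \<cdot> v) \<cdot> s" using cmp_assoc[OF s(1) v c] s(2) ident_right[OF c] by simp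
  then have c0: "c = 0" using tri_cmp2[OF k] cmp_0_left[OF s(1)] by simp
  have "direct_sum C Z [K, V]" using direct_sum_of_tri k c0 by simp
  moreover have "direct_sum C Z' [K, E]"
    using octahedron_split[OF t k t'] c0 cmp_0_left[OF tri_hom2[OF t]] by simp
  ultimately show ?thesis using cls_direct_sum by simp
qed

text \<open>The third morphisms of two almost split triangles that start in \<open>A\<close> differ by a retraction of the
  common third object onto itself, so by \<open>cls_of_retraction\<close> the middle objects have the same class.\<close>

lemma ell_eq:
  assumes as: "almost_split C A E (susp_inv C A) f g h"
  shows "ell C I A = defect A E (susp_inv C A)"
  unfolding ell_def defect_def
proof (rule the_equality)
  show "\<exists>E' f g h. almost_split C A E' (susp_inv C A) f g h \<and>
    cls C I A + cls C I (susp_inv C A) - cls C I E = cls C I A + cls C I (susp_inv C A) - cls C I E'"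
    using as by blast
  fix l assume "\<exists>E f g h. almost_split C A E (susp_inv C A) f g h \<and>
    l = cls C I A + cls C I (susp_inv C A) - cls C I E"
  then obtain E' f' g' h' where as': "almost_split C A E' (susp_inv C A) f' g' h'"
    and l: "l = cls C I A + cls C I (susp_inv C A) - cls C I E'" by blast
  have t: "tri C A E (susp_inv C A) f g h" and t': "tri C A E' (susp_inv C A) f' g' h'" and h': "h' \<noteq> 0"
    using as as' by (auto simp: almost_split_def)
  obtain v s where v: "v \<in> homs C (susp_inv C A) (susp_inv C A)" "s \<in> homs C (susp_inv C A) (susp_inv C A)"
    "h' = h \<cdot> v" "v \<cdot> s = ident C (susp_inv C A)"
    using almost_vanishing_factors[OF as susp_inv_isomorphic tri_hom3[OF t'] h'
        almost_split_almost_vanishing[OF as']] by blast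
  have "cls C I E' = cls C I E"
    using cls_of_retraction[OF t v(1,2,4) t'[unfolded v(3)]] by simp
  then show "l = cls C I A + cls C I (susp_inv C A) - cls C I E" using l by simp
qed

text \<open>A morphism \<open>t\<close> from \<open>T\<close> with \<open>h \<cdot> t \<noteq> 0\<close> would be a retraction, making the desuspension of \<open>A\<close> a
  summand of \<open>T\<close>.\<close>

lemma almost_split_F_null:
  assumes as: "almost_split C A E (susp_inv C A) f g h" and A: "A \<notin> addST"
  shows "F_null (susp_inv C A) h"
  unfolding F_null_def
proof (rule ballI, rule ccontr)
  let ?Z = "susp_inv C A"
  fix t assume t: "t \<in> homs C T ?Z" "h \<cdot> t \<noteq> 0"
  then obtain s where s: "s \<in> homs C ?Z T" "t \<cdot> s = ident C ?Z"
    using almost_split_retraction[OF as susp_inv_isomorphic] by blast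
  have "section_mor C (susp C ?Z) (susp C T) (smap C s)"
    unfolding section_mor_def
    using smap_hom[OF s(1)] smap_hom[OF t(1)] smap_cmp[OF s(1) t(1)] s(2) smap_ident by metis
  moreover have "homs C T (susp C T) = {0}" using T_in_addT by (simp add: addT_iff)
  ultimately have "homs C T (susp C ?Z) = {0}" by (rule homs_zero_retract)
  then have "homs C T A = {0}" by (rule homs_zero_isomorphic[OF susp_inv_isomorphic])
  then show False using A by (simp add: addST_iff)
qed

lemma almost_split_of:
  assumes A: "A \<in> I - addST"
  obtains E f g h where "almost_split C A E (susp_inv C A) f g h" "tri C A E (susp_inv C A) f g h"
    "F_null (susp_inv C A) h" "ell C I A = defect A E (susp_inv C A)"
proof -
  obtain E f g h where as: "almost_split C A E (susp_inv C A) f g h"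
    using ex_almost_split rep_indecomposable A by blast
  then show thesis
    using that[OF as] almost_split_F_null[OF as] A ell_eq[OF as] by (simp add: almost_split_def)
qed

text \<open>Every module homomorphism \<open>F A \<rightarrow> F B\<close> lifts to a morphism \<open>A \<rightarrow> B\<close>.  If \<open>B\<close> is not isomorphic to \<open>A\<close>,
  this lift is not a section, hence factors through \<open>E\<close>, and the cokernel of \<open>pairing_defect\<close> vanishes.\<close>

lemma pairing_ell_other:
  assumes A: "A \<in> I - addST" and B: "B \<in> I" "B \<noteq> A"
  shows "pairing (hdim B) (ell C I A) = 0"
proof -
  obtain E f g h where as: "almost_split C A E (susp_inv C A) f g h"
    and t: "tri C A E (susp_inv C A) f g h" and n: "F_null (susp_inv C A) h"
    and l: "ell C I A = defect A E (susp_inv C A)"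
    using almost_split_of[OF A] .
  have "LH A B \<subseteq> pullback A f ` LH E B"
  proof
    fix \<psi> assume \<psi>: "\<psi> \<in> LH A B"
    then obtain u where u: "u \<in> homs C A B" "\<psi> = induced A u" using induced_surj by blast
    have "\<not> section_mor C A B u"
      using section_into_local_iso[OF rep_local_end[OF B(1)] local_end_ident_nonzero[OF rep_local_end]]
        rep_unique[of A B] A B unfolding isomorphic_def by blast
    then obtain u' where u': "u' \<in> homs C E B" "u = u' \<cdot> f" using as u(1) unfolding almost_split_def by blast
    have "\<psi> = pullback A f (induced E u')"
      using u(2) u'(2) cmp_assoc[OF _ tri_hom1[OF t] u'(1)] cmp_closed[OF _ tri_hom1[OF t]]
      by (auto simp: induced_def pullback_def fun_eq_iff)
    then show "\<psi> \<in> pullback A f ` LH E B" using induced_LH[OF u'(1)] by blast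
  qed
  then have "pullback A f ` LH E B = LH A B" using pullback_image_subspace(2)[OF tri_hom1[OF t]] by blast
  then show ?thesis using pairing_defect[OF t n, of B] l by simp
qed

text \<open>The identity of \<open>F A\<close> represents a nonzero element of the cokernel: a factorization through \<open>F f\<close> would
  give a radical endomorphism \<open>u \<cdot> f\<close> of \<open>A\<close> that acts as the identity on \<open>F A\<close>, although
  \<open>F A\<close> is nonzero.\<close>

lemma pairing_ell_self:
  assumes A: "A \<in> I - addST"
  shows "pairing (hdim A) (ell C I A) > 0"
proof -
  obtain E f g h where as: "almost_split C A E (susp_inv C A) f g h"
    and t: "tri C A E (susp_inv C A) f g h" and n: "F_null (susp_inv C A) h"
    and l: "ell C I A = defect A E (susp_inv C A)"
    using almost_split_of[OF A] .
  note th = tri_hom[OF t]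
  have lA: "local_end C A" using A rep_local_end by blast
  have "induced A (ident C A) \<notin> pullback A f ` LH E A"
  proof
    assume "induced A (ident C A) \<in> pullback A f ` LH E A"
    then obtain \<psi> where \<psi>: "\<psi> \<in> LH E A" "induced A (ident C A) = pullback A f \<psi>" by blast
    obtain u where u: "u \<in> homs C E A" "\<psi> = induced E u" using induced_surj[OF \<psi>(1)] by blast
    have uf: "u \<cdot> f \<in> homs C A A" by (rule cmp_closed[OF th(1) u(1)])
    have id: "x = (u \<cdot> f) \<cdot> x" if x: "x \<in> homs C T A" for x
    proof -
      have "induced A (ident C A) x = pullback A f \<psi> x" using \<psi>(2) by simp
      then show ?thesis
        using x u(2) cmp_closed[OF x th(1)] cmp_assoc[OF x th(1) u(1)] ident_left[OF x]
        by (simp add: induced_def pullback_def)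
    qed
    have "\<not> isomorphism C A A (u \<cdot> f)"
      using section_of_iso_comp[OF th(1) u(1)] almost_split_nonsection[OF as] by blast
    then have "isomorphism C A A (ident C A - u \<cdot> f)" by (rule local_end_one_minus[OF lA uf])
    then obtain k where k: "k \<in> homs C A A" "k \<cdot> (ident C A - u \<cdot> f) = ident C A"
      by (auto simp: isomorphism_def)
    have d: "ident C A - u \<cdot> f \<in> homs C A A" by (rule hom_diff[OF ident_closed uf])
    have "x = 0" if x: "x \<in> homs C T A" for x
    proof -
      have "(ident C A - u \<cdot> f) \<cdot> x = 0"
        using cmp_diff_left[OF x ident_closed uf] ident_left[OF x] id[OF x] by simp
      then show ?thesis using cmp_assoc[OF x d k(1)] k(2) ident_left[OF x] cmp_0_right[OF k(1)] by simp
    qed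
    then have "homs C T A = {0}" using hom_0 by blast
    then show False using A by (simp add: addST_iff)
  qed
  then have "pullback A f ` LH E A \<noteq> LH A A" using induced_LH[OF ident_closed] by blast
  then have "fs.dim (pullback A f ` LH E A) < fs.dim (LH A A)"
    using fs.fin_subspace_dim_less[OF LH_fin_subspace pullback_image_subspace[OF th(1)]] by blast
  then show ?thesis using pairing_defect[OF t n, of A] l by simp
qed

section \<open>The relations of the relative Grothendieck group\<close>

abbreviation "G \<equiv> K0_split I"

lemma defect_carrier: "defect X Y Z \<in> carrier G"
proof -
  have "Poly_Mapping.keys (defect X Y Z) \<subseteq> Poly_Mapping.keys (cls C I X + cls C I Z) \<union> Poly_Mapping.keys (cls C I Y)"
    unfolding defect_def by (rule keys_diff)
  also have "\<dots> \<subseteq> (Poly_Mapping.keys (cls C I X) \<union> Poly_Mapping.keys (cls C I Z)) \<union> Poly_Mapping.keys (cls C I Y)"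
    by (intro Un_mono keys_add order_refl)
  also have "\<dots> \<subseteq> I" using keys_cls by simp
  finally show ?thesis by simp
qed

lemma K0_relations_eq:
  "K0_relations C I Ts = {defect X Y Z | X Y Z. \<exists>f g h. tri C X Y Z f g h \<and> F_null Z h}"
proof (intro equalityI subsetI)
  fix r assume "r \<in> K0_relations C I Ts"
  then obtain X Y Z f g h W a b where r: "r = defect X Y Z" "tri C X Y Z f g h"
    "W \<in> addST" "a \<in> homs C Z W" "b \<in> homs C W (susp C X)" "h = b \<cdot> a"
    unfolding K0_relations_def defect_def by blast
  then have "F_null Z h" using factors_F_null by blast
  then show "r \<in> {defect X Y Z | X Y Z. \<exists>f g h. tri C X Y Z f g h \<and> F_null Z h}" using r by blast
next
  fix r assume "r \<in> {defect X Y Z | X Y Z. \<exists>f g h. tri C X Y Z f g h \<and> F_null Z h}"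
  then obtain X Y Z f g h where r: "r = defect X Y Z" "tri C X Y Z f g h" "F_null Z h" by blast
  then show "r \<in> K0_relations C I Ts"
    using F_null_factors[OF tri_hom3[OF r(2)] r(3)] unfolding K0_relations_def defect_def by blast
qed

lemma K0_relations_carrier: "K0_relations C I Ts \<subseteq> carrier G"
  unfolding K0_relations_eq using defect_carrier by blast

lemma generate_add: "x \<in> generate G S \<Longrightarrow> y \<in> generate G S \<Longrightarrow> x + y \<in> generate G S"
  using generate.eng[of x G S y] by simp

lemma kernel_eq: "kernel G (K0_rel C I Ts) (g_proj C I Ts) = K0_relation_subgroup C I Ts"
proof -
  let ?H = "K0_relation_subgroup C I Ts"
  interpret G: group G by simp
  have H: "subgroup ?H G"
    unfolding K0_relation_subgroup_def by (rule G.generate_is_subgroup[OF K0_relations_carrier])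
  have "kernel G (K0_rel C I Ts) (g_proj C I Ts) = {x \<in> carrier G. ?H #>\<^bsub>G\<^esub> x = ?H}"
    by (simp add: kernel_def K0_rel_def g_proj_def FactGroup_def)
  also have "\<dots> = ?H"
    using G.coset_join1[OF _ _ H] G.coset_join2[OF _ H] subgroup.subset[OF H] by blast
  finally show ?thesis .
qed

abbreviation "J \<equiv> I - addST"
abbreviation "L \<equiv> {ell C I A | A. A \<in> J}"

lemma ell_in_relations:
  assumes "A \<in> J"
  shows "ell C I A \<in> K0_relations C I Ts"
proof -
  obtain E f g h where "tri C A E (susp_inv C A) f g h" "F_null (susp_inv C A) h"
    "ell C I A = defect A E (susp_inv C A)"
    using almost_split_of[OF assms] by metis
  then show ?thesis unfolding K0_relations_eq by blast
qed

lemma L_carrier: "L \<subseteq> carrier G"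
  using ell_in_relations subsetD[OF K0_relations_carrier] by blast

lemma generate_L_subset: "generate G L \<subseteq> K0_relation_subgroup C I Ts"
  unfolding K0_relation_subgroup_def
  using group.mono_generate[OF group_free_Abelian_group, of L "K0_relations C I Ts"] ell_in_relations by blast

lemma pairing_support_finite:
  assumes "x \<in> generate G L"
  shows "finite {B \<in> J. pairing (hdim B) x \<noteq> 0}"
  using assms
proof (induction rule: generate.induct)
  case one
  then show ?case by (simp add: pairing_0)
next
  case (incl x)
  then obtain A where A: "A \<in> J" "x = ell C I A" by blast
  have "{B \<in> J. pairing (hdim B) x \<noteq> 0} \<subseteq> {A}" using pairing_ell_other A by blast
  then show ?case by (rule finite_subset) simp
next
  case (inv x)
  then obtain A where A: "A \<in> J" "x = ell C I A" by blast
  have "x \<in> carrier G" using inv L_carrier by blast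
  then have "inv\<^bsub>G\<^esub> x = - x" by simp
  moreover have "{B \<in> J. pairing (hdim B) (- x) \<noteq> 0} \<subseteq> {A}"
    using pairing_ell_other A by (auto simp: pairing_minus)
  ultimately have "{B \<in> J. pairing (hdim B) (inv\<^bsub>G\<^esub> x) \<noteq> 0} \<subseteq> {A}" by simp
  then show ?case by (rule finite_subset) simp
next
  case (eng x y)
  have "{B \<in> J. pairing (hdim B) (x \<otimes>\<^bsub>G\<^esub> y) \<noteq> 0} \<subseteq>
    {B \<in> J. pairing (hdim B) x \<noteq> 0} \<union> {B \<in> J. pairing (hdim B) y \<noteq> 0}"
    by (auto simp: pairing_add)
  then show ?case by (rule finite_subset) (use eng.IH in simp)
qed

lemma pairing_combination:
  assumes fin: "finite J" and B: "B \<in> J"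
  shows "pairing (hdim B) (\<Sum>A\<in>J. frag_cmul (c A) (ell C I A)) = c B * pairing (hdim B) (ell C I B)"
proof -
  have "pairing (hdim B) (\<Sum>A\<in>J. frag_cmul (c A) (ell C I A)) = (\<Sum>A\<in>J. c A * pairing (hdim B) (ell C I A))"
    by (simp add: pairing_sum pairing_frag_cmul)
  also have "\<dots> = (\<Sum>A\<in>{B}. c A * pairing (hdim B) (ell C I A))"
    by (rule sum.mono_neutral_right) (use fin B pairing_ell_other in auto)
  finally show ?thesis by simp
qed

lemma generate_L_combination:
  assumes fin: "finite J" and x: "x \<in> generate G L"
  shows "\<exists>c. x = (\<Sum>A\<in>J. frag_cmul (c A) (ell C I A))"
  using x
proof (induction rule: generate.induct)
  case one
  show ?case by (rule exI[of _ "\<lambda>_. 0"]) simp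
next
  case (incl x)
  then obtain A where A: "A \<in> J" "x = ell C I A" by blast
  have "(\<Sum>B\<in>J. frag_cmul (if B = A then 1 else 0) (ell C I B)) = (\<Sum>B\<in>J. if B = A then ell C I A else 0)"
    by (rule sum.cong) auto
  also have "\<dots> = x" using A fin by simp
  finally show ?case by metis
next
  case (inv x)
  then obtain A where A: "A \<in> J" "x = ell C I A" by blast
  have "x \<in> carrier G" using inv L_carrier by blast
  then have "inv\<^bsub>G\<^esub> x = - x" by simp
  moreover have "(\<Sum>B\<in>J. frag_cmul (if B = A then - 1 else 0) (ell C I B)) = (\<Sum>B\<in>J. if B = A then - ell C I A else 0)"
    by (rule sum.cong) auto
  then have "(\<Sum>B\<in>J. frag_cmul (if B = A then - 1 else 0) (ell C I B)) = - x" using A fin by simp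
  ultimately show ?case by metis
next
  case (eng x y)
  then obtain c d where "x = (\<Sum>A\<in>J. frag_cmul (c A) (ell C I A))" "y = (\<Sum>A\<in>J. frag_cmul (d A) (ell C I A))"
    by blast
  then have "x \<otimes>\<^bsub>G\<^esub> y = (\<Sum>A\<in>J. frag_cmul (c A + d A) (ell C I A))"
    by (simp add: frag_cmul_distrib sum.distrib)
  then show ?case by (rule exI[of _ "\<lambda>A. c A + d A"])
qed

lemma L_independent: "\<not> module.dependent frag_cmul L"
proof
  interpret frag: module "frag_cmul :: int \<Rightarrow> ('o \<Rightarrow>\<^sub>0 int) \<Rightarrow> _"
    by unfold_locales (simp_all add: frag_cmul_distrib frag_cmul_distrib2)
  assume "frag.dependent L"
  then obtain t u v0 where t: "finite t" "t \<subseteq> L" "(\<Sum>v\<in>t. frag_cmul (u v) v) = 0" "v0 \<in> t" "u v0 \<noteq> 0"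
    unfolding frag.dependent_explicit by blast
  obtain A where A: "A \<in> J" "v0 = ell C I A" using t(2,4) by blast
  have "0 = pairing (hdim A) (\<Sum>v\<in>t. frag_cmul (u v) v)" using t(3) by (simp add: pairing_0)
  also have "\<dots> = (\<Sum>v\<in>t. u v * pairing (hdim A) v)" by (simp add: pairing_sum pairing_frag_cmul)
  also have "\<dots> = (\<Sum>v\<in>{v0}. u v * pairing (hdim A) v)"
  proof (rule sum.mono_neutral_right[OF t(1)])
    show "\<forall>v\<in>t - {v0}. u v * pairing (hdim A) v = 0"
    proof
      fix v assume v: "v \<in> t - {v0}"
      then obtain B where "B \<in> J" "v = ell C I B" using t(2) by blast
      then show "u v * pairing (hdim A) v = 0" using pairing_ell_other[of B A] A v by auto
    qed
  qed (use t(4) in auto)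
  finally show False using t(5) pairing_ell_self[OF A(1)] A(2) by simp
qed

section \<open>Finite type implies generation\<close>

text \<open>This finds a simple subfunctor of the image of \<open>Hom X -\<close> in \<open>Hom Z (susp -)\<close>.  In the proof, the
  number \<open>N A q\<close> is the total dimension of the subfunctor generated by \<open>q\<close>, and \<open>q\<close> is chosen among the
  nonzero morphisms \<open>smap C p \<cdot> h\<close> such that this dimension is minimal.\<close>

lemma ex_minimal_component:
  assumes fin: "finite I" and h: "h \<in> homs C Z (susp C X)" "h \<noteq> 0"
  obtains A p where "A \<in> I" "p \<in> homs C X A" "smap C p \<cdot> h \<noteq> 0" "almost_vanishing A (smap C p \<cdot> h)"
proof -
  define sub where "sub A q B = (\<lambda>u. smap C u \<cdot> q) ` homs C A B" for A q B
  define N where "N A q = (\<Sum>B\<in>I. vs.dim (sub A q B))" for A q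
  have nonzero_component: "\<exists>B\<in>I. \<exists>r\<in>homs C Y B. smap C r \<cdot> q \<noteq> 0"
    if q: "q \<in> homs C W (susp C Y)" "q \<noteq> 0" for W Y q
  proof (rule ccontr)
    assume n: "\<not> ?thesis"
    obtain Ys where Ys: "set Ys \<subseteq> I" "direct_sum C Y Ys" using ex_decomposition by blast
    obtain i r where ir: "\<And>a. a < length Ys \<Longrightarrow> i a \<in> homs C (Ys ! a) Y"
      "\<And>a. a < length Ys \<Longrightarrow> r a \<in> homs C Y (Ys ! a)" "(\<Sum>a<length Ys. i a \<cdot> r a) = ident C Y"
      using Ys(2) unfolding direct_sum_def by blast
    have "(\<Sum>a<length Ys. smap C (i a) \<cdot> smap C (r a)) = (\<Sum>a<length Ys. smap C (i a \<cdot> r a))"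
      using smap_cmp[OF ir(2,1)] by (intro sum.cong) auto
    also have "\<dots> = smap C (\<Sum>a<length Ys. i a \<cdot> r a)"
      by (rule smap_sum[symmetric]) (use cmp_closed[OF ir(2,1)] in auto)
    finally have s: "(\<Sum>a<length Ys. smap C (i a) \<cdot> smap C (r a)) = ident C (susp C Y)"
      using ir(3) smap_ident by simp
    have "smap C (r a) \<cdot> q = 0" if a: "a < length Ys" for a
      using n ir(2)[OF a] Ys(1) nth_mem[OF a] by blast
    then have "q = 0"
      using sum_component_eq'[OF smap_hom[OF ir(1)] smap_hom[OF ir(2)] s q(1)]
        cmp_0_right[OF smap_hom[OF ir(1)]] by (simp add: sum.neutral)
    then show False using q(2) by simp
  qed
  define Q where "Q = (\<lambda>(A, p). A \<in> I \<and> p \<in> homs C X A \<and> smap C p \<cdot> h \<noteq> 0)"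
  have "\<exists>x. Q x" using nonzero_component[OF h] by (auto simp: Q_def)
  then obtain x where x: "Q x" and least: "\<And>y. Q y \<Longrightarrow> (\<lambda>(A, p). N A (smap C p \<cdot> h)) x \<le> (\<lambda>(A, p). N A (smap C p \<cdot> h)) y"
    using ex_has_least_nat[of Q _ "\<lambda>(A, p). N A (smap C p \<cdot> h)"] by blast
  obtain A p where xAp: "x = (A, p)" by (cases x)
  then have A: "A \<in> I" "p \<in> homs C X A" "smap C p \<cdot> h \<noteq> 0" using x by (auto simp: Q_def)
  have least: "N A (smap C p \<cdot> h) \<le> N B (smap C r \<cdot> h)"
    if "B \<in> I" "r \<in> homs C X B" "smap C r \<cdot> h \<noteq> 0" for B r
    using least[of "(B, r)"] that xAp by (auto simp: Q_def)
  define q where "q = smap C p \<cdot> h"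
  have q: "q \<in> homs C Z (susp C A)" unfolding q_def by (rule cmp_closed[OF h(1) smap_hom[OF A(2)]])
  have lin: "linear_within (scl C) (scl C) (homs C A' B) (\<lambda>u. smap C u \<cdot> q')"
    if q': "q' \<in> homs C Z (susp C A')" for q' A' B
    unfolding linear_within_def
    using smap_add smap_scl cmp_add_left[OF q' smap_hom smap_hom] cmp_scl_left[OF q' smap_hom] by auto
  interpret ll: subspace_theory_pair "scl C" "scl C" ..
  have sub_fin: "ft.fin_subspace (sub A' q' B)" if q': "q' \<in> homs C Z (susp C A')" for q' A' B
    unfolding sub_def by (rule ll.fin_subspace_image[OF hom_fin_subspace lin[OF q']])
  have key: "smap C u \<cdot> q = 0" if B: "B \<in> I" and u: "u \<in> homs C A B" "\<not> section_mor C A B u" for B u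
  proof (rule ccontr)
    assume u0: "smap C u \<cdot> q \<noteq> 0"
    define q' where "q' = smap C u \<cdot> q"
    have q': "q' \<in> homs C Z (susp C B)" unfolding q'_def by (rule cmp_closed[OF q smap_hom[OF u(1)]])
    have act: "smap C w \<cdot> q' = smap C (w \<cdot> u) \<cdot> q" if w: "w \<in> homs C B D" for w D
      unfolding q'_def using cmp_assoc[OF q smap_hom[OF u(1)] smap_hom[OF w]] smap_cmp[OF u(1) w] by simp
    have sub: "sub B q' D \<subseteq> sub A q D" for D
      using act cmp_closed[OF u(1)] by (fastforce simp: sub_def)
    \<comment> \<open>If \<open>q\<close> came back from \<open>q'\<close>, a radical endomorphism of \<open>A\<close> would fix \<open>q\<close>.\<close>
    have "q \<notin> sub B q' A"
    proof
      assume "q \<in> sub B q' A"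
      then obtain w where w: "w \<in> homs C B A" "q = smap C (w \<cdot> u) \<cdot> q" using act by (auto simp: sub_def)
      have wu: "w \<cdot> u \<in> homs C A A" by (rule cmp_closed[OF u(1) w(1)])
      have "\<not> isomorphism C A A (w \<cdot> u)" using section_of_iso_comp[OF u(1) w(1)] u(2) by blast
      then have "isomorphism C A A (ident C A - w \<cdot> u)"
        by (rule local_end_one_minus[OF rep_local_end[OF A(1)] wu])
      then have "isomorphism C (susp C A) (susp C A) (smap C (ident C A - w \<cdot> u))" by (rule smap_isomorphism)
      moreover have d: "ident C A - w \<cdot> u \<in> homs C A A" by (rule hom_diff[OF ident_closed wu])
      ultimately obtain k where k: "k \<in> homs C (susp C A) (susp C A)"
        "k \<cdot> smap C (ident C A - w \<cdot> u) = ident C (susp C A)" by (auto simp: isomorphism_def)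
      have "smap C (ident C A - w \<cdot> u) \<cdot> q = 0"
        using smap_diff[OF ident_closed wu] cmp_diff_left[OF q smap_hom[OF ident_closed] smap_hom[OF wu]]
          smap_ident ident_left[OF q] w(2) by simp
      then have "q = 0"
        using cmp_assoc[OF q smap_hom[OF d] k(1)] k(2) ident_left[OF q] cmp_0_right[OF k(1)] by simp
      then show False using A(3) by (simp add: q_def)
    qed
    moreover have "q \<in> sub A q A"
      unfolding sub_def by (rule image_eqI[of _ _ "ident C A"]) (simp_all add: smap_ident ident_left[OF q] ident_closed)
    ultimately have "sub B q' A \<noteq> sub A q A" by blast
    then have less: "vs.dim (sub B q' A) < vs.dim (sub A q A)"
      using ft.fin_subspace_dim_less[OF sub_fin[OF q] _ sub] sub_fin[OF q'] by (simp add: ft.fin_subspace_def)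
    have le: "vs.dim (sub B q' D) \<le> vs.dim (sub A q D)" for D
    proof (cases "sub B q' D = sub A q D")
      case False
      then show ?thesis
        using ft.fin_subspace_dim_less[OF sub_fin[OF q] _ sub, of D] sub_fin[OF q'] by (simp add: ft.fin_subspace_def)
    qed simp
    have "N B q' < N A q"
      unfolding N_def by (rule sum_strict_mono_ex1[OF fin]) (use le less A(1) in auto)
    moreover have q'_eq: "q' = smap C (u \<cdot> p) \<cdot> h"
      unfolding q'_def q_def
      using cmp_assoc[OF h(1) smap_hom[OF A(2)] smap_hom[OF u(1)]] smap_cmp[OF A(2) u(1)] by simp
    ultimately show False
      using least[OF B cmp_closed[OF A(2) u(1)]] u0 unfolding q'_def[symmetric] by (simp add: q_def)
  qed
  have "almost_vanishing A q"
    unfolding almost_vanishing_def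
  proof (intro allI ballI impI, rule ccontr)
    fix X' u assume u: "u \<in> homs C A X'" "\<not> section_mor C A X' u" "smap C u \<cdot> q \<noteq> 0"
    obtain B r where r: "B \<in> I" "r \<in> homs C X' B" "smap C r \<cdot> (smap C u \<cdot> q) \<noteq> 0"
      using nonzero_component[OF cmp_closed[OF q smap_hom[OF u(1)]] u(3)] by blast
    have "\<not> section_mor C A B (r \<cdot> u)" using section_of_comp[OF u(1) r(2)] u(2) by blast
    then have "smap C (r \<cdot> u) \<cdot> q = 0" by (rule key[OF r(1) cmp_closed[OF u(1) r(2)]])
    then show False
      using r(3) cmp_assoc[OF q smap_hom[OF u(1)] smap_hom[OF r(2)]] smap_cmp[OF u(1) r(2)] by simp
  qed
  then show thesis using that A by (simp add: q_def)
qed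

text \<open>Let \<open>q\<close> be the composite of \<open>h\<close> with the suspension of \<open>p\<close>, where \<open>p\<close> comes from
  \<open>ex_minimal_component\<close>, and let \<open>w : Z' \<rightarrow> Z\<close> be its cocone.  On the one hand \<open>q\<close> factors through the
  almost split triangle of \<open>A\<close> by a retraction, which computes the class of \<open>Z'\<close>.  On the other hand
  \<open>q \<cdot> g = 0\<close>, which splits the octahedron on \<open>h \<cdot> w\<close> and computes the class of its cocone \<open>Y'\<close>.\<close>

lemma defect_step:
  assumes fin: "finite I" and t: "tri C X Y Z f g h" and n: "F_null Z h" and h0: "h \<noteq> 0"
  obtains A Y' Z' f' g' h' where "A \<in> J" "tri C X Y' Z' f' g' h'" "F_null Z' h'"
    "defect X Y Z = ell C I A + defect X Y' Z'"
proof -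
  note th = tri_hom[OF t]
  obtain A p where A: "A \<in> I" "p \<in> homs C X A" "smap C p \<cdot> h \<noteq> 0" "almost_vanishing A (smap C p \<cdot> h)"
    using ex_minimal_component[OF fin th(3) h0] .
  define q where "q = smap C p \<cdot> h"
  have q: "q \<in> homs C Z (susp C A)" unfolding q_def by (rule cmp_closed[OF th(3) smap_hom[OF A(2)]])
  have "A \<notin> addST"
  proof
    assume AS: "A \<in> addST"
    obtain W a b where w: "W \<in> addST" "a \<in> homs C Z W" "b \<in> homs C W (susp C X)" "h = b \<cdot> a"
      using F_null_factors[OF th(3) n] by blast
    have "smap C p \<cdot> b = 0" by (rule addST_susp_hom_zero[OF w(1) AS cmp_closed[OF w(3) smap_hom[OF A(2)]]])
    then show False
      using A(3) w(4) cmp_assoc[OF w(2,3) smap_hom[OF A(2)]] cmp_0_left[OF w(2)] by simp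
  qed
  then have AJ: "A \<in> J" using A(1) by blast
  let ?V = "susp_inv C A"
  obtain E fA gA hA where as: "almost_split C A E ?V fA gA hA"
    and tA: "tri C A E ?V fA gA hA" and l: "ell C I A = defect A E ?V"
    using almost_split_of[OF AJ] by metis
  obtain v s where v: "v \<in> homs C Z ?V" "s \<in> homs C ?V Z" "q = hA \<cdot> v" "v \<cdot> s = ident C ?V"
    using almost_vanishing_factors[OF as susp_inv_isomorphic q] A(3,4) unfolding q_def by blast
  obtain Z' f1 w where t1: "tri C A Z' Z f1 w q" using ex_tri_third[OF q] by blast
  note w = tri_hom2[OF t1]
  obtain Y' f' g' where t2: "tri C X Y' Z' f' g' (h \<cdot> w)" using ex_tri_third[OF cmp_closed[OF w th(3)]] by blast
  have Z': "cls C I Z' = cls C I E + cls C I Z - cls C I ?V"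
    by (rule cls_of_retraction[OF tA v(1,2,4) t1[unfolded v(3)]])
  have "q \<cdot> g = 0"
    unfolding q_def using cmp_assoc[OF th(2,3) smap_hom[OF A(2)]] tri_cmp2[OF t] cmp_0_right[OF smap_hom[OF A(2)]]
    by simp
  then have "direct_sum C Y' [A, Y]" by (rule octahedron_split[OF t t1 t2])
  then have "cls C I Y' = cls C I A + cls C I Y" by (rule cls_direct_sum)
  then have "defect X Y Z = ell C I A + defect X Y' Z'" using Z' by (simp add: l defect_def)
  moreover have "F_null Z' (h \<cdot> w)"
    unfolding F_null_def using n cmp_assoc[OF _ w th(3)] cmp_closed[OF _ w] by (auto simp: F_null_def)
  ultimately show thesis using that[OF AJ t2] by blast
qed

text \<open>The pairings of the defect with the elements of \<open>J\<close> are nonnegative, and each step decreases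
  their sum.\<close>

lemma defect_in_generate_L:
  assumes fin: "finite I" and t: "tri C X Y Z f g h" and n: "F_null Z h"
  shows "defect X Y Z \<in> generate G L"
  using t n
proof (induction "nat (\<Sum>B\<in>J. pairing (hdim B) (defect X Y Z))" arbitrary: Y Z f g h rule: less_induct)
  case less
  show ?case
  proof (cases "h = 0")
    case True
    then have "direct_sum C Y [X, Z]" using less.prems(1) direct_sum_of_tri by simp
    then have "defect X Y Z = \<one>\<^bsub>G\<^esub>" by (simp add: defect_def cls_direct_sum)
    then show ?thesis using generate.one by metis
  next
    case False
    obtain A Y' Z' f' g' h' where s: "A \<in> J" "tri C X Y' Z' f' g' h'" "F_null Z' h'"
      "defect X Y Z = ell C I A + defect X Y' Z'"
      using defect_step[OF fin less.prems False] .
    let ?m = "\<lambda>x. \<Sum>B\<in>J. pairing (hdim B) x"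
    have fJ: "finite J" using fin by simp
    have "?m (ell C I A) > 0"
    proof (rule sum_pos2[OF fJ s(1)])
      show "pairing (hdim A) (ell C I A) > 0" by (rule pairing_ell_self[OF s(1)])
      show "pairing (hdim B) (ell C I A) \<ge> 0" if "B \<in> J" for B
        using pairing_ell_other[OF s(1), of B] pairing_ell_self[OF s(1)] that by (cases "B = A") auto
    qed
    moreover have "?m (defect X Y' Z') \<ge> 0"
      by (rule sum_nonneg) (rule pairing_defect_nonneg[OF s(2,3)])
    moreover have "?m (defect X Y Z) = ?m (ell C I A) + ?m (defect X Y' Z')"
      using s(4) by (simp add: pairing_add sum.distrib)
    ultimately have "nat (?m (defect X Y' Z')) < nat (?m (defect X Y Z))" by simp
    then have "defect X Y' Z' \<in> generate G L" using less.hyps s(2,3) by blast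
    moreover have "ell C I A \<in> generate G L" using s(1) by (intro generate.incl) blast
    ultimately show ?thesis using s(4) generate_add by simp
  qed
qed

lemma finite_imp_generate:
  assumes "finite I"
  shows "generate G L = K0_relation_subgroup C I Ts"
proof
  show "generate G L \<subseteq> K0_relation_subgroup C I Ts" by (rule generate_L_subset)
  have "K0_relations C I Ts \<subseteq> generate G L"
    unfolding K0_relations_eq using defect_in_generate_L[OF assms] by blast
  then show "K0_relation_subgroup C I Ts \<subseteq> generate G L"
    unfolding K0_relation_subgroup_def
    using group.generate_subgroup_incl[OF group_free_Abelian_group _
        group.generate_is_subgroup[OF group_free_Abelian_group L_carrier]] by blast
qed

section \<open>Generation implies finite type\<close>

lemma addT_indecomposable:
  assumes K: "local_end C K"
  shows "X \<in> addT \<Longrightarrow> section_mor C K X s \<Longrightarrow> \<exists>Y\<in>set Ts. isomorphic C K Y"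
proof (induction arbitrary: s rule: add_closure.induct)
  case (base X)
  then have "indecomposable C X" using ct by (auto simp: basic_cluster_tilting_def in_set_conv_nth)
  then have "isomorphism C K X s"
    using section_into_local_iso[OF indecomposable_local_end local_end_ident_nonzero[OF K] base(2)] by blast
  then show ?case using base(1) by (auto simp: isomorphic_def)
next
  case (zero X)
  then obtain r where r: "s \<in> homs C K X" "r \<in> homs C X K" "r \<cdot> s = ident C K" by (auto simp: section_mor_def)
  have "s = 0" by (rule zero_object_hom(2)[OF zero(1) r(1)])
  then show ?case using r(3) cmp_0_right[OF r(2)] local_end_ident_nonzero[OF K] by simp
next
  case (sum X Y Z)
  obtain i1 i2 p1 p2 where d:
    "i1 \<in> homs C X Z" "i2 \<in> homs C Y Z" "p1 \<in> homs C Z X" "p2 \<in> homs C Z Y"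
    "p1 \<cdot> i1 = ident C X" "p1 \<cdot> i2 = 0" "p2 \<cdot> i1 = 0" "p2 \<cdot> i2 = ident C Y"
    "i1 \<cdot> p1 + i2 \<cdot> p2 = ident C Z"
    using direct_sum2E[OF sum.hyps(3)] .
  obtain r where r: "s \<in> homs C K Z" "r \<in> homs C Z K" "r \<cdot> s = ident C K"
    using sum.prems by (auto simp: section_mor_def)
  have c: "p1 \<cdot> s \<in> homs C K X" "p2 \<cdot> s \<in> homs C K Y" "r \<cdot> i1 \<in> homs C X K" "r \<cdot> i2 \<in> homs C Y K"
    using cmp_closed[OF r(1) d(3)] cmp_closed[OF r(1) d(4)] cmp_closed[OF d(1) r(2)] cmp_closed[OF d(2) r(2)]
    by simp_all
  have "s = i1 \<cdot> (p1 \<cdot> s) + i2 \<cdot> (p2 \<cdot> s)"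
    using cmp_add_left[OF r(1) cmp_closed[OF d(3,1)] cmp_closed[OF d(4,2)]] d(9) ident_left[OF r(1)]
      cmp_assoc[OF r(1) d(3,1)] cmp_assoc[OF r(1) d(4,2)] by simp
  then have "r \<cdot> s = r \<cdot> (i1 \<cdot> (p1 \<cdot> s)) + r \<cdot> (i2 \<cdot> (p2 \<cdot> s))"
    using cmp_add_right[OF cmp_closed[OF c(1) d(1)] cmp_closed[OF c(2) d(2)] r(2)] by simp
  then have "isomorphism C K K ((r \<cdot> i1) \<cdot> (p1 \<cdot> s) + (r \<cdot> i2) \<cdot> (p2 \<cdot> s))"
    using r(3) cmp_assoc[OF c(1) d(1) r(2)] cmp_assoc[OF c(2) d(2) r(2)] isomorphism_ident[of K] by simp
  then have "isomorphism C K K ((r \<cdot> i1) \<cdot> (p1 \<cdot> s)) \<or> isomorphism C K K ((r \<cdot> i2) \<cdot> (p2 \<cdot> s))"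
    by (rule local_end_sum[OF K cmp_closed[OF c(1,3)] cmp_closed[OF c(2,4)]])
  then have "section_mor C K X (p1 \<cdot> s) \<or> section_mor C K Y (p2 \<cdot> s)"
    using section_of_iso_comp[OF c(1,3)] section_of_iso_comp[OF c(2,4)] by blast
  then show ?case using sum.IH by blast
next
  case (iso X Y)
  obtain t t' where t: "t \<in> homs C X Y" "t' \<in> homs C Y X" "t \<cdot> t' = ident C Y"
    using iso.hyps(2) by (auto simp: isomorphic_def isomorphism_def)
  have s: "s \<in> homs C K Y" using iso.prems by (auto simp: section_mor_def)
  have "t \<cdot> (t' \<cdot> s) = s" using cmp_assoc[OF s t(2,1)] t(3) ident_left[OF s] by simp
  then have "section_mor C K X (t' \<cdot> s)"
    using section_of_comp[OF cmp_closed[OF s t(2)] t(1)] iso.prems by simp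
  then show ?case by (rule iso.IH)
qed

lemma finite_I_Int_addST: "finite (I \<inter> addST)"
proof -
  define r where "r Y = (SOME A. A \<in> I \<and> isomorphic C A (susp C Y))" for Y
  have "I \<inter> addST \<subseteq> r ` set Ts"
  proof
    fix A assume A: "A \<in> I \<inter> addST"
    obtain K where K: "isomorphic C (susp C K) A" using susp_essentially_surjective by blast
    have "homs C T A = {0}" using A by (simp add: addST_iff)
    then have KT: "K \<in> addT" unfolding addT_iff by (rule homs_zero_isomorphic[OF isomorphic_sym[OF K]])
    have "local_end C K"
      using local_end_susp local_end_isomorphic[OF rep_local_end isomorphic_sym[OF K]] A by blast
    moreover have "section_mor C K K (ident C K)"
      using ident_closed ident_left[OF ident_closed] by (auto simp: section_mor_def)
    ultimately obtain Y where Y: "Y \<in> set Ts" "isomorphic C K Y" using addT_indecomposable KT by blast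
    have "isomorphic C A (susp C Y)"
      by (rule isomorphic_trans[OF isomorphic_sym[OF K] susp_isomorphic[OF Y(2)]])
    then have "r Y \<in> I \<and> isomorphic C (r Y) (susp C Y)"
      unfolding r_def using A by (intro someI[of "\<lambda>A. A \<in> I \<and> isomorphic C A (susp C Y)"]) blast
    then have "isomorphic C (r Y) A"
      using isomorphic_trans[OF _ isomorphic_sym[OF \<open>isomorphic C A (susp C Y)\<close>]] by blast
    then have "r Y = A" using rep_unique A \<open>r Y \<in> I \<and> _\<close> by blast
    then show "A \<in> r ` set Ts" using Y(1) by blast
  qed
  then show ?thesis using finite_subset by blast
qed

text \<open>The triangle \<open>T \<rightarrow> 0 \<rightarrow> susp T\<close> gives a relation that pairs nontrivially with every element of \<open>J\<close>,
  whereas an element of the span of \<open>L\<close> pairs nontrivially with finitely many only.\<close>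

lemma generate_imp_finite:
  assumes gen: "generate G L = K0_relation_subgroup C I Ts"
  shows "finite I"
proof -
  obtain O' where O': "zero_object C O'" using ex_zero_object by blast
  have t: "tri C T O' (susp C T) 0 0 (- smap C (ident C T))" using rotate[OF tri_ident[OF O']] .
  have "homs C T (susp C T) = {0}" using T_in_addT by (simp add: addT_iff)
  then have "F_null (susp C T) (- smap C (ident C T))"
    using cmp_0_right[OF tri_hom3[OF t]] by (auto simp: F_null_def)
  then have "defect T O' (susp C T) \<in> K0_relations C I Ts" unfolding K0_relations_eq using t by blast
  then have "defect T O' (susp C T) \<in> generate G L"
    unfolding gen K0_relation_subgroup_def by (rule generate.incl)
  then have fin: "finite {B \<in> J. pairing (hdim B) (defect T O' (susp C T)) \<noteq> 0}" by (rule pairing_support_finite)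
  have "pairing (hdim B) (defect T O' (susp C T)) \<noteq> 0" if B: "B \<in> J" for B
  proof -
    have "homs C T B \<noteq> {0}" using B by (simp add: addST_iff)
    then obtain u where u: "u \<in> homs C T B" "u \<noteq> 0" using hom_0 by blast
    have "induced T u (ident C T) \<noteq> 0" using u ident_closed ident_right[OF u(1)] by (simp add: induced_def)
    then have "induced T u \<noteq> 0" by auto
    then have ne: "{0} \<noteq> LH T B" using induced_LH[OF u(1)] by blast
    have "{0} \<subseteq> LH T B" using fs.subspace_0[OF LH_subspace] by simp
    then have "fs.dim {0} < fs.dim (LH T B)"
      by (rule fs.fin_subspace_dim_less[OF LH_fin_subspace fs.subspace_single_0 _ ne])
    then have "hdim B T > 0" by (simp add: hdim_eq fs.dim_zero_space)
    moreover have "hdim B (susp C T) \<ge> 0" by (simp add: hdim_eq)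
    moreover have "cls C I O' = 0" using cls_zero_object O' by simp
    ultimately show ?thesis by (simp add: defect_def pairing_add pairing_hdim_cls)
  qed
  then have "{B \<in> J. pairing (hdim B) (defect T O' (susp C T)) \<noteq> 0} = J" by blast
  then have "finite J" using fin by simp
  moreover have "I = J \<union> (I \<inter> addST)" by blast
  ultimately show ?thesis using finite_I_Int_addST by (metis finite_Un)
qed

section \<open>The expansion of kernel elements\<close>

lemma finite_indec_iso_classes: "finite (indec_iso_classes C) \<longleftrightarrow> finite I"
proof -
  let ?c = "\<lambda>A. {Y. isomorphic C A Y}"
  have "inj_on ?c I"
    by (rule inj_onI) (use rep_unique isomorphic_refl isomorphic_sym in blast)
  moreover have "?c ` I = indec_iso_classes C"
  proof (intro equalityI subsetI)
    fix S assume "S \<in> ?c ` I"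
    then show "S \<in> indec_iso_classes C" using rep_indecomposable by (auto simp: indec_iso_classes_def)
  next
    fix S assume "S \<in> indec_iso_classes C"
    then obtain X where X: "indecomposable C X" "S = ?c X" by (auto simp: indec_iso_classes_def)
    obtain A where A: "A \<in> I" "isomorphic C X A" using ex_rep X(1) by blast
    have "?c X = ?c A" using isomorphic_trans isomorphic_sym A(2) by blast
    then show "S \<in> ?c ` I" using A(1) X(2) by blast
  qed
  ultimately show ?thesis using finite_image_iff by metis
qed

lemma kernel_expansion:
  assumes fin: "finite I" and x: "x \<in> generate G L"
  shows "\<forall>A\<in>J. pairing (hdim A) (ell C I A) \<noteq> 0 \<and> pairing (hdim A) (ell C I A) dvd pairing (hdim A) x"
    and "x = (\<Sum>A\<in>J. frag_cmul (pairing (hdim A) x div pairing (hdim A) (ell C I A)) (ell C I A))"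
proof -
  have fJ: "finite J" using fin by simp
  obtain c where c: "x = (\<Sum>A\<in>J. frag_cmul (c A) (ell C I A))" using generate_L_combination[OF fJ x] by blast
  have p: "pairing (hdim A) x = c A * pairing (hdim A) (ell C I A)" if "A \<in> J" for A
    unfolding c by (rule pairing_combination[OF fJ that])
  have nz: "pairing (hdim A) (ell C I A) \<noteq> 0" if "A \<in> J" for A using pairing_ell_self[OF that] by simp
  show "\<forall>A\<in>J. pairing (hdim A) (ell C I A) \<noteq> 0 \<and> pairing (hdim A) (ell C I A) dvd pairing (hdim A) x"
    using p nz by simp
  have "(\<Sum>A\<in>J. frag_cmul (pairing (hdim A) x div pairing (hdim A) (ell C I A)) (ell C I A)) =
    (\<Sum>A\<in>J. frag_cmul (c A) (ell C I A))"
    by (rule sum.cong) (use p nz in simp_all)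
  then show "x = (\<Sum>A\<in>J. frag_cmul (pairing (hdim A) x div pairing (hdim A) (ell C I A)) (ell C I A))"
    using c by simp
qed

end

theorem theorem3p8:
  fixes C :: "('o, 'm::ab_group_add, 'k::field) tri_cat"
    and T :: 'o and Ts :: "'o list" and I :: "'o set"
  assumes "triangulated_category C"
    and "hom_finite C"
    and "krull_schmidt C"
    and "two_calabi_yau C"
    and "basic_cluster_tilting C T Ts"
    and "indec_representatives C I"
  shows
    "let J = I - add_susp C Ts;
         L = {ell C I A | A. A \<in> J};
         ker_g = kernel (K0_split I) (K0_rel C I Ts) (g_proj C I Ts)
     in (finite (indec_iso_classes C) \<longleftrightarrow> generate (K0_split I) L = ker_g) \<and>
        (finite (indec_iso_classes C) \<longrightarrow>
           (generate (K0_split I) L = ker_g \<and> \<not> module.dependent frag_cmul L) \<and>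
           (\<forall>x\<in>ker_g.
              (\<forall>A\<in>J. K0_form C T (ell C I A) (frag_of A) \<noteq> 0 \<and>
                 K0_form C T (ell C I A) (frag_of A) dvd K0_form C T x (frag_of A)) \<and>
              x = (\<Sum>A\<in>J. frag_cmul
                     (K0_form C T x (frag_of A) div K0_form C T (ell C I A) (frag_of A))
                     (ell C I A))))"
proof -
  interpret tc: triangulated_category C by fact
  interpret cluster_tilting_category C I T Ts
    by unfold_locales (fact assms)+
  have "finite I \<longleftrightarrow> generate G L = K0_relation_subgroup C I Ts"
    using finite_imp_generate generate_imp_finite by (rule iffI)
  moreover have "generate G L = K0_relation_subgroup C I Ts \<and> \<not> module.dependent frag_cmul L"
    if "finite I"
    using finite_imp_generate[OF that] L_independent by (rule conjI)
  moreover have "(\<forall>A\<in>J. pairing (hdim A) (ell C I A) \<noteq> 0 \<and>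
        pairing (hdim A) (ell C I A) dvd pairing (hdim A) x) \<and>
      x = (\<Sum>A\<in>J. frag_cmul (pairing (hdim A) x div pairing (hdim A) (ell C I A)) (ell C I A))"
    if "finite I" "x \<in> K0_relation_subgroup C I Ts" for x
  proof -
    have "x \<in> generate G L" using that(2) finite_imp_generate[OF that(1)] by simp
    then show ?thesis by (intro conjI kernel_expansion[OF that(1)])
  qed
  ultimately show ?thesis
    unfolding Let_def K0_form_eq_pairing kernel_eq finite_indec_iso_classes by blast
qed

end
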